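(* For positive integers $n$ and $d$ let $\mathcal{P}(n,d)$ be the set of Frobenius partitions $\lambda=(\lambda_1,\dots,\lambda_m)$ of $n$ with $\lambda_i\le d$ for all $1\le i\le m$. If $d\in\{1,2,3,4\}$, then the values of $|\mathcal{P}(n,d)|$ are eventually periodic in $n$. More precisely: \begin{itemize} \item If $n\ge 3$, then $|\mathcal{P}(n,1)|=0$. \item If $n\ge 5$, then $|\mathcal{P}(n,2)|=1$ when $n$ is odd and $|\mathcal{P}(n,2)|=0$ when $n$ is even. \item If $n\ge 13$, then $|\mathcal{P}(n,3)|=2$ when $n$ is odd and $|\mathcal{P}(n,3)|=0$ when $n$ is even. \item If $n\ge 17$, then $|\mathcal{P}(n,4)|=4$ when $n\equiv 1\pmod 4$, $|\mathcal{P}(n,4)|=2$ when $n\equiv 2\pmod 4$, $|\mathcal{P}(n,4)|=3$ when $n\equiv 3\pmod 4$, and $|\mathcal{P}(n,4)|=0$ when $n\equiv 0\pmod 4$. \end{itemize}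
   Context: All Lie algebras are over $\mathbb{C}$. A partition of the positive integer $n$ is a finite non-increasing sequence $\lambda=(\lambda_1,\dots,\lambda_m)$ of positive integers with sum $n$. Seaweed algebras: let $a_1|\cdots|a_m$ and $b_1|\cdots|b_t$ be two compositions of $n$ (finite sequences of positive integers with sum $n$), and let $V=\mathbb{C}^n$ with basis $e_1,\dots,e_n$. Put $V_i=\mathrm{span}\{e_1,\dots,e_{a_1+\cdots+a_i}\}$ for $0\le i\le m$ (so $V_0=\{0\}$, $V_m=V$) and $W_j=\mathrm{span}\{e_{b_1+\cdots+b_j+1},\dots,e_n\}$ for $0\le j\le t$ (so $W_0=V$, $W_t=\{0\}$). The seaweed algebra of type $\frac{a_1|\cdots|a_m}{b_1|\cdots|b_t}$ is the Lie subalgebra of $\mathfrak{sl}(n)$ (trace-zero $n\times n$ complex matrices, with the commutator bracket) consisting of those matrices that map each $V_i$ into itself and each $W_j$ into itself. Index: for a finite-dimensional Lie algebra $\mathfrak{g}$, $\mathrm{ind}(\mathfrak{g})=\min_{f\in\mathfrak{g}^*}\dim\ker(B_f)$, where $B_f(x,y)=f([x,y])$ for $x,y\in\mathfrak{g}$ and $\ker(B_f)=\{x\in\mathfrak{g}: B_f(x,y)=0\text{ for all }y\in\mathfrak{g}\}$. A partition $\lambda=(\lambda_1,\dots,\lambda_m)$ of $n$ is called a Frobenius partition if the seaweed algebra of type $\frac{\lambda_1|\cdots|\lambda_m}{n}$ (bottom composition with the single part $n$) has index $0$. *)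

theory Defs
  imports "Jordan_Normal_Form.VS_Connect"
begin

section \<open>The index of a Lie algebra\<close>

text \<open>
  A complex Lie algebra is given by its underlying vector space \<open>L\<close> (a module record over
  \<^term>\<open>class_ring :: complex ring\<close>) together with its bracket \<open>br\<close>. Functionals are total
  functions; only their values on the carrier are constrained and used.
\<close>

definition linear_functionals :: "(complex, 'v) module \<Rightarrow> ('v \<Rightarrow> complex) set" where
  "linear_functionals L =
     {f. (\<forall>x\<in>carrier L. \<forall>y\<in>carrier L. f (x \<oplus>\<^bsub>L\<^esub> y) = f x + f y) \<and>
         (\<forall>c. \<forall>x\<in>carrier L. f (c \<odot>\<^bsub>L\<^esub> x) = c * f x)}"

definition form_kernel ::
    "(complex, 'v) module \<Rightarrow> ('v \<Rightarrow> 'v \<Rightarrow> 'v) \<Rightarrow> ('v \<Rightarrow> complex) \<Rightarrow> 'v set" where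
  "form_kernel L br f = {x \<in> carrier L. \<forall>y\<in>carrier L. f (br x y) = 0}"

definition lie_index :: "(complex, 'v) module \<Rightarrow> ('v \<Rightarrow> 'v \<Rightarrow> 'v) \<Rightarrow> nat" where
  "lie_index L br =
     (LEAST k. \<exists>f\<in>linear_functionals L.
        k = vectorspace.dim class_ring (L\<lparr>carrier := form_kernel L br f\<rparr>))"


section \<open>Seaweed algebras\<close>

definition is_composition :: "nat \<Rightarrow> nat list \<Rightarrow> bool" where
  "is_composition n a \<longleftrightarrow> (\<forall>x\<in>set a. 0 < x) \<and> sum_list a = n"

definition commutator :: "complex mat \<Rightarrow> complex mat \<Rightarrow> complex mat" where
  "commutator A B = A * B - B * A"

definition sl :: "nat \<Rightarrow> complex mat set" where
  "sl n = {A \<in> carrier_mat n n. (\<Sum>i<n. A $$ (i, i)) = 0}"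

text \<open>
  Coordinates are counted from 0, so the basis vector \<open>e\<^sub>k\<close> is \<open>unit_vec n (k - 1)\<close>.
\<close>

definition coord_span :: "nat \<Rightarrow> nat set \<Rightarrow> complex vec set" where
  "coord_span n I = LinearCombinations.module.span class_ring (module_vec TYPE(complex) n) (unit_vec n ` I)"

definition upper_flag :: "nat \<Rightarrow> nat list \<Rightarrow> nat \<Rightarrow> complex vec set" where
  "upper_flag n a i = coord_span n {..<sum_list (take i a)}"

definition lower_flag :: "nat \<Rightarrow> nat list \<Rightarrow> nat \<Rightarrow> complex vec set" where
  "lower_flag n b j = coord_span n {sum_list (take j b)..<n}"

definition preserves :: "complex mat \<Rightarrow> complex vec set \<Rightarrow> bool" where
  "preserves A W \<longleftrightarrow> (\<forall>v\<in>W. A *\<^sub>v v \<in> W)"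

text \<open>Meaningful when \<open>a\<close> and \<open>b\<close> are compositions of \<open>n\<close>.\<close>

definition seaweed :: "nat \<Rightarrow> nat list \<Rightarrow> nat list \<Rightarrow> complex mat set" where
  "seaweed n a b =
     {A \<in> sl n. (\<forall>i\<le>length a. preserves A (upper_flag n a i)) \<and>
                (\<forall>j\<le>length b. preserves A (lower_flag n b j))}"

definition seaweed_space :: "nat \<Rightarrow> nat list \<Rightarrow> nat list \<Rightarrow> (complex, complex mat) module" where
  "seaweed_space n a b = (module_mat TYPE(complex) n n)\<lparr>carrier := seaweed n a b\<rparr>"

definition seaweed_index :: "nat \<Rightarrow> nat list \<Rightarrow> nat list \<Rightarrow> nat" where
  "seaweed_index n a b = lie_index (seaweed_space n a b) commutator"


section \<open>Frobenius partitions\<close>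

definition is_partition :: "nat \<Rightarrow> nat list \<Rightarrow> bool" where
  "is_partition n l \<longleftrightarrow> is_composition n l \<and> sorted_wrt (\<ge>) l"

definition frobenius_partition :: "nat \<Rightarrow> nat list \<Rightarrow> bool" where
  "frobenius_partition n l \<longleftrightarrow> is_partition n l \<and> seaweed_index n l [n] = 0"

definition frobenius_partitions_le :: "nat \<Rightarrow> nat \<Rightarrow> nat list set" where
  "frobenius_partitions_le n d = {l. frobenius_partition n l \<and> (\<forall>x\<in>set l. x \<le> d)}"


section \<open>Well-definedness\<close>

lemma submodule_coord_span:
  assumes "I \<subseteq> {..<n}"
  shows "submodule class_ring (coord_span n I) (module_vec TYPE(complex) n)"
proof -
  interpret vec_module "TYPE(complex)" n .
  have "unit_vec n ` I \<subseteq> carrier_vec n" by auto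
  then show ?thesis unfolding coord_span_def by (rule span_is_submodule)
qed

lemma coord_span_closed:
  assumes "I \<subseteq> {..<n}"
  shows "coord_span n I \<subseteq> carrier_vec n"
    and "0\<^sub>v n \<in> coord_span n I"
    and "v \<in> coord_span n I \<Longrightarrow> w \<in> coord_span n I \<Longrightarrow> v + w \<in> coord_span n I"
    and "v \<in> coord_span n I \<Longrightarrow> c \<cdot>\<^sub>v v \<in> coord_span n I"
  using submodule_coord_span[OF assms] unfolding submodule_def
  by (auto simp: module_vec_simps)

lemma preserves_coord_span_closed:
  assumes I: "I \<subseteq> {..<n}" and A: "A \<in> carrier_mat n n" and B: "B \<in> carrier_mat n n"
    and pA: "preserves A (coord_span n I)" and pB: "preserves B (coord_span n I)"
  shows "preserves (A + B) (coord_span n I)"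
    and "preserves (A * B) (coord_span n I)"
    and "preserves (c \<cdot>\<^sub>m A) (coord_span n I)"
    and "preserves (A - B) (coord_span n I)"
proof -
  note cl = coord_span_closed[OF I]
  show "preserves (A + B) (coord_span n I)"
    unfolding preserves_def
  proof
    fix v assume v: "v \<in> coord_span n I"
    then have "v \<in> carrier_vec n" using cl(1) by auto
    then have "(A + B) *\<^sub>v v = A *\<^sub>v v + B *\<^sub>v v" using A B by (rule add_mult_distrib_mat_vec[rotated 2])
    then show "(A + B) *\<^sub>v v \<in> coord_span n I"
      using v pA pB cl(3) unfolding preserves_def by simp
  qed
  show "preserves (A * B) (coord_span n I)"
    unfolding preserves_def
  proof
    fix v assume v: "v \<in> coord_span n I"
    then have "v \<in> carrier_vec n" using cl(1) by auto
    then have "(A * B) *\<^sub>v v = A *\<^sub>v (B *\<^sub>v v)" using A B by (rule assoc_mult_mat_vec[rotated 2])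
    then show "(A * B) *\<^sub>v v \<in> coord_span n I"
      using v pA pB unfolding preserves_def by simp
  qed
  show "preserves (c \<cdot>\<^sub>m A) (coord_span n I)"
    unfolding preserves_def
  proof
    fix v assume v: "v \<in> coord_span n I"
    then have "v \<in> carrier_vec n" using cl(1) by auto
    then have "(c \<cdot>\<^sub>m A) *\<^sub>v v = c \<cdot>\<^sub>v (A *\<^sub>v v)" using A by auto
    then show "(c \<cdot>\<^sub>m A) *\<^sub>v v \<in> coord_span n I"
      using v pA cl(4) unfolding preserves_def by simp
  qed
  show "preserves (A - B) (coord_span n I)"
    unfolding preserves_def
  proof
    fix v assume v: "v \<in> coord_span n I"
    then have vc: "v \<in> carrier_vec n" using cl(1) by auto
    have "(A - B) *\<^sub>v v = A *\<^sub>v v - B *\<^sub>v v" using A B vc by (rule minus_mult_distrib_mat_vec)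
    also have "\<dots> = A *\<^sub>v v + (- 1) \<cdot>\<^sub>v (B *\<^sub>v v)" using A B vc by (intro eq_vecI) auto
    finally show "(A - B) *\<^sub>v v \<in> coord_span n I"
      using v pA pB cl(3,4) unfolding preserves_def by simp
  qed
qed

lemma flags_coord_span:
  fixes a :: "nat list"
  assumes "sum_list a = n"
  shows "{..<sum_list (take i a)} \<subseteq> {..<n}" "{sum_list (take i a)..<n} \<subseteq> {..<n}"
proof -
  have "sum_list (take i a) + sum_list (drop i a) = n"
    using assms by (metis append_take_drop_id sum_list_append)
  then have "sum_list (take i a) \<le> n" by linarith
  then show "{..<sum_list (take i a)} \<subseteq> {..<n}"
    by (simp add: lessThan_subset_iff)
qed auto

lemma trace_mult_comm:
  assumes "A \<in> carrier_mat n n" "B \<in> carrier_mat n n"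
  shows "(\<Sum>i<n. (A * B) $$ (i, i)) = (\<Sum>i<n. (B * A) $$ (i, i) :: complex)"
proof -
  have "(\<Sum>i<n. (A * B) $$ (i, i)) = (\<Sum>i<n. \<Sum>k<n. A $$ (i, k) * B $$ (k, i))"
    using assms by (intro sum.cong) (auto simp: scalar_prod_def atLeast0LessThan)
  also have "\<dots> = (\<Sum>k<n. \<Sum>i<n. B $$ (k, i) * A $$ (i, k))"
    by (subst sum.swap) (simp add: mult.commute)
  also have "\<dots> = (\<Sum>i<n. (B * A) $$ (i, i))"
    using assms by (intro sum.cong) (auto simp: scalar_prod_def atLeast0LessThan)
  finally show ?thesis .
qed

lemma sl_closed:
  shows "0\<^sub>m n n \<in> sl n"
    and "A \<in> sl n \<Longrightarrow> B \<in> sl n \<Longrightarrow> A + B \<in> sl n"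
    and "A \<in> sl n \<Longrightarrow> c \<cdot>\<^sub>m A \<in> sl n"
    and "A \<in> sl n \<Longrightarrow> B \<in> sl n \<Longrightarrow> commutator A B \<in> sl n"
proof -
  show "0\<^sub>m n n \<in> sl n" by (simp add: sl_def)
  show "A + B \<in> sl n" if "A \<in> sl n" "B \<in> sl n"
  proof -
    have "(\<Sum>i<n. (A + B) $$ (i, i)) = (\<Sum>i<n. A $$ (i, i) + B $$ (i, i))"
      using that by (intro sum.cong) (auto simp: sl_def)
    then show ?thesis using that by (simp add: sl_def sum.distrib)
  qed
  show "c \<cdot>\<^sub>m A \<in> sl n" if "A \<in> sl n"
  proof -
    have "(\<Sum>i<n. (c \<cdot>\<^sub>m A) $$ (i, i)) = (\<Sum>i<n. c * A $$ (i, i))"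
      using that by (intro sum.cong) (auto simp: sl_def)
    then show ?thesis using that by (simp add: sl_def flip: sum_distrib_left)
  qed
  show "commutator A B \<in> sl n" if "A \<in> sl n" "B \<in> sl n"
  proof -
    have c: "A \<in> carrier_mat n n" "B \<in> carrier_mat n n" using that by (simp_all add: sl_def)
    have "(\<Sum>i<n. commutator A B $$ (i, i)) = (\<Sum>i<n. (A * B) $$ (i, i) - (B * A) $$ (i, i))"
      using c by (intro sum.cong) (simp_all add: commutator_def)
    also have "\<dots> = 0" using trace_mult_comm[OF c] by (simp add: sum_subtractf)
    finally show ?thesis using c by (simp add: sl_def commutator_def minus_carrier_mat)
  qed
qed

lemma seaweed_subspace:
  assumes "sum_list a = n" "sum_list b = n"
  shows "subspace class_ring (seaweed n a b) (module_mat TYPE(complex) n n)"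
proof -
  have V: "vectorspace (class_ring :: complex ring) (module_mat TYPE(complex) n n)"
    by (rule matrix_vs)
  note fl = flags_coord_span(1)[OF assms(1)] flags_coord_span(2)[OF assms(2)]
  have sub: "A \<in> carrier_mat n n" if "A \<in> seaweed n a b" for A
    using that by (simp add: seaweed_def sl_def)
  have add: "A + B \<in> seaweed n a b" if "A \<in> seaweed n a b" "B \<in> seaweed n a b" for A B
    using that sub[OF that(1)] sub[OF that(2)] sl_closed(2) fl preserves_coord_span_closed(1)
    by (simp add: seaweed_def upper_flag_def lower_flag_def)
  have smult: "c \<cdot>\<^sub>m A \<in> seaweed n a b" if "A \<in> seaweed n a b" for c A
    using that sub[OF that] sl_closed(3) fl
      preserves_coord_span_closed(3)[OF _ sub[OF that] sub[OF that]]
    by (simp add: seaweed_def upper_flag_def lower_flag_def)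
  have zero: "0\<^sub>m n n \<in> seaweed n a b"
  proof -
    have "preserves (0\<^sub>m n n) (coord_span n I)" if I: "I \<subseteq> {..<n}" for I
      unfolding preserves_def
    proof
      fix v assume "v \<in> coord_span n I"
      then have "v \<in> carrier_vec n" using coord_span_closed(1)[OF I] by auto
      then have "0\<^sub>m n n *\<^sub>v v = 0\<^sub>v n" by auto
      then show "0\<^sub>m n n *\<^sub>v v \<in> coord_span n I" using coord_span_closed(2)[OF I] by simp
    qed
    then show ?thesis using sl_closed(1) fl
      by (simp add: seaweed_def upper_flag_def lower_flag_def)
  qed
  show ?thesis
    unfolding subspace_def submodule_def
    using V sub add smult zero by (auto simp: vectorspace_def module_mat_simps)
qed

lemma seaweed_commutator:
  assumes "sum_list a = n" "sum_list b = n" "A \<in> seaweed n a b" "B \<in> seaweed n a b"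
  shows "commutator A B \<in> seaweed n a b"
proof -
  have c: "A \<in> carrier_mat n n" "B \<in> carrier_mat n n" using assms by (auto simp: seaweed_def sl_def)
  have "preserves (commutator A B) (coord_span n I)"
    if "I \<subseteq> {..<n}" "preserves A (coord_span n I)" "preserves B (coord_span n I)" for I
    unfolding commutator_def using that c by (intro preserves_coord_span_closed) auto
  then show ?thesis
    using assms flags_coord_span(1)[OF assms(1)] flags_coord_span(2)[OF assms(2)] sl_closed(4)
    by (simp add: seaweed_def upper_flag_def lower_flag_def)
qed

lemma finite_frobenius_partitions_le: "finite (frobenius_partitions_le n d)"
proof (rule finite_subset)
  show "frobenius_partitions_le n d \<subseteq> {l. set l \<subseteq> {..d} \<and> length l \<le> n}"
  proof
    fix l assume "l \<in> frobenius_partitions_le n d"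
    then have p: "\<forall>x\<in>set l. 0 < x" "sum_list l = n" "\<forall>x\<in>set l. x \<le> d"
      by (auto simp: frobenius_partitions_le_def frobenius_partition_def is_partition_def
          is_composition_def)
    have "length l \<le> sum_list l" using p(1) by (induction l) auto
    with p show "l \<in> {l. set l \<subseteq> {..d} \<and> length l \<le> n}" by auto
  qed
  show "finite {l. set l \<subseteq> {..d} \<and> length l \<le> n}" by (rule finite_lists_length_le) simp
qed

end

theory Submission
  imports Defs
begin

text \<open>
  The index of a seaweed algebra can be computed by a Euclidean type algorithm on the two compositions
  (Dergachev and Kirillov; in the inductive form used here, Panyushev), and for partitions with small
  parts this algorithm can be followed uniformly in \<open>n\<close>.

  Adding the identity matrix to the seaweed algebra gives an associative algebra, the matrices with
  support in a preorder, and each functional has the form \<open>x \<mapsto> tr (F x)\<close>. The index is 0 iff for some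
  \<open>F\<close>, called a brick, the only \<open>x\<close> with \<open>tr (F [x, y]) = 0\<close> for all \<open>y\<close> are the scalars
  (\<open>frobenius_partition_iff\<close>).

  Let \<open>x < y\<close> be the first blocks of the two compositions. The maps from the last \<open>y - x\<close> vectors of
  the longer block to the first \<open>x\<close> form an abelian ideal. If \<open>F\<close> is a brick, its part dual to this
  ideal must have full rank and be in general position to the flag, so elementary operations bring it
  to a standard partial permutation matrix (\<open>normal_form_exists\<close>). Its stabiliser is the seaweed algebra
  of a smaller type, and bricks correspond on both sides (\<open>has_brick_reduced\<close>). On compositions this
  becomes \<open>frob_wide\<close> if \<open>2 x \<le> y\<close> and \<open>frob_narrow\<close> otherwise. The compositions may be exchanged
  (transposition) or both be reversed, and if the first blocks are equal there is a brick only for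
  type \<open>1\<close> over \<open>1\<close> (\<open>frob_equal\<close>).

  The number of odd parts is invariant and ends at 2 (\<open>frob_odds\<close>). So a Frobenius partition of \<open>n\<close>
  with parts at most 4 has, besides parts 4 and 2, exactly one odd part if \<open>n\<close> is odd and exactly two
  if \<open>n\<close> is even. A few moves at the ends of the compositions settle each such shape. Writing
  exponents for multiplicities, for large \<open>n\<close> there remain \<open>2\<^sup>q 1\<close> and \<open>3 2\<^sup>q\<close> for each odd \<open>n\<close>,
  \<open>4\<^sup>p 1\<close> and \<open>4\<^sup>p 3 2\<close> for \<open>n \<equiv> 1\<close> modulo 4, \<open>4\<^sup>p 1 1\<close> and \<open>4\<^sup>p 3 3\<close> for \<open>n \<equiv> 2\<close>, and \<open>4\<^sup>p 3\<close>
  for \<open>n \<equiv> 3\<close>. Counting them by the largest part gives the theorem.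
\<close>

section \<open>Bricks\<close>

text \<open>
  Matrices indexed by an arbitrary set \<open>I\<close> are plain functions.
\<close>

definition mprod :: "'i set \<Rightarrow> ('i \<Rightarrow> 'i \<Rightarrow> complex) \<Rightarrow> ('i \<Rightarrow> 'i \<Rightarrow> complex) \<Rightarrow> 'i \<Rightarrow> 'i \<Rightarrow> complex" where
  "mprod I x y = (\<lambda>i j. \<Sum>k\<in>I. x i k * y k j)"

text \<open>
  A preorder \<open>R\<close> on \<open>I\<close> cuts out the
  associative algebra of the matrices supported in \<open>R\<close>; the full seaweed algebra, without the trace
  condition, is of this form. A matrix \<open>F\<close> stands for the functional \<open>x \<mapsto> tr (F x)\<close>, so only the
  entries of \<open>F\<close> at positions \<open>(l, k)\<close> with \<open>R k l\<close> matter, and \<open>x\<close> lies in the kernel of the form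
  \<open>(x, y) \<mapsto> tr (F [x, y])\<close> iff \<open>[F, x]\<close> vanishes at all these positions.
\<close>

definition supported :: "'i set \<Rightarrow> ('i \<Rightarrow> 'i \<Rightarrow> bool) \<Rightarrow> ('i \<Rightarrow> 'i \<Rightarrow> complex) \<Rightarrow> bool" where
  "supported I R x \<longleftrightarrow> (\<forall>k\<in>I. \<forall>l\<in>I. x k l \<noteq> 0 \<longrightarrow> R k l)"

definition centralizes :: "'i set \<Rightarrow> ('i \<Rightarrow> 'i \<Rightarrow> bool) \<Rightarrow> ('i \<Rightarrow> 'i \<Rightarrow> complex) \<Rightarrow> ('i \<Rightarrow> 'i \<Rightarrow> complex) \<Rightarrow> bool" where
  "centralizes I R F x \<longleftrightarrow> (\<forall>k\<in>I. \<forall>l\<in>I. R k l \<longrightarrow> mprod I F x l k = mprod I x F l k)"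

definition scalar_on :: "'i set \<Rightarrow> ('i \<Rightarrow> 'i \<Rightarrow> complex) \<Rightarrow> bool" where
  "scalar_on I x \<longleftrightarrow> (\<exists>c. \<forall>k\<in>I. \<forall>l\<in>I. x k l = (if k = l then c else 0))"

text \<open>
  The identity always lies in the kernel. A functional is called a brick, as in representation
  theory, if its kernel consists of the scalars only.
\<close>

definition brick :: "'i set \<Rightarrow> ('i \<Rightarrow> 'i \<Rightarrow> bool) \<Rightarrow> ('i \<Rightarrow> 'i \<Rightarrow> complex) \<Rightarrow> bool" where
  "brick I R F \<longleftrightarrow> (\<forall>x. supported I R x \<longrightarrow> centralizes I R F x \<longrightarrow> scalar_on I x)"

definition has_brick :: "'i set \<Rightarrow> ('i \<Rightarrow> 'i \<Rightarrow> bool) \<Rightarrow> bool" where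
  "has_brick I R \<longleftrightarrow> (\<exists>F. brick I R F)"

lemma mprod_assoc: "mprod I (mprod I x y) z = mprod I x (mprod I y z)"
proof (intro ext)
  fix i j
  show "mprod I (mprod I x y) z i j = mprod I x (mprod I y z) i j"
    unfolding mprod_def sum_distrib_left sum_distrib_right
    by (subst sum.swap) (simp add: mult.assoc)
qed

lemma mprod_cong:
  assumes "\<And>k. k \<in> I \<Longrightarrow> x i k = x' i k" "\<And>k. k \<in> I \<Longrightarrow> y k j = y' k j"
  shows "mprod I x y i j = mprod I x' y' i j"
  using assms by (simp add: mprod_def)

lemma mprod_scalar:
  assumes "finite I" "\<And>k l. k \<in> I \<Longrightarrow> l \<in> I \<Longrightarrow> x k l = (if k = l then c else 0)" "i \<in> I" "j \<in> I"
  shows "mprod I x y i j = c * y i j" "mprod I y x i j = c * y i j"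
proof -
  have "mprod I x y i j = (\<Sum>k\<in>I. if i = k then c * y k j else 0)"
    unfolding mprod_def by (rule sum.cong) (use assms in auto)
  then show "mprod I x y i j = c * y i j" using assms by simp
  have "mprod I y x i j = (\<Sum>k\<in>I. if k = j then c * y i k else 0)"
    unfolding mprod_def by (rule sum.cong) (use assms in auto)
  then show "mprod I y x i j = c * y i j" using assms by simp
qed

lemma brick_bij:
  assumes h: "bij_betw h I I'" and R: "\<And>k l. k \<in> I \<Longrightarrow> l \<in> I \<Longrightarrow> R k l \<longleftrightarrow> R' (h k) (h l)"
    and b: "brick I R (\<lambda>i j. F (h i) (h j))"
  shows "brick I' R' F"
  unfolding brick_def
proof (intro allI impI)
  fix x assume s: "supported I' R' x" and c: "centralizes I' R' F x"
  have hI: "h k \<in> I'" if "k \<in> I" for k using h that by (auto simp: bij_betw_def)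
  have prod: "mprod I (\<lambda>i j. y (h i) (h j)) (\<lambda>i j. z (h i) (h j)) i j = mprod I' y z (h i) (h j)"
    for y z :: "'b \<Rightarrow> 'b \<Rightarrow> complex" and i j
    unfolding mprod_def using sum.reindex_bij_betw[OF h, of "\<lambda>k. y (h i) k * z k (h j)"] by simp
  have "supported I R (\<lambda>i j. x (h i) (h j))"
    using s R hI unfolding supported_def by blast
  moreover have "centralizes I R (\<lambda>i j. F (h i) (h j)) (\<lambda>i j. x (h i) (h j))"
    using c R hI unfolding centralizes_def prod by blast
  ultimately have "scalar_on I (\<lambda>i j. x (h i) (h j))" using b unfolding brick_def by blast
  then obtain c where c: "\<And>k l. k \<in> I \<Longrightarrow> l \<in> I \<Longrightarrow> x (h k) (h l) = (if k = l then c else 0)"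
    unfolding scalar_on_def by blast
  have "x k l = (if k = l then c else 0)" if kl: "k \<in> I'" "l \<in> I'" for k l
  proof -
    obtain k' l' where "k' \<in> I" "l' \<in> I" "k = h k'" "l = h l'"
      using h kl by (auto simp: bij_betw_def)
    moreover have "(h k' = h l') = (k' = l')" using h calculation by (auto simp: bij_betw_def inj_on_def)
    ultimately show ?thesis using c by auto
  qed
  then show "scalar_on I' x" unfolding scalar_on_def by blast
qed

lemma has_brick_bij:
  assumes h: "bij_betw h I I'" and R: "\<And>k l. k \<in> I \<Longrightarrow> l \<in> I \<Longrightarrow> R k l \<longleftrightarrow> R' (h k) (h l)"
  shows "has_brick I R \<longleftrightarrow> has_brick I' R'"
proof
  have inv: "h (inv_into I h k) = k" if "k \<in> I'" for k
    using h that by (auto simp: bij_betw_def f_inv_into_f)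
  have inv': "inv_into I h (h k) = k" if "k \<in> I" for k
    using h that by (auto simp: bij_betw_def)
  have h': "bij_betw (inv_into I h) I' I" using h by (rule bij_betw_inv_into)
  have iI: "inv_into I h k \<in> I" if "k \<in> I'" for k
    using h' that by (auto simp: bij_betw_def)
  {
    assume "has_brick I R"
    then obtain F where F: "brick I R F" unfolding has_brick_def by blast
    have "brick I R (\<lambda>i j. F (inv_into I h (h i)) (inv_into I h (h j)))"
    proof (rule brick_bij[of id I I R])
      show "brick I R (\<lambda>i j. F (inv_into I h (h (id i))) (inv_into I h (h (id j))))"
        using F unfolding brick_def centralizes_def mprod_def
        by (simp add: inv' cong: sum.cong)
    qed auto
    then have "brick I' R' (\<lambda>i j. F (inv_into I h i) (inv_into I h j))"
      by (intro brick_bij[OF h, where R = R and R' = R'] R)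
    then show "has_brick I' R'" unfolding has_brick_def by blast
  next
    assume "has_brick I' R'"
    then obtain F where F: "brick I' R' F" unfolding has_brick_def by blast
    have "brick I R (\<lambda>i j. F (h i) (h j))"
    proof (rule brick_bij[OF h'])
      show "R' k l = R (inv_into I h k) (inv_into I h l)" if "k \<in> I'" "l \<in> I'" for k l
        using R[OF iI[OF that(1)] iI[OF that(2)]] inv that by simp
      show "brick I' R' (\<lambda>i j. F (h (inv_into I h i)) (h (inv_into I h j)))"
        using F unfolding brick_def centralizes_def mprod_def
        by (simp add: inv cong: sum.cong)
    qed
    then show "has_brick I R" unfolding has_brick_def by blast
  }
qed

lemma brick_transpose:
  assumes "brick I R F"
  shows "brick I (\<lambda>k l. R l k) (\<lambda>i j. F j i)"
  unfolding brick_def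
proof (intro allI impI)
  fix x assume "supported I (\<lambda>k l. R l k) x" and c: "centralizes I (\<lambda>k l. R l k) (\<lambda>i j. F j i) x"
  then have "supported I R (\<lambda>i j. x j i)" unfolding supported_def by blast
  moreover have "centralizes I R F (\<lambda>i j. x j i)"
    using c unfolding centralizes_def mprod_def by (simp add: mult.commute)
  ultimately have "scalar_on I (\<lambda>i j. x j i)" using assms unfolding brick_def by blast
  then show "scalar_on I x" unfolding scalar_on_def by metis
qed

lemma has_brick_transpose: "has_brick I (\<lambda>k l. R l k) \<longleftrightarrow> has_brick I R"
  using brick_transpose[of I R] brick_transpose[of I "\<lambda>k l. R l k"]
  unfolding has_brick_def by blast

text \<open>
  The positions \<open>(l, k)\<close> with \<open>R k l\<close> are those of the dual, and the matrices vanishing there form a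
  bimodule over the algebra. Hence conjugating by a unit of the algebra preserves kernels.
\<close>

lemma brick_conj:
  assumes fin: "finite I" and tr: "\<And>i j k. i \<in> I \<Longrightarrow> j \<in> I \<Longrightarrow> k \<in> I \<Longrightarrow> R i j \<Longrightarrow> R j k \<Longrightarrow> R i k"
    and g: "supported I R g" and g': "supported I R g'"
    and gg': "\<And>i j. i \<in> I \<Longrightarrow> j \<in> I \<Longrightarrow> mprod I g g' i j = (if i = j then 1 else 0)"
    and g'g: "\<And>i j. i \<in> I \<Longrightarrow> j \<in> I \<Longrightarrow> mprod I g' g i j = (if i = j then 1 else 0)"
    and F: "brick I R F"
  shows "brick I R (mprod I g (mprod I F g'))"
  unfolding brick_def
proof (intro allI impI)
  fix x assume s: "supported I R x" and c: "centralizes I R (mprod I g (mprod I F g')) x"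
  let ?F = "mprod I g (mprod I F g')" and ?y = "mprod I g' (mprod I x g)"
  have unit: "mprod I (mprod I g g') z i j = z i j" "mprod I (mprod I g' g) z i j = z i j"
    "mprod I z (mprod I g g') i j = z i j" "mprod I z (mprod I g' g) i j = z i j"
    if "i \<in> I" "j \<in> I" for i j z
    using mprod_scalar[OF fin gg' that] mprod_scalar[OF fin g'g that] by simp_all
  have mult: "supported I R (mprod I u v)" if u: "supported I R u" and v: "supported I R v" for u v
    unfolding supported_def
  proof (intro ballI impI)
    fix k l assume kl: "k \<in> I" "l \<in> I" and "mprod I u v k l \<noteq> 0"
    then obtain m where "m \<in> I" "u k m * v m l \<noteq> 0"
      unfolding mprod_def by (meson sum.neutral)
    then show "R k l" using u v tr[of k m l] kl unfolding supported_def by auto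
  qed
  have sy: "supported I R ?y" by (intro mult g' s g)
  have "mprod I F ?y l k = mprod I ?y F l k" if kl: "k \<in> I" "l \<in> I" "R k l" for k l
  proof -
    let ?D = "\<lambda>i j. mprod I ?F x i j - mprod I x ?F i j"
    have z: "mprod I g' (mprod I ?D g) l k = 0"
      unfolding mprod_def[of I g'] mprod_def[of I ?D] sum_distrib_left
    proof (intro sum.neutral ballI)
      fix i j assume ij: "i \<in> I" "j \<in> I"
      show "g' l i * (?D i j * g j k) = 0"
      proof (rule ccontr)
        assume nz: "g' l i * (?D i j * g j k) \<noteq> 0"
        then have "R l i" "R j k" using g g' ij kl unfolding supported_def by auto
        then have "R j i" using tr[of j k l] tr[of j l i] ij kl by blast
        then have "?D i j = 0" using c ij unfolding centralizes_def by auto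
        then show False using nz by simp
      qed
    qed
    have "mprod I g' (mprod I ?D g) l k
        = mprod I g' (mprod I (mprod I ?F x) g) l k - mprod I g' (mprod I (mprod I x ?F) g) l k"
      unfolding mprod_def[of I g'] mprod_def[of I _ g]
      by (simp add: left_diff_distrib right_diff_distrib sum_subtractf)
    moreover have "mprod I g' (mprod I (mprod I ?F x) g) l k = mprod I F ?y l k"
    proof -
      have "mprod I g' (mprod I (mprod I ?F x) g) = mprod I (mprod I g' g) (mprod I F ?y)"
        by (simp add: mprod_assoc)
      then show ?thesis using unit kl by simp
    qed
    moreover have "mprod I g' (mprod I (mprod I x ?F) g) l k = mprod I ?y F l k"
    proof -
      have "mprod I g' (mprod I (mprod I x ?F) g) = mprod I (mprod I ?y F) (mprod I g' g)"
        by (simp add: mprod_assoc)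
      then show ?thesis using unit kl by simp
    qed
    ultimately show ?thesis using z by simp
  qed
  then have "centralizes I R F ?y" unfolding centralizes_def by blast
  then obtain c where c: "\<And>k l. k \<in> I \<Longrightarrow> l \<in> I \<Longrightarrow> ?y k l = (if k = l then c else 0)"
    using F sy unfolding brick_def scalar_on_def by blast
  have "x k l = (if k = l then c else 0)" if kl: "k \<in> I" "l \<in> I" for k l
  proof -
    have "mprod I g (mprod I ?y g') k l = c * mprod I g g' k l"
    proof -
      have "mprod I g (mprod I ?y g') k l = mprod I g (\<lambda>i j. c * g' i j) k l"
        by (rule mprod_cong) (use mprod_scalar(1)[OF fin c] kl in auto)
      then show ?thesis by (simp add: mprod_def sum_distrib_left mult.left_commute)
    qed
    moreover have "mprod I g (mprod I ?y g') = mprod I (mprod I g g') (mprod I x (mprod I g g'))"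
      by (simp add: mprod_assoc)
    ultimately show ?thesis using unit kl gg' by simp
  qed
  then show "scalar_on I x" unfolding scalar_on_def by blast
qed

text \<open>
  The identity with row \<open>r\<close> replaced by \<open>u\<close>. Conjugation by such a matrix is
  one step of Gaussian elimination; these are the only units that the elimination below needs.
\<close>

definition row_replaced :: "'i \<Rightarrow> ('i \<Rightarrow> complex) \<Rightarrow> 'i \<Rightarrow> 'i \<Rightarrow> complex" where
  "row_replaced r u = (\<lambda>i j. if i = r then u j else if i = j then 1 else 0)"

lemma mprod_row_replaced_left:
  assumes "finite I" "i \<in> I"
  shows "mprod I (row_replaced r u) y i j = (if i = r then (\<Sum>k\<in>I. u k * y k j) else y i j)"
proof (cases "i = r")
  case False
  then have "mprod I (row_replaced r u) y i j = (\<Sum>k\<in>I. if i = k then y k j else 0)"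
    unfolding mprod_def row_replaced_def by (intro sum.cong) auto
  then show ?thesis using assms False by simp
qed (simp add: mprod_def row_replaced_def)

lemma mprod_row_replaced_right:
  assumes "finite I" "r \<in> I" "j \<in> I"
  shows "mprod I y (row_replaced r u) i j = (if j = r then 0 else y i j) + y i r * u j"
proof -
  have "mprod I y (row_replaced r u) i j
      = (\<Sum>k\<in>I. (if k = j then if j = r then 0 else y i j else 0) + (if k = r then y i r * u j else 0))"
    unfolding mprod_def row_replaced_def by (intro sum.cong) auto
  then show ?thesis using assms by (simp add: sum.distrib)
qed

lemma brick_row_replaced:
  assumes fin: "finite I" and tr: "\<And>i j k. i \<in> I \<Longrightarrow> j \<in> I \<Longrightarrow> k \<in> I \<Longrightarrow> R i j \<Longrightarrow> R j k \<Longrightarrow> R i k"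
    and rf: "\<And>i. i \<in> I \<Longrightarrow> R i i"
    and r: "r \<in> I" and ur: "u r \<noteq> 0" and u: "\<And>j. j \<in> I \<Longrightarrow> u j \<noteq> 0 \<Longrightarrow> R r j"
    and F: "brick I R F"
  defines "u' \<equiv> \<lambda>j. if j = r then 1 / u r else - u j / u r"
  shows "brick I R (mprod I (row_replaced r u) (mprod I F (row_replaced r u')))"
proof (rule brick_conj[OF fin tr _ _ _ _ F])
  show "supported I R (row_replaced r u)" "supported I R (row_replaced r u')"
    using rf u r unfolding supported_def row_replaced_def u'_def by auto
  show "mprod I (row_replaced r u) (row_replaced r u') i j = (if i = j then 1 else 0)"
    if "i \<in> I" "j \<in> I" for i j
    using mprod_row_replaced_right[OF fin r that(2), of "row_replaced r u" u' i] ur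
    by (auto simp: row_replaced_def u'_def)
  show "mprod I (row_replaced r u') (row_replaced r u) i j = (if i = j then 1 else 0)"
    if "i \<in> I" "j \<in> I" for i j
    using mprod_row_replaced_right[OF fin r that(2), of "row_replaced r u'" u i] ur
    by (auto simp: row_replaced_def u'_def)
qed

section \<open>Reduction along an abelian ideal\<close>

definition comm :: "'i set \<Rightarrow> ('i \<Rightarrow> 'i \<Rightarrow> complex) \<Rightarrow> ('i \<Rightarrow> 'i \<Rightarrow> complex) \<Rightarrow> 'i \<Rightarrow> 'i \<Rightarrow> complex" where
  "comm I F x i j = mprod I F x i j - mprod I x F i j"

lemma comm_scalar:
  assumes "finite I" "\<And>k l. k \<in> I \<Longrightarrow> l \<in> I \<Longrightarrow> x k l = (if k = l then c else 0)" "i \<in> I" "j \<in> I"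
  shows "comm I F x i j = 0"
  using mprod_scalar[OF assms] unfolding comm_def by simp

lemma comm_cong:
  assumes "\<And>k l. k \<in> I \<Longrightarrow> l \<in> I \<Longrightarrow> x k l = x' k l" "i \<in> I" "j \<in> I"
  shows "comm I F x i j = comm I F x' i j"
  using assms unfolding comm_def mprod_def by simp

lemma centralizes_comm: "centralizes I R F x \<longleftrightarrow> (\<forall>k\<in>I. \<forall>l\<in>I. R k l \<longrightarrow> comm I F x l k = 0)"
  unfolding centralizes_def comm_def by simp

text \<open>
  Entries of \<open>F\<close> outside the dual positions pair to zero with the whole algebra.
\<close>

lemma brick_cong_dual:
  assumes tr: "\<And>i j k. i \<in> I \<Longrightarrow> j \<in> I \<Longrightarrow> k \<in> I \<Longrightarrow> R i j \<Longrightarrow> R j k \<Longrightarrow> R i k"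
    and eq: "\<And>k l. k \<in> I \<Longrightarrow> l \<in> I \<Longrightarrow> R k l \<Longrightarrow> F l k = F' l k"
    and b: "brick I R F"
  shows "brick I R F'"
  unfolding brick_def
proof (intro allI impI)
  fix x assume s: "supported I R x" and c: "centralizes I R F' x"
  have "mprod I F x l k = mprod I F' x l k \<and> mprod I x F l k = mprod I x F' l k"
    if kl: "k \<in> I" "l \<in> I" "R k l" for k l
  proof -
    have "F l j * x j k = F' l j * x j k" if j: "j \<in> I" for j
      using s eq[of j l] tr[of j k l] kl j unfolding supported_def by fastforce
    moreover have "x l j * F j k = x l j * F' j k" if j: "j \<in> I" for j
      using s eq[of k j] tr[of k l j] kl j unfolding supported_def by fastforce
    ultimately show ?thesis unfolding mprod_def by (intro conjI sum.cong) auto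
  qed
  then have "centralizes I R F x" using c unfolding centralizes_def by simp
  then show "scalar_on I x" using b s unfolding brick_def by blast
qed

text \<open>
  One step of Panyushev's reduction. The index set is \<open>A \<union> M \<union> N\<close> with \<open>M = J \<union> L\<close>; the matrices
  supported in \<open>A \<times> M\<close> form an abelian ideal, and the part \<open>f\<close> of a functional dual to it is its
  \<open>M \<times> A\<close> block. In normal form \<open>f\<close> is a partial permutation matrix, identifying \<open>J \<subseteq> M\<close> with
  \<open>A - K\<close>; the map \<open>s\<close> is this identification, extended by the identity to \<open>K\<close>, and \<open>t\<close> is its
  inverse. The stabiliser of \<open>f\<close> is again an algebra of supported matrices: its index set is
  \<open>K \<union> M \<union> N\<close>, because the block of \<open>A - K\<close> is forced to agree with that of \<open>J\<close>, and it may not map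
  \<open>J\<close> into \<open>L\<close>. That \<open>K\<close> or \<open>L\<close> is empty says that \<open>f\<close> has maximal rank.
\<close>

locale pivot =
  fixes A J L N K :: "'i set" and R :: "'i \<Rightarrow> 'i \<Rightarrow> bool" and s t :: "'i \<Rightarrow> 'i"
  assumes fin: "finite A" "finite J" "finite L" "finite N"
    and disj: "A \<inter> (J \<union> L \<union> N) = {}" "J \<inter> L = {}" "J \<inter> N = {}" "L \<inter> N = {}"
    and KA: "K \<subseteq> A" and KL: "K = {} \<or> L = {}"
    and s: "bij_betw s (J \<union> K) A" and t: "\<And>j. j \<in> J \<union> K \<Longrightarrow> t (s j) = j"
    and sK: "\<And>k. k \<in> K \<Longrightarrow> s k = k"
    and RAA: "\<And>k l. k \<in> A \<Longrightarrow> l \<in> A \<Longrightarrow> R k l"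
    and RAM: "\<And>k l. k \<in> A \<Longrightarrow> l \<in> J \<union> L \<Longrightarrow> R k l"
    and RAN: "\<And>k l. k \<in> A \<Longrightarrow> l \<in> N \<Longrightarrow> \<not> R k l"
    and RIA: "\<And>k l. k \<in> J \<union> L \<union> N \<Longrightarrow> l \<in> A \<Longrightarrow> \<not> R k l"
    and RMN: "\<And>k l. k \<in> J \<union> L \<Longrightarrow> l \<in> N \<Longrightarrow> \<not> R k l"
    and RLJ: "\<And>k l. k \<in> L \<Longrightarrow> l \<in> J \<Longrightarrow> R k l"
begin

text \<open>
  \<open>I2\<close> and \<open>R2\<close> are the index set and the support of the stabiliser; \<open>P\<close> indexes its action on \<open>A\<close>.
\<close>

definition "I' = J \<union> L \<union> N"
definition "I = A \<union> I'"
definition "P = J \<union> K"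
definition "I2 = K \<union> I'"
definition "R2 k l \<longleftrightarrow> R k l \<and> \<not> (k \<in> L \<and> l \<in> J)"

definition normal_form :: "('i \<Rightarrow> 'i \<Rightarrow> complex) \<Rightarrow> bool" where
  "normal_form F \<longleftrightarrow> (\<forall>i\<in>J \<union> L. \<forall>a\<in>A. F i a = (if i = t a then 1 else 0))"

text \<open>
  The functional induced on the stabiliser: a stabilising \<open>x\<close> has one common block for \<open>J\<close> and for
  \<open>A - K\<close>, so both corresponding blocks of \<open>F\<close> are paired with it and add up.
\<close>

definition compressed :: "('i \<Rightarrow> 'i \<Rightarrow> complex) \<Rightarrow> 'i \<Rightarrow> 'i \<Rightarrow> complex" where
  "compressed F i j = (if i \<in> P \<and> j \<in> P then F (s i) (s j) else 0) + (if i \<in> I' \<and> j \<in> I' then F i j else 0)"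

lemma finI: "finite I'" "finite I" "finite P" "finite I2"
  using fin KA finite_subset by (auto simp: I'_def I_def P_def I2_def)

lemma sP: "j \<in> P \<Longrightarrow> s j \<in> A" "j \<in> P \<Longrightarrow> t (s j) = j"
  using s t unfolding P_def by (auto simp: bij_betw_def)

lemma tA: "a \<in> A \<Longrightarrow> t a \<in> P" "a \<in> A \<Longrightarrow> s (t a) = a"
  using s t unfolding P_def by (metis bij_betw_imp_surj_on imageE)+

lemma tK: "a \<in> A \<Longrightarrow> t a \<in> K \<Longrightarrow> t a = a"
  using tA(2) sK by metis

lemma sum_A: "(\<Sum>a\<in>A. f a) = (\<Sum>j\<in>P. f (s j))"
  using sum.reindex_bij_betw[OF s, of f] unfolding P_def by simp

lemma mprod_split: "mprod I x y i j = mprod A x y i j + mprod I' x y i j"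
  unfolding mprod_def I_def by (rule sum.union_disjoint) (use fin finI disj in \<open>auto simp: I'_def\<close>)

lemma zero_outside:
  assumes "supported I R x"
  shows "i \<in> I' \<Longrightarrow> a \<in> A \<Longrightarrow> x i a = 0"
    and "a \<in> A \<Longrightarrow> n \<in> N \<Longrightarrow> x a n = 0"
    and "m \<in> J \<union> L \<Longrightarrow> n \<in> N \<Longrightarrow> x m n = 0"
  using assms RIA[of i a] RAN[of a n] RMN[of m n] unfolding supported_def I_def I'_def by blast+

text \<open>
  The next three lemmas evaluate \<open>[F, x]\<close> on the three kinds of dual positions. Because \<open>f\<close> is a
  partial identity, the entries of \<open>x\<close> in the ideal enter each equation at most once and unmultiplied.
\<close>

lemma comm_AA:
  assumes F: "normal_form F" and x: "supported I R x" and kl: "k \<in> A" "l \<in> A"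
  shows "comm I F x l k = comm A F x l k - (if t k \<in> J then x l (t k) else 0)"
proof -
  have "mprod I' F x l k = 0"
    unfolding mprod_def
    by (rule sum.neutral) (simp add: zero_outside(1)[OF x] kl)
  moreover have "mprod I' x F l k = (if t k \<in> J then x l (t k) else 0)"
  proof -
    have "mprod I' x F l k = (\<Sum>j\<in>I'. if j = t k then (if t k \<in> J then x l (t k) else 0) else 0)"
      unfolding mprod_def
    proof (rule sum.cong[OF refl])
      fix j assume j: "j \<in> I'"
      show "x l j * F j k = (if j = t k then (if t k \<in> J then x l (t k) else 0) else 0)"
      proof (cases "j \<in> N")
        case True
        then have "x l j = 0" using zero_outside(2)[OF x] kl by blast
        moreover have "t k \<notin> J \<or> j \<noteq> t k" using True disj by auto
        ultimately show ?thesis by auto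
      next
        case False
        then have "j \<in> J \<union> L" using j by (auto simp: I'_def)
        moreover have "j = t k \<Longrightarrow> t k \<in> J"
          using calculation tA(1)[OF kl(1)] disj KA unfolding P_def by blast
        ultimately show ?thesis using F kl unfolding normal_form_def by auto
      qed
    qed
    also have "\<dots> = (if t k \<in> I' then (if t k \<in> J then x l (t k) else 0) else 0)"
      using finI by simp
    finally show ?thesis by (auto simp: I'_def)
  qed
  ultimately show ?thesis unfolding comm_def mprod_split by simp
qed

lemma comm_MA:
  assumes F: "normal_form F" and x: "supported I R x" and kl: "k \<in> A" "l \<in> J \<union> L"
  shows "comm I F x l k = (if l \<in> J then x (s l) k else 0) - (if t k \<in> J then x l (t k) else 0)"
proof -
  have lP: "l \<in> J \<longleftrightarrow> l \<in> P" using kl disj KA unfolding P_def by blast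
  have "mprod A F x l k = (\<Sum>j\<in>P. if j = l then x (s l) k else 0)"
    unfolding mprod_def sum_A
    by (rule sum.cong) (use F kl sP in \<open>auto simp: normal_form_def\<close>)
  then have 1: "mprod A F x l k = (if l \<in> J then x (s l) k else 0)" using finI lP by simp
  have "l \<in> I'" using kl unfolding I'_def by blast
  then have 2: "mprod I' F x l k = 0" "mprod A x F l k = 0"
    unfolding mprod_def by (simp_all add: zero_outside(1)[OF x] kl)
  have "mprod I' x F l k = (\<Sum>j\<in>I'. if j = t k then (if t k \<in> J then x l (t k) else 0) else 0)"
    unfolding mprod_def
  proof (rule sum.cong[OF refl])
    fix j assume j: "j \<in> I'"
    show "x l j * F j k = (if j = t k then (if t k \<in> J then x l (t k) else 0) else 0)"
    proof (cases "j \<in> N")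
      case True
      then have "x l j = 0" using zero_outside(3)[OF x] kl by blast
      moreover have "t k \<notin> J \<or> j \<noteq> t k" using True disj by auto
      ultimately show ?thesis by auto
    next
      case False
      then have "j \<in> J \<union> L" using j by (auto simp: I'_def)
      moreover have "j = t k \<Longrightarrow> t k \<in> J"
        using calculation tA(1)[OF kl(1)] disj KA unfolding P_def by blast
      ultimately show ?thesis using F kl unfolding normal_form_def by auto
    qed
  qed
  also have "\<dots> = (if t k \<in> J then x l (t k) else 0)"
    using finI by (auto simp: I'_def)
  finally show ?thesis using 1 2 unfolding comm_def mprod_split by simp
qed

lemma comm_II:
  assumes F: "normal_form F" and x: "supported I R x" and kl: "k \<in> I'" "l \<in> I'" "R k l"
  shows "comm I F x l k = comm I' F x l k + (if k \<in> J \<union> L \<and> l \<in> J then x (s l) k else 0)"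
proof -
  have "mprod A x F l k = 0"
    unfolding mprod_def by (simp add: zero_outside(1)[OF x] kl)
  moreover have "mprod A F x l k = (if k \<in> J \<union> L \<and> l \<in> J then x (s l) k else 0)"
  proof (cases "k \<in> N")
    case True
    then have "mprod A F x l k = 0"
      unfolding mprod_def
      by (simp add: zero_outside(2)[OF x])
    then show ?thesis using True disj by auto
  next
    case False
    then have k: "k \<in> J \<union> L" using kl by (auto simp: I'_def)
    then have l: "l \<in> J \<union> L" using kl RMN by (auto simp: I'_def)
    have lP: "l \<in> J \<longleftrightarrow> l \<in> P" using l disj KA unfolding P_def by blast
    have "mprod A F x l k = (\<Sum>j\<in>P. if j = l then x (s l) k else 0)"
      unfolding mprod_def sum_A
      by (rule sum.cong) (use F l sP in \<open>auto simp: normal_form_def\<close>)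
    then show ?thesis using finI lP k by simp
  qed
  ultimately show ?thesis unfolding comm_def mprod_split by simp
qed

text \<open>
  Here \<open>y\<close> is the element of the stabiliser seen inside \<open>x\<close>. Although \<open>P\<close> and \<open>I'\<close> overlap in
  \<open>J\<close>, each of the two parts of the compressed functional contributes just its own product: the cross
  terms vanish by the support condition.
\<close>

lemma mprod_compressed:
  assumes y: "supported I2 R2 y"
    and yI: "\<And>i j. i \<in> I' \<Longrightarrow> j \<in> I' \<Longrightarrow> y i j = x i j"
    and yP: "\<And>i j. i \<in> P \<Longrightarrow> j \<in> P \<Longrightarrow> y i j = x (s i) (s j)"
    and kl: "k \<in> I2" "l \<in> I2" "R2 k l"
  shows "mprod I2 (compressed F) y l k = (if k \<in> P \<and> l \<in> P then mprod A F x (s l) (s k) else 0)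
      + (if k \<in> I' \<and> l \<in> I' then mprod I' F x l k else 0)" (is ?th1)
    and "mprod I2 y (compressed F) l k = (if k \<in> P \<and> l \<in> P then mprod A x F (s l) (s k) else 0)
      + (if k \<in> I' \<and> l \<in> I' then mprod I' x F l k else 0)" (is ?th2)
proof -
  have PI: "P \<subseteq> I2" "I' \<subseteq> I2" unfolding P_def I2_def I'_def by auto
  have y0: "\<not> R2 i j \<Longrightarrow> i \<in> I2 \<Longrightarrow> j \<in> I2 \<Longrightarrow> y i j = 0" for i j
    using y unfolding supported_def by blast
  have restr: "(\<Sum>j\<in>I2. if j \<in> S then f j else 0) = (\<Sum>j\<in>S. f j)" if "S \<subseteq> I2" for S and f :: "'i \<Rightarrow> complex"
    using finI(4) that by (simp add: sum.inter_restrict[symmetric] Int_absorb1)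
  have "mprod I2 (compressed F) y l k = (\<Sum>j\<in>I2. if j \<in> P then (if l \<in> P then F (s l) (s j) * y j k else 0) else 0)
      + (\<Sum>j\<in>I2. if j \<in> I' then (if l \<in> I' then F l j * y j k else 0) else 0)"
    unfolding mprod_def compressed_def sum.distrib[symmetric]
    by (rule sum.cong) (auto simp: distrib_right)
  also have "\<dots> = (\<Sum>j\<in>P. if l \<in> P then F (s l) (s j) * y j k else 0)
      + (\<Sum>j\<in>I'. if l \<in> I' then F l j * y j k else 0)"
    using restr PI by simp
  also have "(\<Sum>j\<in>P. if l \<in> P then F (s l) (s j) * y j k else 0)
      = (if k \<in> P \<and> l \<in> P then mprod A F x (s l) (s k) else 0)"
  proof (cases "k \<in> P")
    case True
    then show ?thesis unfolding mprod_def sum_A by (simp add: yP cong: sum.cong)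
  next
    case False
    have "y j k = 0" if j: "j \<in> P" and l: "l \<in> P" for j
    proof (rule y0)
      show "\<not> R2 j k"
        using False j l kl RAN RMN RIA KA KL unfolding R2_def P_def I2_def I'_def by blast
    qed (use j kl PI in auto)
    then show ?thesis using False by (simp cong: sum.cong)
  qed
  also have "(\<Sum>j\<in>I'. if l \<in> I' then F l j * y j k else 0)
      = (if k \<in> I' \<and> l \<in> I' then mprod I' F x l k else 0)"
  proof (cases "k \<in> I'")
    case True
    then show ?thesis unfolding mprod_def by (simp add: yI cong: sum.cong)
  next
    case False
    have "y j k = 0" if j: "j \<in> I'" for j
      by (rule y0) (use False j kl RIA KA PI in \<open>auto simp: R2_def I2_def I'_def\<close>)
    then show ?thesis using False by (simp cong: sum.cong)
  qed
  finally show ?th1 .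
  have "mprod I2 y (compressed F) l k = (\<Sum>j\<in>I2. if j \<in> P then (if k \<in> P then y l j * F (s j) (s k) else 0) else 0)
      + (\<Sum>j\<in>I2. if j \<in> I' then (if k \<in> I' then y l j * F j k else 0) else 0)"
    unfolding mprod_def compressed_def sum.distrib[symmetric]
    by (rule sum.cong) (auto simp: distrib_left)
  also have "\<dots> = (\<Sum>j\<in>P. if k \<in> P then y l j * F (s j) (s k) else 0)
      + (\<Sum>j\<in>I'. if k \<in> I' then y l j * F j k else 0)"
    using restr PI by simp
  also have "(\<Sum>j\<in>P. if k \<in> P then y l j * F (s j) (s k) else 0)
      = (if k \<in> P \<and> l \<in> P then mprod A x F (s l) (s k) else 0)"
  proof (cases "l \<in> P")
    case True
    then show ?thesis unfolding mprod_def sum_A by (simp add: yP cong: sum.cong)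
  next
    case False
    have "y l j = 0" if j: "j \<in> P" and k: "k \<in> P" for j
    proof (rule y0)
      show "\<not> R2 l j"
        using False j k kl RAN RMN RIA KA KL unfolding R2_def P_def I2_def I'_def by blast
    qed (use j kl PI in auto)
    then show ?thesis using False by (simp cong: sum.cong)
  qed
  also have "(\<Sum>j\<in>I'. if k \<in> I' then y l j * F j k else 0)
      = (if k \<in> I' \<and> l \<in> I' then mprod I' x F l k else 0)"
  proof (cases "l \<in> I'")
    case True
    then show ?thesis unfolding mprod_def by (simp add: yI cong: sum.cong)
  next
    case False
    then have "l \<in> A" "k \<notin> I'" using kl RIA KA unfolding R2_def I2_def I'_def by blast+
    then show ?thesis by simp
  qed
  finally show ?th2 .
qed

lemma comm_compressed:
  assumes y: "supported I2 R2 y"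
    and yI: "\<And>i j. i \<in> I' \<Longrightarrow> j \<in> I' \<Longrightarrow> y i j = x i j"
    and yP: "\<And>i j. i \<in> P \<Longrightarrow> j \<in> P \<Longrightarrow> y i j = x (s i) (s j)"
    and kl: "k \<in> I2" "l \<in> I2" "R2 k l"
  shows "comm I2 (compressed F) y l k = (if k \<in> P \<and> l \<in> P then comm A F x (s l) (s k) else 0)
      + (if k \<in> I' \<and> l \<in> I' then comm I' F x l k else 0)"
  unfolding comm_def by (simp add: mprod_compressed[OF y yI yP kl])

text \<open>
  An element \<open>y\<close> of the kernel on the stabiliser extends to an element \<open>x\<close> of the kernel on the whole
  algebra: its block on \<open>A\<close> is copied from \<open>y\<close>, and the entries in the ideal are solved for from the
  equations at \<open>A \<times> A\<close> (columns in \<open>J\<close>) and at \<open>J \<times> L\<close> (columns in \<open>L\<close>). So \<open>x\<close>, and with it \<open>y\<close>, is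
  a scalar.
\<close>

lemma brick_compressed:
  assumes F: "normal_form F" and b: "brick I R F"
  shows "brick I2 R2 (compressed F)"
  unfolding brick_def
proof (intro allI impI)
  fix y assume y: "supported I2 R2 y" and "centralizes I2 R2 (compressed F) y"
  then have c: "\<And>k l. k \<in> I2 \<Longrightarrow> l \<in> I2 \<Longrightarrow> R2 k l \<Longrightarrow> comm I2 (compressed F) y l k = 0"
    unfolding centralizes_comm by blast
  have PI: "P \<subseteq> I2" "I' \<subseteq> I2" unfolding P_def I2_def I'_def by auto
  have y0: "\<not> R2 i j \<Longrightarrow> i \<in> I2 \<Longrightarrow> j \<in> I2 \<Longrightarrow> y i j = 0" for i j
    using y unfolding supported_def by blast
  have AI: "a \<in> A \<Longrightarrow> a \<notin> I'" for a using disj unfolding I'_def by blast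
  define xA where "xA = (\<lambda>i j. y (t i) (t j))"
  define x where "x = (\<lambda>i j. if i \<in> A then
      (if j \<in> A then xA i j else if j \<in> J then comm A F xA i (s j)
       else if j \<in> L then - comm I' F y (t i) j else 0)
     else if j \<in> A then 0 else y i j)"
  have xAA: "comm A F x i j = comm A F xA i j" if "i \<in> A" "j \<in> A" for i j
    by (rule comm_cong) (use that in \<open>auto simp: x_def\<close>)
  have xII: "comm I' F x i j = comm I' F y i j" if "i \<in> I'" "j \<in> I'" for i j
    by (rule comm_cong) (use that AI in \<open>auto simp: x_def\<close>)
  have yI: "\<And>i j. i \<in> I' \<Longrightarrow> j \<in> I' \<Longrightarrow> y i j = x i j" using AI by (auto simp: x_def)
  have yP: "\<And>i j. i \<in> P \<Longrightarrow> j \<in> P \<Longrightarrow> y i j = x (s i) (s j)" using sP by (simp add: x_def xA_def)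
  note key = comm_compressed[OF y yI yP]
  have xs: "supported I R x"
    unfolding supported_def
  proof (intro ballI impI)
    fix k l assume kl: "k \<in> I" "l \<in> I" and nz: "x k l \<noteq> 0"
    show "R k l"
    proof (cases "k \<in> A")
      case True
      then show ?thesis using nz kl RAA RAM by (auto simp: x_def I_def I'_def split: if_splits)
    next
      case False
      then have "k \<in> I'" "l \<in> I'" "y k l \<noteq> 0" using nz kl by (auto simp: x_def I_def split: if_splits)
      then show ?thesis using y PI unfolding supported_def R2_def by blast
    qed
  qed
  have "comm I F x l k = 0" if kl: "k \<in> I" "l \<in> I" "R k l" for k l
  proof (cases "k \<in> A")
    case kA: True
    then have tk: "t k \<in> P" "s (t k) = k" using tA by auto
    show ?thesis
    proof (cases "l \<in> A")
      case lA: True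
      show ?thesis
      proof (cases "t k \<in> J")
        case True
        then have "t k \<notin> A" using disj by auto
        then show ?thesis using True lA kA tk xAA comm_AA[OF F xs kA lA] by (simp add: x_def)
      next
        case False
        then have K: "t k \<in> K" "t k = k" using tk tK kA unfolding P_def by auto
        have "R2 k (t l)"
          using K kA lA tA(1)[OF lA] RAA RAM KA disj unfolding R2_def P_def by blast
        then have "comm I2 (compressed F) y (t l) k = 0"
          using c[of k "t l"] K tA(1)[OF lA] PI tk by auto
        moreover have "comm I2 (compressed F) y (t l) k = comm A F x l k"
          using key[of k "t l" F] \<open>R2 k (t l)\<close> K kA lA tA[OF lA] PI tk AI[OF kA] by auto
        ultimately show ?thesis using comm_AA[OF F xs kA lA] False by simp
      qed
    next
      case False
      then have lM: "l \<in> J \<union> L" using kl kA RAN by (auto simp: I_def I'_def)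
      have tk2: "t k \<in> J \<Longrightarrow> t k \<notin> A" using disj by auto
      have "l \<in> J \<Longrightarrow> t k \<notin> J \<Longrightarrow> y l (t k) = 0"
        using y0[of l "t k"] tk lM RIA KA PI unfolding R2_def P_def I2_def I'_def by blast
      moreover have "l \<notin> J \<Longrightarrow> t k \<in> J \<Longrightarrow> y l (t k) = 0"
        using y0[of l "t k"] tk lM PI unfolding R2_def I2_def I'_def by blast
      moreover have "l \<in> J \<Longrightarrow> x (s l) k = y l (t k)"
        using sP[of l] kA by (simp add: P_def x_def xA_def)
      moreover have "t k \<in> J \<Longrightarrow> x l (t k) = y l (t k)"
        using False tk2 by (simp add: x_def)
      ultimately show ?thesis using comm_MA[OF F xs kA lM] by auto
    qed
  next
    case False
    then have kI: "k \<in> I'" using kl by (auto simp: I_def)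
    then have lI: "l \<in> I'" using kl RIA by (auto simp: I_def I'_def)
    have kA: "k \<notin> A" using False .
    show ?thesis
    proof (cases "k \<in> L \<and> l \<in> J")
      case True
      then have "x (s l) k = - comm I' F y l k"
        using kA disj sP[of l] by (auto simp: x_def P_def)
      then show ?thesis using comm_II[OF F xs kI lI kl(3)] xII[OF lI kI] True by simp
    next
      case nLJ: False
      then have R2: "R2 k l" using kl unfolding R2_def by blast
      have "comm I2 (compressed F) y l k = 0" using c[of k l] R2 kI lI PI by auto
      then have z: "(if k \<in> P \<and> l \<in> P then comm A F x (s l) (s k) else 0) + comm I' F x l k = 0"
        using key[of k l F] R2 kI lI subsetD[OF PI(2) kI] subsetD[OF PI(2) lI] by simp
      have KI: "k \<in> P \<longleftrightarrow> k \<in> J" "l \<in> P \<longleftrightarrow> l \<in> J"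
        using kI lI AI KA unfolding P_def by blast+
      show ?thesis
      proof (cases "k \<in> J \<and> l \<in> J")
        case True
        then have "x (s l) k = comm A F x (s l) (s k)"
          using kA sP[of l] sP[of k] xAA by (simp add: x_def P_def)
        then show ?thesis using z comm_II[OF F xs kI lI kl(3)] True KI by (simp add: add.commute)
      next
        case False
        then show ?thesis using z comm_II[OF F xs kI lI kl(3)] nLJ KI by auto
      qed
    qed
  qed
  then have "centralizes I R F x" unfolding centralizes_comm by blast
  then obtain c where sc: "\<And>k l. k \<in> I \<Longrightarrow> l \<in> I \<Longrightarrow> x k l = (if k = l then c else 0)"
    using b xs unfolding brick_def scalar_on_def by blast
  have "y k l = (if k = l then c else 0)" if kl: "k \<in> I2" "l \<in> I2" for k l
  proof (cases "k \<in> I' \<and> l \<in> I'")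
    case True
    then show ?thesis using yI sc by (auto simp: I_def)
  next
    case nI: False
    show ?thesis
    proof (cases "k \<in> P \<and> l \<in> P")
      case True
      then have "y k l = (if s k = s l then c else 0)" using yP sc sP by (auto simp: I_def)
      moreover have "s k = s l \<longleftrightarrow> k = l" using True sP(2) by metis
      ultimately show ?thesis by simp
    next
      case False
      then have "\<not> R2 k l" "k \<noteq> l"
        using nI kl KL KA RAN RIA AI unfolding R2_def P_def I2_def I'_def by blast+
      then show ?thesis using y0 kl by simp
    qed
  qed
  then show "scalar_on I2 y" unfolding scalar_on_def by blast
qed

text \<open>
  Conversely, the equations at \<open>M \<times> A\<close> force a kernel element into the stabiliser, and the equations
  that determine its entries in the ideal show that these vanish once the remainder is a scalar.
\<close>

lemma brick_of_compressed:
  assumes F: "normal_form F" and b: "brick I2 R2 (compressed F)"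
  shows "brick I R F"
  unfolding brick_def
proof (intro allI impI)
  fix x assume x: "supported I R x" and "centralizes I R F x"
  then have c: "\<And>k l. k \<in> I \<Longrightarrow> l \<in> I \<Longrightarrow> R k l \<Longrightarrow> comm I F x l k = 0"
    unfolding centralizes_comm by blast
  have PI: "P \<subseteq> I2" "I' \<subseteq> I2" unfolding P_def I2_def I'_def by auto
  have AI: "a \<in> A \<Longrightarrow> a \<notin> I'" for a using disj unfolding I'_def by blast
  have x0: "\<not> R i j \<Longrightarrow> i \<in> I \<Longrightarrow> j \<in> I \<Longrightarrow> x i j = 0" for i j
    using x unfolding supported_def by blast
  have eq: "(if l \<in> J then x (s l) (s k) else 0) = (if k \<in> J then x l k else 0)"
    if "l \<in> J \<union> L" "k \<in> P" for k l
    using comm_MA[OF F x sP(1)[OF that(2)] that(1)] c[of "s k" l] RAM[of "s k" l] that sP[OF that(2)]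
    by (auto simp: I_def I'_def)
  have PJ: "k \<in> I' \<Longrightarrow> k \<in> P \<longleftrightarrow> k \<in> J" for k using AI KA unfolding P_def by blast
  have eqJJ: "x (s l) (s k) = x l k" if "l \<in> J" "k \<in> J" for k l
    using eq[of l k] that by (simp add: P_def)
  have eqJK: "x (s l) (s k) = 0" if "l \<in> J" "k \<in> K" for k l
    using eq[of l k] that KA disj by (auto simp: P_def split: if_splits)
  have eqLJ: "x l k = 0" if "l \<in> L" "k \<in> J" for k l
  proof -
    have "l \<notin> J" "l \<in> J \<union> L" "k \<in> P" using that disj unfolding P_def by auto
    then show ?thesis using eq[of l k] that by simp
  qed
  define y where "y = (\<lambda>i j. if i \<in> I' \<and> j \<in> I' then x i j else if i \<in> P \<and> j \<in> P then x (s i) (s j) else 0)"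
  have yI: "\<And>i j. i \<in> I' \<Longrightarrow> j \<in> I' \<Longrightarrow> y i j = x i j" by (simp add: y_def)
  have yP: "\<And>i j. i \<in> P \<Longrightarrow> j \<in> P \<Longrightarrow> y i j = x (s i) (s j)"
    using eqJJ PJ by (auto simp: y_def)
  have y: "supported I2 R2 y"
    unfolding supported_def
  proof (intro ballI impI)
    fix k l assume kl: "k \<in> I2" "l \<in> I2" and nz: "y k l \<noteq> 0"
    show "R2 k l"
    proof (cases "k \<in> I' \<and> l \<in> I'")
      case True
      then have "x k l \<noteq> 0" using nz yI by simp
      then show ?thesis using True x eqLJ unfolding supported_def R2_def I_def by blast
    next
      case False
      then have P: "k \<in> P" "l \<in> P" "x (s k) (s l) \<noteq> 0" using nz by (auto simp: y_def split: if_splits)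
      then have "k \<in> K" using False eqJK unfolding P_def I'_def by blast
      then show ?thesis using P RAA RAM KA disj unfolding R2_def P_def by blast
    qed
  qed
  note key = comm_compressed[OF y yI yP]
  have "comm I2 (compressed F) y l k = 0" if kl: "k \<in> I2" "l \<in> I2" "R2 k l" for k l
  proof -
    have Rkl: "R k l" using kl unfolding R2_def by blast
    have 1: "comm A F x (s l) (s k) = (if k \<in> J then x (s l) k else 0)" if "k \<in> P" "l \<in> P"
      using comm_AA[OF F x sP(1)[OF that(1)] sP(1)[OF that(2)]] c[of "s k" "s l"] sP that RAA
      by (simp add: I_def)
    have 2: "comm I' F x l k = - (if k \<in> J \<union> L \<and> l \<in> J then x (s l) k else 0)" if "k \<in> I'" "l \<in> I'"
      using comm_II[OF F x that Rkl] c[of k l] that Rkl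
      by (metis I_def UnI2 add_eq_0_iff2)
    have "\<not> (k \<in> L \<and> l \<in> J)" using kl unfolding R2_def by blast
    moreover have "k \<in> I' \<Longrightarrow> l \<in> I'" using kl Rkl RIA KA unfolding I2_def I'_def by blast
    moreover have "k \<notin> I' \<Longrightarrow> k \<notin> J" unfolding I'_def by auto
    ultimately show ?thesis
      using key[of k l F] kl 1 2 PJ[of k] PJ[of l] by auto
  qed
  then have "centralizes I2 R2 (compressed F) y" unfolding centralizes_comm by blast
  then obtain c' where sc: "\<And>k l. k \<in> I2 \<Longrightarrow> l \<in> I2 \<Longrightarrow> y k l = (if k = l then c' else 0)"
    using b y unfolding brick_def scalar_on_def by blast
  have xI: "x k l = (if k = l then c' else 0)" if "k \<in> I'" "l \<in> I'" for k l
    using yI[OF that] sc[of k l] subsetD[OF PI(2)] that by simp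
  have xA: "x k l = (if k = l then c' else 0)" if "k \<in> A" "l \<in> A" for k l
  proof -
    have "x k l = (if t k = t l then c' else 0)"
      using yP[of "t k" "t l"] sc[of "t k" "t l"] tA that subsetD[OF PI(1)] by simp
    moreover have "t k = t l \<longleftrightarrow> k = l" using tA that by metis
    ultimately show ?thesis by simp
  qed
  have xAM: "x k l = 0" if k: "k \<in> A" and l: "l \<in> J \<union> L" for k l
  proof (cases "l \<in> J")
    case True
    then have lP: "l \<in> P" unfolding P_def by simp
    have "comm A F x k (s l) = 0" by (rule comm_scalar[OF fin(1) xA]) (use k sP lP in auto)
    then show ?thesis
      using comm_AA[OF F x sP(1)[OF lP] k] c[of "s l" k] RAA[of "s l" k] sP[OF lP] k True
      by (simp add: I_def)
  next
    case False
    then have lL: "l \<in> L" "K = {}" using l KL by auto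
    then have tk: "t k \<in> J" "s (t k) = k" using tA[OF k] unfolding P_def by auto
    have II: "l \<in> I'" "t k \<in> I'" using lL tk unfolding I'_def by auto
    have "comm I' F x (t k) l = 0" by (rule comm_scalar[OF finI(1) xI]) (use II in auto)
    then show ?thesis
      using comm_II[OF F x II RLJ[OF lL(1) tk(1)]] c[of l "t k"] RLJ[OF lL(1) tk(1)] tk lL II
      by (simp add: I_def)
  qed
  have "x k l = (if k = l then c' else 0)" if kl: "k \<in> I" "l \<in> I" for k l
  proof -
    consider "k \<in> A" "l \<in> A" | "k \<in> I'" "l \<in> I'" | "k \<in> A" "l \<in> J \<union> L" | "k \<in> A" "l \<in> N" | "k \<in> I'" "l \<in> A"
      using kl unfolding I_def I'_def by blast
    then show ?thesis
    proof cases
      case 3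
      then show ?thesis using xAM disj by auto
    next
      case 4
      then show ?thesis using x0[OF RAN[OF 4]] kl disj by auto
    next
      case 5
      then show ?thesis using x0[OF RIA, of k l] kl AI unfolding I'_def by auto
    qed (use xI xA in auto)
  qed
  then show "scalar_on I x" unfolding scalar_on_def by blast
qed

text \<open>
  Every functional on the stabiliser is compressed from a functional in normal form: put what belongs
  to columns in \<open>K\<close> into the block of \<open>A\<close> and the rest on \<open>M \<union> N\<close>.
\<close>

lemma has_brick_of_reduction:
  assumes tr: "\<And>i j k. i \<in> I2 \<Longrightarrow> j \<in> I2 \<Longrightarrow> k \<in> I2 \<Longrightarrow> R i j \<Longrightarrow> R j k \<Longrightarrow> R i k"
    and b: "has_brick I2 R2"
  shows "has_brick I R"
proof -
  obtain G where G: "brick I2 R2 G" using b unfolding has_brick_def by blast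
  have AI: "a \<in> A \<Longrightarrow> a \<notin> I'" for a using disj unfolding I'_def by blast
  define F where "F = (\<lambda>i j. if i \<in> A \<and> j \<in> A then (if t j \<in> K then G (t i) (t j) else 0)
     else if i \<in> I' \<and> j \<in> I' then G i j else if i = t j then 1 else 0)"
  have nf: "normal_form F"
    using AI unfolding normal_form_def F_def I'_def by auto
  have "brick I2 R2 (compressed F)"
  proof (rule brick_cong_dual[OF _ _ G])
    fix i j k assume "i \<in> I2" "j \<in> I2" "k \<in> I2" "R2 i j" "R2 j k"
    then show "R2 i k" using tr RMN RIA KA unfolding R2_def I2_def I'_def by blast
  next
    fix k l assume kl: "k \<in> I2" "l \<in> I2" and R2: "R2 k l"
    have PK: "\<And>i. i \<in> P \<Longrightarrow> i \<notin> K \<Longrightarrow> i \<in> J" unfolding P_def by auto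
    show "G l k = compressed F l k"
    proof (cases "k \<in> I'")
      case True
      then have l: "l \<in> I'" using R2 kl RIA KA unfolding R2_def I2_def I'_def by blast
      then have "k \<notin> K" "l \<notin> A" "k \<notin> A" using True AI KA by blast+
      then show ?thesis using True l sP unfolding compressed_def F_def by auto
    next
      case False
      then have k: "k \<in> K" "k \<in> A" "k \<in> P" using kl KA unfolding I2_def P_def by auto
      then have "L = {}" "l \<notin> N" using KL RAN R2 unfolding R2_def by auto
      then have "l \<in> P" using kl unfolding I2_def I'_def P_def by auto
      then show ?thesis using False k sP unfolding compressed_def F_def by simp
    qed
  qed
  then show ?thesis using brick_of_compressed[OF nf] unfolding has_brick_def by blast
qed

end

section \<open>Seaweed supports\<close>

text \<open>
  The support of a seaweed algebra, described by the sets \<open>S\<close> and \<open>T\<close> of end points of the blocks of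
  the two compositions: the entry at \<open>(k, l)\<close> maps \<open>e\<^sub>l\<close> to \<open>e\<^sub>k\<close> and must preserve each initial segment
  cut off at \<open>S\<close> and each final segment cut off at \<open>T\<close>.
\<close>

definition allowed :: "nat set \<Rightarrow> nat set \<Rightarrow> nat \<Rightarrow> nat \<Rightarrow> bool" where
  "allowed S T k l \<longleftrightarrow> (\<forall>c\<in>S. l < c \<longrightarrow> k < c) \<and> (\<forall>c\<in>T. k < c \<longrightarrow> l < c)"

lemma allowed_refl: "allowed S T k k"
  and allowed_trans: "allowed S T i j \<Longrightarrow> allowed S T j k \<Longrightarrow> allowed S T i k"
  unfolding allowed_def by auto

lemma upper_end_eq:
  fixes a b :: nat
  assumes "J \<subseteq> {a..<b}" "\<And>k j. k \<in> {a..<b} - J \<Longrightarrow> j \<in> J \<Longrightarrow> k < j"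
  shows "J = {b - card J..<b}"
proof (cases "J = {}")
  case False
  define m where "m = Min J"
  have fin: "finite J" using assms(1) finite_subset by blast
  have m: "m \<in> J" "\<And>j. j \<in> J \<Longrightarrow> m \<le> j" using False fin by (auto simp: m_def)
  have "J = {m..<b}"
  proof (rule Set.set_eqI)
    fix i
    have "i \<in> {m..<b} \<Longrightarrow> i \<in> J" using assms(2)[of i m] m assms(1) by fastforce
    then show "i \<in> J \<longleftrightarrow> i \<in> {m..<b}" using m assms(1) by auto
  qed
  moreover have "b - card J = m" using calculation m assms(1) by auto
  ultimately show ?thesis by simp
qed simp

text \<open>
  The first top block \<open>{..<a}\<close> is shorter than the first bottom block \<open>{..<b}\<close>. In the notation of the
  previous locale \<open>A = {..<a}\<close>, \<open>M = {a..<b}\<close> and \<open>N = {b..<n}\<close>.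
\<close>

locale first_blocks =
  fixes n a b :: nat and S T :: "nat set"
  assumes ab: "0 < a" "a < b" "b \<le> n"
    and aS: "a \<in> S" and bT: "b \<in> T"
    and S: "\<And>c. c \<in> S \<Longrightarrow> c = 0 \<or> a \<le> c" and T: "\<And>c. c \<in> T \<Longrightarrow> c = 0 \<or> b \<le> c"
begin

abbreviation "R \<equiv> allowed S T"

lemma RAA: "k < a \<Longrightarrow> l < a \<Longrightarrow> R k l"
  and RAM: "k < a \<Longrightarrow> l < b \<Longrightarrow> R k l"
  and RAN: "k < a \<Longrightarrow> b \<le> l \<Longrightarrow> \<not> R k l"
  and RIA: "a \<le> k \<Longrightarrow> l < a \<Longrightarrow> \<not> R k l"
  and RMN: "k < b \<Longrightarrow> b \<le> l \<Longrightarrow> \<not> R k l"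
  and RMM: "k \<le> l \<Longrightarrow> l < b \<Longrightarrow> R k l"
  using ab aS bT S T unfolding allowed_def by (force dest: S T)+

definition partial_perm :: "nat \<Rightarrow> (nat \<Rightarrow> nat \<Rightarrow> complex) \<Rightarrow> nat set \<Rightarrow> (nat \<Rightarrow> nat) \<Rightarrow> bool" where
  "partial_perm m F J \<sigma> \<longleftrightarrow> J \<subseteq> {m..<b} \<and> inj_on \<sigma> J \<and> \<sigma> ` J \<subseteq> {..<a} \<and>
     (\<forall>i\<in>{m..<b}. \<forall>p<a. F i p = (if i \<in> J \<and> p = \<sigma> i then 1 else 0))"

text \<open>
  Gaussian elimination with the units at hand. Row operations within \<open>M\<close> may only add a later row to
  an earlier one, so the rows are treated from the last one upwards; column operations within \<open>A\<close>
  are unrestricted.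
\<close>

lemma eliminate:
  assumes "brick {..<n} R F" "a \<le> m" "m \<le> b"
  shows "\<exists>F J \<sigma>. brick {..<n} R F \<and> partial_perm m F J \<sigma>"
  using assms(3)
proof (induction rule: inc_induct)
  case base
  show ?case using assms(1) unfolding partial_perm_def by fastforce
next
  case (step r)
  then obtain F J \<sigma> where F: "brick {..<n} R F" and pp: "partial_perm (Suc r) F J \<sigma>" by blast
  have r: "a \<le> r" "r < b" "r \<in> {..<n}" using step assms(2) ab by auto
  note tr = allowed_trans[of S T]
  have J: "J \<subseteq> {Suc r..<b}" "inj_on \<sigma> J" "\<And>j. j \<in> J \<Longrightarrow> \<sigma> j < a"
    and Fj: "\<And>i p. Suc r \<le> i \<Longrightarrow> i < b \<Longrightarrow> p < a \<Longrightarrow> F i p = (if i \<in> J \<and> p = \<sigma> i then 1 else 0)"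
    using pp unfolding partial_perm_def by auto
  have finJ: "finite J" and JI: "J \<subseteq> {..<n}" and rJ: "r \<notin> J" using J ab finite_subset by fastforce+
  \<comment> \<open>Clear row \<open>r\<close> at the pivot columns by subtracting multiples of the rows below.\<close>
  define u where "u = (\<lambda>j. if j = r then 1 else if j \<in> J then - F r (\<sigma> j) else 0)"
  define u' where "u' = (\<lambda>j. if j = r then 1 / u r else - u j / u r)"
  define F1 where "F1 = mprod {..<n} (row_replaced r u) (mprod {..<n} F (row_replaced r u'))"
  have b1: "brick {..<n} R F1"
    unfolding F1_def u'_def
    by (rule brick_row_replaced[OF _ tr allowed_refl r(3) _ _ F])
      (use J r RMM in \<open>auto simp: u_def split: if_splits\<close>)
  have FE: "mprod {..<n} F (row_replaced r u') k p = F k p" if "p < a" for k p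
  proof -
    have "p \<notin> J" "p \<noteq> r" "p < n" using that r J(1) ab by auto
    then show ?thesis
      using mprod_row_replaced_right[of "{..<n}" r p F u' k] r
      by (simp add: u'_def u_def)
  qed
  have F1i: "F1 i p = (if i \<in> J \<and> p = \<sigma> i then 1 else 0)" if "Suc r \<le> i" "i < b" "p < a" for i p
    using mprod_row_replaced_left[of "{..<n}" i r u] that ab Fj by (simp add: F1_def FE)
  have F1r: "F1 r p = (if p \<in> \<sigma> ` J then 0 else F r p)" if p: "p < a" for p
  proof -
    have "F1 r p = (\<Sum>k<n. u k * F k p)"
      using mprod_row_replaced_left[of "{..<n}" r r u] r p by (simp add: F1_def FE)
    also have "\<dots> = (\<Sum>k\<in>insert r J. u k * F k p)"
      by (rule sum.mono_neutral_right) (use JI r in \<open>auto simp: u_def\<close>)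
    also have "\<dots> = F r p + (\<Sum>k\<in>J. u k * F k p)"
      using finJ rJ by (simp add: u_def)
    also have "(\<Sum>k\<in>J. u k * F k p) = (\<Sum>k\<in>J. if p = \<sigma> k then - F r p else 0)"
      by (rule sum.cong) (use J p Fj rJ in \<open>auto simp: u_def\<close>)
    also have "F r p + \<dots> = (if p \<in> \<sigma> ` J then 0 else F r p)"
    proof (cases "p \<in> \<sigma> ` J")
      case True
      then obtain j where j: "j \<in> J" "p = \<sigma> j" by blast
      have "(\<Sum>k\<in>J. if p = \<sigma> k then - F r p else 0) = (\<Sum>k\<in>J. if k = j then - F r p else 0)"
        by (rule sum.cong) (use j J(2) in \<open>auto simp: inj_on_def\<close>)
      then show ?thesis using True finJ j by simp
    next
      case False
      then have "(\<Sum>k\<in>J. if p = \<sigma> k then - F r p else 0) = 0" by (intro sum.neutral) auto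
      then show ?thesis using False by simp
    qed
    finally show ?thesis .
  qed
  show ?case
  proof (cases "\<forall>p<a. F1 r p = 0")
    case True
    have "F1 i p = (if i \<in> J \<and> p = \<sigma> i then 1 else 0)" if "r \<le> i" "i < b" "p < a" for i p
      using F1i[of i p] True that rJ by (cases "i = r") auto
    then have "partial_perm r F1 J \<sigma>" using J unfolding partial_perm_def by force
    then show ?thesis using b1 by blast
  next
    case False
    then obtain p where p: "p < a" "F1 r p \<noteq> 0" by blast
    then have pJ: "p \<notin> \<sigma> ` J" using F1r by auto
    have pn: "p \<in> {..<n}" using p ab by auto
    \<comment> \<open>A nonzero entry at column \<open>p\<close> remains; column operations turn row \<open>r\<close> into a unit vector.\<close>
    define v where "v = (\<lambda>j. if j < a then F1 r j else 0)"
    define v' where "v' = (\<lambda>j. if j = p then 1 / v p else - v j / v p)"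
    define F2 where "F2 = mprod {..<n} (row_replaced p v) (mprod {..<n} F1 (row_replaced p v'))"
    have b2: "brick {..<n} R F2"
      unfolding F2_def v'_def
      by (rule brick_row_replaced[OF _ tr allowed_refl pn _ _ b1])
        (use p RAA in \<open>auto simp: v_def split: if_splits\<close>)
    have F2: "F2 i j = (if j = p then 0 else F1 i j) + F1 i p * v' j" if "r \<le> i" "i < b" "j < a" for i j
      using mprod_row_replaced_left[of "{..<n}" i p v] mprod_row_replaced_right[of "{..<n}" p j F1 v' i]
        that p r ab pn by (simp add: F2_def)
    have "F2 i j = (if i \<in> insert r J \<and> j = (\<sigma>(r := p)) i then 1 else 0)"
      if ij: "r \<le> i" "i < b" "j < a" for i j
    proof (cases "i = r")
      case True
      then show ?thesis using F2[OF ij] p ij by (simp add: v'_def v_def)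
    next
      case False
      then have "F1 i p = 0" using F1i[of i p] ij p pJ by auto
      then show ?thesis using F2[OF ij] F1i[of i j] ij False by auto
    qed
    moreover have "inj_on (\<sigma>(r := p)) (insert r J)"
      using J(2) pJ rJ by (auto simp: inj_on_def)
    moreover have "(\<sigma>(r := p)) ` insert r J \<subseteq> {..<a}" "insert r J \<subseteq> {r..<b}"
      using J p rJ r by auto
    ultimately have "partial_perm r F2 (insert r J) (\<sigma>(r := p))"
      unfolding partial_perm_def by auto
    then show ?thesis using b2 by blast
  qed
qed

text \<open>
  Under these assumptions the elementary matrix at \<open>(p, k)\<close> lies in the kernel, since \<open>F\<close> has no entry
  that could meet it on either side.
\<close>

lemma brick_no_isolated_pair:
  assumes b: "brick {..<n} R F" and p: "p < a" and k: "a \<le> k" "k < b"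
    and row: "\<And>l. a \<le> l \<Longrightarrow> l < b \<Longrightarrow> R k l \<Longrightarrow> F l p = 0"
    and col: "\<And>q. q < a \<Longrightarrow> F k q = 0"
  shows False
proof -
  define x :: "nat \<Rightarrow> nat \<Rightarrow> complex" where "x = (\<lambda>i j. if i = p \<and> j = k then 1 else 0)"
  have "supported {..<n} R x" using p k RAM unfolding supported_def x_def by auto
  moreover have "mprod {..<n} F x j i = mprod {..<n} x F j i"
    if ij: "i < n" "j < n" "R i j" for i j
  proof -
    have "mprod {..<n} F x j i = (\<Sum>m<n. if m = p then (if i = k then F j p else 0) else 0)"
      unfolding mprod_def x_def by (rule sum.cong) auto
    also have "\<dots> = (if i = k then F j p else 0)" using p ab by simp
    also have "\<dots> = 0"
    proof -
      have "F j p = 0" if "i = k"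
        using row[of j] ij that RIA[of k j] RMN[of k j] k by (metis not_le_imp_less)
      then show ?thesis by simp
    qed
    finally have 1: "mprod {..<n} F x j i = 0" .
    have "mprod {..<n} x F j i = (\<Sum>m<n. if m = k then (if j = p then F k i else 0) else 0)"
      unfolding mprod_def x_def by (rule sum.cong) auto
    also have "\<dots> = (if j = p then F k i else 0)" using k ab by simp
    also have "\<dots> = 0"
    proof -
      have "F k i = 0" if "j = p"
        using col[of i] ij that RIA[of i p] p by (metis not_le_imp_less)
      then show ?thesis by simp
    qed
    finally show ?thesis using 1 by simp
  qed
  then have "centralizes {..<n} R F x" unfolding centralizes_def by auto
  ultimately obtain c where "\<And>i j. i < n \<Longrightarrow> j < n \<Longrightarrow> x i j = (if i = j then c else 0)"
    using b unfolding brick_def scalar_on_def by fastforce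
  from this[of p k] show False using p k ab by (simp add: x_def)
qed

text \<open>
  If neither the rows nor the columns are exhausted by the pivots, or if a pivot row lies in an earlier
  block than a row without pivot, there is an isolated pair. A pivot row and a later row of the same
  block are exchanged by a symmetry; choosing the pivot set with the largest sum makes such an exchange
  impossible, so that the pivots end up in the last rows of \<open>M\<close>.
\<close>

lemma normal_form_exists:
  assumes "brick {..<n} R F"
  shows "\<exists>F \<sigma> q. brick {..<n} R F \<and> partial_perm a F {b - q..<b} \<sigma> \<and> q = min a (b - a)"
proof -
  define \<J> where "\<J> = {J. \<exists>F \<sigma>. brick {..<n} R F \<and> partial_perm a F J \<sigma>}"
  have "\<J> \<subseteq> Pow {a..<b}" unfolding \<J>_def partial_perm_def by blast
  then have "finite \<J>" by (rule finite_subset) simp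
  moreover have "\<J> \<noteq> {}" using eliminate[OF assms, of a] ab unfolding \<J>_def by auto
  ultimately obtain J :: "nat set" where J: "J \<in> \<J>" and max: "\<And>J'. J' \<in> \<J> \<Longrightarrow> \<Sum>J' \<le> \<Sum>J"
  proof -
    have fin: "finite (Sum ` \<J>)" and ne: "Sum ` \<J> \<noteq> {}" using \<open>finite \<J>\<close> \<open>\<J> \<noteq> {}\<close> by auto
    obtain J where J: "J \<in> \<J>" "Max (Sum ` \<J>) = \<Sum>J" using Max_in[OF fin ne] by blast
    show ?thesis by (rule that[OF J(1)]) (use Max_ge[OF fin] J(2) in auto)
  qed
  then obtain F \<sigma> where F: "brick {..<n} R F" and pp: "partial_perm a F J \<sigma>"
    unfolding \<J>_def by blast
  have Jab: "J \<subseteq> {a..<b}" and inj: "inj_on \<sigma> J" and \<sigma>: "\<sigma> ` J \<subseteq> {..<a}"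
    and Fe: "\<And>i p. a \<le> i \<Longrightarrow> i < b \<Longrightarrow> p < a \<Longrightarrow> F i p = (if i \<in> J \<and> p = \<sigma> i then 1 else 0)"
    using pp unfolding partial_perm_def by auto
  have finJ: "finite J" using Jab finite_subset by blast
  have RLJ: "R k j" if "k \<in> {a..<b} - J" "j \<in> J" for k j
  proof (rule ccontr)
    assume n: "\<not> R k j"
    show False
    proof (rule brick_no_isolated_pair[OF F, of "\<sigma> j" k])
      show "F l (\<sigma> j) = 0" if l: "a \<le> l" "l < b" "R k l" for l
      proof -
        have "\<sigma> j < a" using \<sigma> \<open>j \<in> J\<close> by auto
        moreover have "\<not> (l \<in> J \<and> \<sigma> j = \<sigma> l)"
          using l n \<open>j \<in> J\<close> inj unfolding inj_on_def by blast
        ultimately show ?thesis using Fe[of l "\<sigma> j"] l by simp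
      qed
    qed (use that \<sigma> Fe in auto)
  qed
  have LJ: "k < j" if k: "k \<in> {a..<b} - J" and j: "j \<in> J" for k j
  proof (rule ccontr)
    assume "\<not> k < j"
    then have jk: "j < k" using that by (cases "j = k") auto
    define \<tau> where "\<tau> = (\<lambda>i. if i = j then k else if i = k then j else i)"
    have \<tau>\<tau>: "\<tau> (\<tau> i) = i" for i by (auto simp: \<tau>_def)
    have jn: "j < n" "k < n" "a \<le> j" "j < b" using k j Jab ab by auto
    have bij: "bij_betw \<tau> {..<n} {..<n}"
      by (rule bij_betw_byWitness[where f' = \<tau>]) (use jn in \<open>auto simp: \<tau>_def\<close>)
    have kj: "R k j" "R j k" using RLJ[OF k j] RMM[of j k] jk k by auto
    have tau_R: "R i l \<Longrightarrow> R (\<tau> i) (\<tau> l)" for i l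
      using kj allowed_trans[of S T] allowed_refl[of S T] unfolding \<tau>_def by (smt (verit))
    have "brick {..<n} R (\<lambda>i l. F (\<tau> i) (\<tau> l))"
    proof (rule brick_bij[OF bij])
      show "R i l \<longleftrightarrow> R (\<tau> i) (\<tau> l)" for i l using tau_R[of i l] tau_R[of "\<tau> i" "\<tau> l"] \<tau>\<tau> by auto
      show "brick {..<n} R (\<lambda>i j. F (\<tau> (\<tau> i)) (\<tau> (\<tau> j)))" using F by (simp add: \<tau>\<tau>)
    qed
    moreover have "partial_perm a (\<lambda>i l. F (\<tau> i) (\<tau> l)) (\<tau> ` J) (\<sigma> \<circ> \<tau>)"
      unfolding partial_perm_def
    proof (intro conjI ballI allI impI)
      show "\<tau> ` J \<subseteq> {a..<b}" using Jab k j by (auto simp: \<tau>_def)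
      show "inj_on (\<sigma> \<circ> \<tau>) (\<tau> ` J)" using inj by (auto simp: inj_on_def \<tau>\<tau>)
      show "(\<sigma> \<circ> \<tau>) ` \<tau> ` J \<subseteq> {..<a}" using \<sigma> by (auto simp: \<tau>\<tau>)
      fix i p assume i: "i \<in> {a..<b}" and p: "p < a"
      have "\<tau> p = p" using p jn k by (auto simp: \<tau>_def)
      moreover have "a \<le> \<tau> i" "\<tau> i < b" using i jn k by (auto simp: \<tau>_def)
      moreover have "i \<in> \<tau> ` J \<longleftrightarrow> \<tau> i \<in> J" using \<tau>\<tau> by (metis image_iff)
      ultimately show "F (\<tau> i) (\<tau> p) = (if i \<in> \<tau> ` J \<and> p = (\<sigma> \<circ> \<tau>) i then 1 else 0)"
        using Fe[of "\<tau> i" p] p by simp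
    qed
    ultimately have "\<tau> ` J \<in> \<J>" unfolding \<J>_def by blast
    then have "\<Sum>(\<tau> ` J) \<le> \<Sum>J" by (rule max)
    moreover have "\<tau> ` J = insert k (J - {j})" using k j by (auto simp: \<tau>_def)
    moreover have "\<Sum>(insert k (J - {j})) = k + \<Sum>(J - {j})" using k finJ by simp
    moreover have "\<Sum>J = j + \<Sum>(J - {j})" using j finJ by (simp add: sum.remove)
    ultimately show False using jk by simp
  qed
  define q where "q = card J"
  have Jq: "J = {b - q..<b}" unfolding q_def by (rule upper_end_eq[OF Jab LJ])
  have qba: "q \<le> b - a" using card_mono[OF _ Jab] by (simp add: q_def)
  have qa: "q \<le> a" using card_inj_on_le[OF inj \<sigma>] by (simp add: q_def)
  have "q = a \<or> q = b - a"
  proof (rule ccontr)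
    assume n: "\<not> (q = a \<or> q = b - a)"
    have "card (\<sigma> ` J) < card {..<a}" using n qa card_image[OF inj] by (simp add: q_def)
    then obtain p where p: "p < a" "p \<notin> \<sigma> ` J" using card_mono[of "\<sigma> ` J" "{..<a}"] finJ
      by (metis finite_imageI lessThan_iff not_le subsetI)
    have "a \<notin> J" using Jq n qba ab by auto
    show False
    proof (rule brick_no_isolated_pair[OF F p(1), of a])
      show "F l p = 0" if "a \<le> l" "l < b" for l using Fe[OF that p(1)] p(2) by auto
      show "F a r = 0" if "r < a" for r using Fe[of a r] that ab \<open>a \<notin> J\<close> by auto
    qed (use ab in auto)
  qed
  then have "q = min a (b - a)" using qa qba by auto
  then show ?thesis using F pp Jq by blast
qed

lemma pivot_instance:
  assumes q: "q = min a (b - a)" and inj: "inj_on \<sigma> {b - q..<b}" and \<sigma>: "\<sigma> ` {b - q..<b} \<subseteq> {..<a}"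
  shows "pivot {..<a} {b - q..<b} {a..<b - q} {b..<n} ({..<a} - \<sigma> ` {b - q..<b}) R
    (\<lambda>j. if a \<le> j then \<sigma> j else j)
    (\<lambda>p. if p \<in> \<sigma> ` {b - q..<b} then inv_into {b - q..<b} \<sigma> p else p)"
proof
  let ?J = "{b - q..<b}" and ?s = "\<lambda>j. if a \<le> j then \<sigma> j else j"
  have aJ: "a \<le> j" if "j \<in> ?J" for j using that q by auto
  have card: "card (\<sigma> ` ?J) = q" using card_image[OF inj] q by auto
  show "{..<a} - \<sigma> ` ?J = {} \<or> {a..<b - q} = {}"
  proof (cases "q = a")
    case True
    then have "\<sigma> ` ?J = {..<a}" using card \<sigma> by (intro card_subset_eq) auto
    then show ?thesis by simp
  qed (use q in auto)
  show "bij_betw ?s (?J \<union> ({..<a} - \<sigma> ` ?J)) {..<a}"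
    unfolding bij_betw_def
  proof
    show "inj_on ?s (?J \<union> ({..<a} - \<sigma> ` ?J))" using inj aJ by (fastforce simp: inj_on_def)
    have "?s ` ?J = \<sigma> ` ?J" using aJ by (auto simp: image_iff)
    moreover have "?s ` ({..<a} - \<sigma> ` ?J) = {..<a} - \<sigma> ` ?J" by (auto simp: image_iff)
    ultimately show "?s ` (?J \<union> ({..<a} - \<sigma> ` ?J)) = {..<a}"
      unfolding image_Un using \<sigma> by auto
  qed
  show "(if ?s j \<in> \<sigma> ` ?J then inv_into ?J \<sigma> (?s j) else ?s j) = j"
    if "j \<in> ?J \<union> ({..<a} - \<sigma> ` ?J)" for j
    using that aJ[of j] inv_into_f_f[OF inj, of j] by auto
  show "R k l" if "k \<in> {a..<b - q}" "l \<in> {b - q..<b}" for k l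
    using that RMM[of k l] by auto
qed (use ab RAA RAM RAN RIA RMN q in auto)

definition reduced :: "nat \<Rightarrow> nat \<Rightarrow> nat \<Rightarrow> bool" where
  "reduced q k l \<longleftrightarrow> R k l \<and> \<not> (k \<in> {a..<b - q} \<and> l \<in> {b - q..<b})"

text \<open>
  The reduction of the previous locale in coordinates. From left to right, the surviving indices \<open>K\<close>
  are renamed to \<open>q, \<dots>, a - 1\<close>; from right to left, \<open>J\<close> is identified with \<open>{..<q}\<close> by a shift.
\<close>

lemma has_brick_reduced:
  assumes q: "q = min a (b - a)"
  shows "has_brick {..<n} R \<longleftrightarrow> has_brick {q..<n} (reduced q)"
proof
  have sets: "{b - q..<b} \<union> {a..<b - q} \<union> {b..<n} = {a..<n}" using q ab by auto
  have I: "{..<a} \<union> {a..<n} = {..<n}" using ab by auto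
  {
    assume "has_brick {..<n} R"
    then obtain F0 where "brick {..<n} R F0" unfolding has_brick_def by blast
    from normal_form_exists[OF this] obtain F \<sigma> where
      F: "brick {..<n} R F" and pp: "partial_perm a F {b - q..<b} \<sigma>" using q by blast
    have inj: "inj_on \<sigma> {b - q..<b}" and \<sigma>: "\<sigma> ` {b - q..<b} \<subseteq> {..<a}"
      and Fe: "\<And>i p. a \<le> i \<Longrightarrow> i < b \<Longrightarrow> p < a \<Longrightarrow> F i p = (if i \<in> {b - q..<b} \<and> p = \<sigma> i then 1 else 0)"
      using pp unfolding partial_perm_def by auto
    let ?K = "{..<a} - \<sigma> ` {b - q..<b}"
    interpret pv: pivot "{..<a}" "{b - q..<b}" "{a..<b - q}" "{b..<n}" ?K R
      "\<lambda>j. if a \<le> j then \<sigma> j else j"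
      "\<lambda>p. if p \<in> \<sigma> ` {b - q..<b} then inv_into {b - q..<b} \<sigma> p else p"
      by (rule pivot_instance[OF q inj \<sigma>])
    have pvI: "pv.I = {..<n}" unfolding pv.I_def pv.I'_def sets I ..
    have pvI2: "pv.I2 = ?K \<union> {a..<n}" unfolding pv.I2_def pv.I'_def sets ..
    have "pv.normal_form F"
      unfolding pv.normal_form_def
    proof (intro ballI)
      fix i p assume i: "i \<in> {b - q..<b} \<union> {a..<b - q}" and p: "p \<in> {..<a}"
      have ia: "a \<le> i" "i < b" using i q by auto
      have "(i \<in> {b - q..<b} \<and> p = \<sigma> i)
        \<longleftrightarrow> i = (if p \<in> \<sigma> ` {b - q..<b} then inv_into {b - q..<b} \<sigma> p else p)"
      proof (cases "p \<in> \<sigma> ` {b - q..<b}")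
        case True
        then show ?thesis using inj by (metis f_inv_into_f inv_into_f_f inv_into_into)
      next
        case False
        then show ?thesis using ia p by auto
      qed
      then show "F i p = (if i = (if p \<in> \<sigma> ` {b - q..<b} then inv_into {b - q..<b} \<sigma> p else p) then 1 else 0)"
        using Fe[OF ia] p by simp
    qed
    from pv.brick_compressed[OF this] have "has_brick (?K \<union> {a..<n}) pv.R2"
      using F unfolding pvI pvI2 has_brick_def by blast
    moreover have "has_brick (?K \<union> {a..<n}) pv.R2 \<longleftrightarrow> has_brick {q..<n} (reduced q)"
    proof -
      have "card ?K = a - q"
        using card_Diff_subset[of "\<sigma> ` {b - q..<b}" "{..<a}"] \<sigma> card_image[OF inj] q by auto
      then have "card ?K = card {q..<a}" by simp
      then obtain h where h: "bij_betw h ?K {q..<a}"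
        using finite_same_card_bij[of ?K "{q..<a}"] by auto
      define h' where "h' = (\<lambda>i. if a \<le> i then i else h i)"
      have hK: "h i \<in> {q..<a}" if "i \<in> ?K" for i using h that by (auto simp: bij_betw_def)
      have "bij_betw h' (?K \<union> {a..<n}) ({q..<a} \<union> {a..<n})"
      proof (rule bij_betw_combine)
        show "bij_betw h' ?K {q..<a}"
          using h by (rule bij_betw_cong[THEN iffD1, rotated]) (auto simp: h'_def)
        show "bij_betw h' {a..<n} {a..<n}"
          by (rule bij_betw_cong[THEN iffD1, OF _ bij_betw_id]) (auto simp: h'_def)
      qed auto
      moreover have "{q..<a} \<union> {a..<n} = {q..<n}" using q ab by auto
      ultimately have "bij_betw h' (?K \<union> {a..<n}) {q..<n}" by simp
      then show ?thesis
      proof (rule has_brick_bij)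
        fix k l assume kl: "k \<in> ?K \<union> {a..<n}" "l \<in> ?K \<union> {a..<n}"
        have h'a: "h' i < a \<longleftrightarrow> i < a" if "i \<in> ?K \<union> {a..<n}" for i
          using hK that by (auto simp: h'_def)
        have h'i: "h' i = i" if "a \<le> i" for i using that by (simp add: h'_def)
        consider "k < a" "l < a" | "a \<le> k" "a \<le> l" | "a \<le> k" "l < a" | "k < a" "a \<le> l" by linarith
        then show "pv.R2 k l = reduced q (h' k) (h' l)"
        proof cases
          case 1
          then have "R k l" "R (h' k) (h' l)" "h' k < a" using h'a kl RAA by blast+
          then show ?thesis using 1 unfolding pv.R2_def reduced_def by auto
        next
          case 2
          then show ?thesis using h'i unfolding pv.R2_def reduced_def by auto
        next
          case 3
          then have "\<not> R k l" "\<not> R (h' k) (h' l)" using h'a[OF kl(2)] RIA h'i by auto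
          then show ?thesis unfolding pv.R2_def reduced_def by auto
        next
          case 4
          then have "R k l \<longleftrightarrow> l < b" "R (h' k) (h' l) \<longleftrightarrow> l < b"
            using h'a[OF kl(1)] RAM RAN h'i by (metis not_le)+
          then show ?thesis using 4 h'a[OF kl(1)] unfolding pv.R2_def reduced_def by auto
        qed
      qed
    qed
    ultimately show "has_brick {q..<n} (reduced q)" by blast
  next
    assume br: "has_brick {q..<n} (reduced q)"
    define \<sigma> where "\<sigma> = (\<lambda>j. j - (b - q))"
    have inj: "inj_on \<sigma> {b - q..<b}" by (auto simp: inj_on_def \<sigma>_def)
    have im: "\<sigma> ` {b - q..<b} = {..<q}"
    proof (intro Set.set_eqI iffI)
      fix i assume "i \<in> {..<q}"
      then have "i = \<sigma> (b - q + i)" "b - q + i \<in> {b - q..<b}" using q by (auto simp: \<sigma>_def)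
      then show "i \<in> \<sigma> ` {b - q..<b}" by (rule image_eqI)
    qed (auto simp: \<sigma>_def)
    have \<sigma>: "\<sigma> ` {b - q..<b} \<subseteq> {..<a}" using im q by auto
    interpret pv: pivot "{..<a}" "{b - q..<b}" "{a..<b - q}" "{b..<n}" "{..<a} - \<sigma> ` {b - q..<b}" R
      "\<lambda>j. if a \<le> j then \<sigma> j else j"
      "\<lambda>p. if p \<in> \<sigma> ` {b - q..<b} then inv_into {b - q..<b} \<sigma> p else p"
      by (rule pivot_instance[OF q inj \<sigma>])
    have pvI: "pv.I = {..<n}" unfolding pv.I_def pv.I'_def sets I ..
    have "{..<a} - {..<q} \<union> {a..<n} = {q..<n}" using q ab by auto
    then have pvI2: "pv.I2 = {q..<n}" unfolding pv.I2_def pv.I'_def sets unfolding im .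
    have "pv.R2 = reduced q" by (intro ext) (simp add: pv.R2_def reduced_def)
    then show "has_brick {..<n} R"
      using pv.has_brick_of_reduction br allowed_trans[of S T] unfolding pvI pvI2 by metis
  }
qed

end

section \<open>The reduction on pairs of compositions\<close>

fun cuts :: "nat list \<Rightarrow> nat set" where
  "cuts [] = {0}"
| "cuts (x # xs) = insert 0 ((+) x ` cuts xs)"

text \<open>
  The seaweed algebra of type \<open>a\<close> over \<open>b\<close> has index 0. Zero parts are admitted, since they do not change
  the set of cuts and arise in the reduction.
\<close>

definition frob :: "nat list \<Rightarrow> nat list \<Rightarrow> bool" where
  "frob a b \<longleftrightarrow> sum_list a = sum_list b \<and> has_brick {..<sum_list a} (allowed (cuts a) (cuts b))"

lemma zero_cuts [simp]: "0 \<in> cuts xs"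
  by (cases xs) auto

lemma cuts_append: "cuts (xs @ ys) = cuts xs \<union> (+) (sum_list xs) ` cuts ys"
proof (induction xs)
  case (Cons x xs)
  then show ?case by (simp add: image_Un image_image add.assoc)
qed (auto simp: image_iff)

lemma cuts_le: "c \<in> cuts xs \<Longrightarrow> c \<le> sum_list xs"
  by (induction xs arbitrary: c) auto

lemma cuts_rev: "cuts (rev xs) = (\<lambda>c. sum_list xs - c) ` cuts xs"
proof (induction xs)
  case (Cons x xs)
  have "(\<lambda>c. x + sum_list xs - c) ` cuts (x # xs)
      = insert (x + sum_list xs) ((\<lambda>c. sum_list xs - c) ` cuts xs)"
    by (simp add: image_image)
  moreover have "sum_list xs \<in> (\<lambda>c. sum_list xs - c) ` cuts xs"
    by (rule image_eqI[of _ _ 0]) auto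
  ultimately show ?case by (auto simp: Cons.IH cuts_append add.commute)
qed simp

lemma frob_swap: "frob a b \<longleftrightarrow> frob b a"
proof -
  have "allowed (cuts b) (cuts a) = (\<lambda>k l. allowed (cuts a) (cuts b) l k)"
    by (intro ext) (auto simp: allowed_def)
  then show ?thesis using has_brick_transpose[of "{..<sum_list a}" "allowed (cuts a) (cuts b)"]
    unfolding frob_def by auto
qed

text \<open>
  Reversing the order of the basis exchanges initial and final segments, and transposing restores them.
\<close>

lemma frob_rev: "frob a b \<longleftrightarrow> frob (rev a) (rev b)"
proof (cases "sum_list a = sum_list b")
  case True
  define n where "n = sum_list a"
  have "has_brick {..<n} (\<lambda>k l. allowed (cuts a) (cuts b) l k)
      \<longleftrightarrow> has_brick {..<n} (allowed (cuts (rev a)) (cuts (rev b)))"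
  proof (rule has_brick_bij)
    show "bij_betw (\<lambda>i. n - 1 - i) {..<n} {..<n}"
      by (rule bij_betw_byWitness[where f' = "\<lambda>i. n - 1 - i"]) auto
    fix k l assume kl: "k \<in> {..<n}" "l \<in> {..<n}"
    have *: "(n - 1 - i < n - c) \<longleftrightarrow> \<not> i < c" if "i \<in> {..<n}" "c \<le> n" for i c
      using that by auto
    have ac: "c \<le> n" if "c \<in> cuts a" for c using cuts_le[OF that] by (simp add: n_def)
    have bc: "c \<le> n" if "c \<in> cuts b" for c using cuts_le[OF that] True by (simp add: n_def)
    show "allowed (cuts a) (cuts b) l k = allowed (cuts (rev a)) (cuts (rev b)) (n - 1 - k) (n - 1 - l)"
    proof -
      have na: "sum_list a = n" and nb: "sum_list b = n" using True by (simp_all add: n_def)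
      have "(\<forall>c\<in>cuts a. n - 1 - l < n - c \<longrightarrow> n - 1 - k < n - c) \<longleftrightarrow> (\<forall>c\<in>cuts a. k < c \<longrightarrow> l < c)"
        by (intro ball_cong refl) (use kl * ac in blast)
      moreover have "(\<forall>c\<in>cuts b. n - 1 - k < n - c \<longrightarrow> n - 1 - l < n - c) \<longleftrightarrow> (\<forall>c\<in>cuts b. l < c \<longrightarrow> k < c)"
        by (intro ball_cong refl) (use kl * bc in blast)
      ultimately show ?thesis
        by (simp only: allowed_def cuts_rev na nb ball_simps(9) conj_commute)
    qed
  qed
  then show ?thesis
    using True has_brick_transpose[of "{..<n}" "allowed (cuts a) (cuts b)"]
    by (simp add: frob_def n_def)
qed (simp add: frob_def)

lemma frob_zero [simp]: "frob (0 # a) b \<longleftrightarrow> frob a b" "frob a (0 # b) \<longleftrightarrow> frob a b"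
  by (simp_all add: frob_def insert_absorb)

text \<open>
  If the first blocks agree, the algebra is a direct product and the projection to the first factor
  lies in every kernel. So the first block is everything; on a full matrix algebra a brick \<open>F\<close> commutes
  with itself, hence is a scalar, hence commutes with everything.
\<close>

lemma frob_equal:
  assumes c: "0 < c"
  shows "frob (c # a) (c # b) \<longleftrightarrow> c = 1 \<and> sum_list a = 0 \<and> sum_list b = 0"
proof (cases "sum_list a = sum_list b")
  case s: True
  define n where "n = c + sum_list a"
  let ?R = "allowed (cuts (c # a)) (cuts (c # b))"
  have cs: "x = 0 \<or> c \<le> x" if "x \<in> cuts (c # a) \<union> cuts (c # b)" for x using that by auto
  have RAA: "?R k l" if "k < c" "l < c" for k l
    using that cs unfolding allowed_def by (metis UnI1 UnI2 less_le_trans not_less_zero)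
  have c_in: "c \<in> cuts (c # a)" "c \<in> cuts (c # b)" by (auto intro: image_eqI[of _ _ 0])
  then have Riff: "?R k l \<Longrightarrow> k < c \<longleftrightarrow> l < c" for k l unfolding allowed_def by blast
  have "has_brick {..<n} ?R \<longleftrightarrow> c = 1 \<and> sum_list a = 0"
  proof
    assume *: "c = 1 \<and> sum_list a = 0"
    have "n = 1" unfolding n_def using * by linarith
    then have "{..<n} = {0}" by auto
    then show "has_brick {..<n} ?R" by (auto simp: has_brick_def brick_def scalar_on_def)
  next
    assume "has_brick {..<n} ?R"
    then obtain F where F: "brick {..<n} ?R F" unfolding has_brick_def by blast
    define x :: "nat \<Rightarrow> nat \<Rightarrow> complex" where "x = (\<lambda>i j. if i = j \<and> i < c then 1 else 0)"
    have x: "mprod {..<n} F x i j = (if j < c then F i j else 0)"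
      "mprod {..<n} x F i j = (if i < c then F i j else 0)" if "i < n" "j < n" for i j
    proof -
      have "mprod {..<n} F x i j = (\<Sum>k<n. if k = j then (if j < c then F i j else 0) else 0)"
        unfolding mprod_def x_def by (rule sum.cong) auto
      then show "mprod {..<n} F x i j = (if j < c then F i j else 0)" using that by simp
      have "mprod {..<n} x F i j = (\<Sum>k<n. if k = i then (if i < c then F i j else 0) else 0)"
        unfolding mprod_def x_def by (rule sum.cong) auto
      then show "mprod {..<n} x F i j = (if i < c then F i j else 0)" using that by simp
    qed
    have "supported {..<n} ?R x" using RAA by (auto simp: supported_def x_def)
    moreover have "centralizes {..<n} ?R F x"
      using x Riff unfolding centralizes_def by simp
    ultimately obtain d where d: "\<And>i j. i < n \<Longrightarrow> j < n \<Longrightarrow> x i j = (if i = j then d else 0)"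
      using F unfolding brick_def scalar_on_def by fastforce
    have "sum_list a = 0"
    proof (rule ccontr)
      assume "sum_list a \<noteq> 0"
      then have "0 < n" "c < n" unfolding n_def by linarith+
      then show False using d[of 0 0] d[of c c] c by (simp add: x_def)
    qed
    then have nc: "n = c" by (simp add: n_def)
    have "supported {..<n} ?R F" "centralizes {..<n} ?R F F"
      using RAA nc by (auto simp: supported_def centralizes_def)
    then obtain e where e: "\<And>i j. i \<in> {..<n} \<Longrightarrow> j \<in> {..<n} \<Longrightarrow> F i j = (if i = j then e else 0)"
      using F unfolding brick_def scalar_on_def by blast
    define y :: "nat \<Rightarrow> nat \<Rightarrow> complex" where "y = (\<lambda>i j. if i = 0 \<and> j = c - 1 then 1 else 0)"
    have "supported {..<n} ?R y" using RAA nc by (auto simp: supported_def)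
    moreover have "centralizes {..<n} ?R F y"
      unfolding centralizes_def using mprod_scalar[OF finite_lessThan e] by metis
    ultimately obtain d where d: "\<And>i j. i < n \<Longrightarrow> j < n \<Longrightarrow> y i j = (if i = j then d else 0)"
      using F unfolding brick_def scalar_on_def by fastforce
    have "c = 1" using d[of 0 "c - 1"] nc c by (auto simp: y_def split: if_splits)
    then show "c = 1 \<and> sum_list a = 0" using \<open>sum_list a = 0\<close> by blast
  qed
  then show ?thesis using s by (auto simp: frob_def n_def)
next
  case False
  then have "\<not> frob (c # a) (c # b)" by (simp add: frob_def)
  then show ?thesis using False by metis
qed

lemma frob_first_blocks:
  assumes ab: "0 < a" "a < b" and s: "a + sum_list as = b + sum_list bs" and q: "q = min a (b - a)"
    and s': "sum_list as' + q = b + sum_list bs" "sum_list bs' + q = b + sum_list bs"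
    and eq: "\<And>k l. allowed (cuts as') (cuts bs') k l \<longleftrightarrow>
      allowed (cuts (a # as)) (cuts (b # bs)) (q + k) (q + l) \<and>
      \<not> (q + k \<in> {a..<b - q} \<and> q + l \<in> {b - q..<b})"
  shows "frob (a # as) (b # bs) \<longleftrightarrow> frob as' bs'"
proof -
  define n where "n = b + sum_list bs"
  interpret first_blocks n a b "cuts (a # as)" "cuts (b # bs)"
    by unfold_locales (use ab in \<open>auto simp: n_def intro: image_eqI[of _ _ 0]\<close>)
  have "bij_betw ((+) q) {..<n - q} {q..<n}"
    by (rule bij_betw_byWitness[where f' = "\<lambda>i. i - q"]) auto
  then have "has_brick {..<n - q} (allowed (cuts as') (cuts bs')) \<longleftrightarrow> has_brick {q..<n} (reduced q)"
    by (rule has_brick_bij) (simp only: eq reduced_def)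
  moreover have "sum_list as' = n - q" "sum_list bs' = n - q" using s' by (auto simp: n_def)
  moreover have "a + sum_list as = n" "b + sum_list bs = n" using s by (auto simp: n_def)
  ultimately show ?thesis using has_brick_reduced[OF q] unfolding frob_def by simp
qed

text \<open>
  The two moves of the reduction. In the wide case \<open>q = x\<close>: the first top block disappears and the
  bottom block \<open>y\<close> loses \<open>x\<close> elements and is cut. In the narrow case \<open>q = y - x\<close>: the top block
  shrinks, and since \<open>y - q = x\<close> no new cut appears.
\<close>

lemma frob_wide:
  assumes x: "0 < x" "2 * x \<le> y"
  shows "frob (x # a) (y # b) \<longleftrightarrow> frob a ((y - 2 * x) # x # b)"
proof (cases "x + sum_list a = y + sum_list b")
  case True
  show ?thesis
  proof (rule frob_first_blocks[where q = x])
    fix k l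
    have 1: "(\<forall>c\<in>cuts ((y - 2 * x) # x # b). k < c \<longrightarrow> l < c)
      \<longleftrightarrow> (\<forall>c\<in>cuts (y # b). x + k < c \<longrightarrow> x + l < c) \<and> \<not> (k < y - 2 * x \<and> y - 2 * x \<le> l \<and> x + l < y)"
      (is "?l \<longleftrightarrow> ?r")
    proof -
      have e: "y - 2 * x + (x + c) = y - x + c" for c using x by simp
      have f: "(x + i < y + c) \<longleftrightarrow> (i < y - x + c)" for i c using x by auto
      have g: "?l \<longleftrightarrow> (k < y - 2 * x \<longrightarrow> l < y - 2 * x) \<and> (\<forall>c\<in>cuts b. k < y - x + c \<longrightarrow> l < y - x + c)"
        by (simp add: image_image e del: add_diff_assoc2)
      have h: "?r \<longleftrightarrow> (\<forall>c\<in>cuts b. k < y - x + c \<longrightarrow> l < y - x + c)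
        \<and> \<not> (k < y - 2 * x \<and> y - 2 * x \<le> l \<and> l < y - x)"
        using f[of _ 0] by (simp add: f)
      have w: "k < y - x \<longrightarrow> l < y - x" if "\<forall>c\<in>cuts b. k < y - x + c \<longrightarrow> l < y - x + c"
        using bspec[OF that zero_cuts] by simp
      have "y - 2 * x \<le> y - x" by simp
      with w show ?thesis unfolding g h by (meson less_le_trans not_le_imp_less leD)
    qed
    have 2: "(\<forall>c\<in>cuts (x # a). x + l < c \<longrightarrow> x + k < c) \<longleftrightarrow> (\<forall>c\<in>cuts a. l < c \<longrightarrow> k < c)" by simp
    have 3: "(x + k \<in> {x..<y - x} \<and> x + l \<in> {y - x..<y}) \<longleftrightarrow> k < y - 2 * x \<and> y - 2 * x \<le> l \<and> x + l < y"
      using x by auto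
    show "allowed (cuts a) (cuts ((y - 2 * x) # x # b)) k l \<longleftrightarrow>
      allowed (cuts (x # a)) (cuts (y # b)) (x + k) (x + l) \<and>
      \<not> (x + k \<in> {x..<y - x} \<and> x + l \<in> {y - x..<y})"
      by (simp only: allowed_def 1 2 3 conj_assoc)
  qed (use x True in auto)
qed (use x in \<open>auto simp: frob_def\<close>)

lemma frob_narrow:
  assumes x: "x < y" "y < 2 * x"
  shows "frob (x # a) (y # b) \<longleftrightarrow> frob ((2 * x - y) # a) (x # b)"
proof (cases "x + sum_list a = y + sum_list b")
  case True
  show ?thesis
  proof (rule frob_first_blocks[where q = "y - x"])
    fix k l
    have "(y - x + i < x + c) \<longleftrightarrow> (i < 2 * x - y + c)" "(y - x + i < y + c) \<longleftrightarrow> (i < x + c)" for i c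
      using x by auto
    then show "allowed (cuts ((2 * x - y) # a)) (cuts (x # b)) k l \<longleftrightarrow>
      allowed (cuts (x # a)) (cuts (y # b)) (y - x + k) (y - x + l) \<and>
      \<not> (y - x + k \<in> {x..<y - (y - x)} \<and> y - x + l \<in> {y - (y - x)..<y})"
      unfolding allowed_def using x by simp
  qed (use x True in auto)
qed (use x in \<open>auto simp: frob_def\<close>)

lemma frob_wide': "0 < y \<Longrightarrow> 2 * y \<le> x \<Longrightarrow> frob (x # a) (y # b) \<longleftrightarrow> frob ((x - 2 * y) # y # a) b"
  using frob_wide[of y x b a] frob_swap by blast

lemma frob_narrow': "y < x \<Longrightarrow> x < 2 * y \<Longrightarrow> frob (x # a) (y # b) \<longleftrightarrow> frob (y # a) ((2 * y - x) # b)"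
  using frob_narrow[of y x b a] frob_swap by blast

definition odds :: "nat list \<Rightarrow> nat" where
  "odds xs = length (filter odd xs)"

lemma odds_simps [simp]: "odds [] = 0" "odds (x # xs) = x mod 2 + odds xs"
  "odds (xs @ ys) = odds xs + odds ys" "odds (replicate k x) = k * (x mod 2)"
  by (auto simp: odds_def odd_iff_mod_2_eq_one filter_replicate)

lemma odds_zero: "sum_list xs = 0 \<Longrightarrow> odds xs = 0"
  by (induction xs) auto

text \<open>
  Both moves preserve the number of odd parts, as the only part that changes keeps its parity, and the
  terminal type is \<open>1\<close> over \<open>1\<close>. (Odd blocks are the end points of paths in the meander graph of the
  two compositions, and index 0 means that the graph is a single path.)
\<close>

lemma frob_odds:
  assumes "frob a b" "0 < sum_list a"
  shows "odds a + odds b = 2"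
  using assms
proof (induction "sum_list a + length a + length b" arbitrary: a b rule: less_induct)
  case less
  have sums: "sum_list a = sum_list b" using less.prems by (simp add: frob_def)
  obtain x a' where a: "a = x # a'" using less.prems by (cases a) auto
  obtain y b' where b: "b = y # b'" using less.prems sums by (cases b) auto
  have step: "odds (u # us) + odds (v # vs) = 2"
    if uv: "0 < u" "u < v" and f: "frob (u # us) (v # vs)"
      and m: "sum_list (u # us) + length (u # us) + length (v # vs) = sum_list a + length a + length b"
    for u us v vs
  proof -
    have m': "u + sum_list us + length us + length vs + 2 = sum_list a + length a + length b"
      using m by simp
    show ?thesis
    proof (cases "2 * u \<le> v")
      case True
      have s: "u + sum_list us = v + sum_list vs" using f by (simp add: frob_def)
      have f': "frob us ((v - 2 * u) # u # vs)" using frob_wide[of u v us vs] uv True f by blast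
      have "odds us + odds ((v - 2 * u) # u # vs) = 2"
      proof (rule less.hyps[OF _ f'])
        show "sum_list us + length us + length ((v - 2 * u) # u # vs) < sum_list a + length a + length b"
          using m' uv(1) True by (simp only: sum_list.Cons list.size)
        show "0 < sum_list us" using s uv True by linarith
      qed
      moreover have "(v - 2 * u) mod 2 = v mod 2" using True by (simp add: mod2_eq_if)
      ultimately show ?thesis by simp
    next
      case False
      have f': "frob ((2 * u - v) # us) (u # vs)" using frob_narrow[of u v us vs] uv False f by auto
      have "odds ((2 * u - v) # us) + odds (u # vs) = 2"
      proof (rule less.hyps[OF _ f'])
        show "sum_list ((2 * u - v) # us) + length ((2 * u - v) # us) + length (u # vs)
          < sum_list a + length a + length b"
          using m' uv False by simp
        show "0 < sum_list ((2 * u - v) # us)" using False by simp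
      qed
      moreover have "(2 * u - v) mod 2 = v mod 2" using False by (simp add: mod2_eq_if)
      ultimately show ?thesis by simp
    qed
  qed
  consider "x = 0" | "y = 0" | "0 < x" "x < y" | "0 < y" "y < x" | "x = y" "0 < x" by linarith
  then show ?case
  proof cases
    case 1
    then show ?thesis using less.hyps[of a' b] less.prems a by simp
  next
    case 2
    then show ?thesis using less.hyps[of a b'] less.prems b by simp
  next
    case 3
    then show ?thesis using step[of x y a' b'] less.prems a b by simp
  next
    case 4
    then show ?thesis using step[of y x b' a'] less.prems frob_swap[of a b] sums a b by simp
  next
    case 5
    then show ?thesis using less.prems frob_equal[of x a' b'] a b odds_zero by auto
  qed
qed

section \<open>Families of partitions with parts up to 4\<close>

text \<open>
  By reversal, the moves may also be made at the right ends.
\<close>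

lemma frob_right_wide: "0 < x \<Longrightarrow> 2 * x \<le> y \<Longrightarrow> frob (a @ [x]) (b @ [y]) \<longleftrightarrow> frob a (b @ [x, y - 2 * x])"
  using frob_wide[of x y "rev a" "rev b"] frob_rev[of "a @ [x]" "b @ [y]"] frob_rev[of a "b @ [x, y - 2 * x]"] by simp

lemma frob_right_wide': "0 < y \<Longrightarrow> 2 * y \<le> x \<Longrightarrow> frob (a @ [x]) (b @ [y]) \<longleftrightarrow> frob (a @ [y, x - 2 * y]) b"
  using frob_right_wide[of y x b a] frob_swap by blast

lemma frob_right_zero [simp]: "frob (a @ [0]) b \<longleftrightarrow> frob a b" "frob a (b @ [0]) \<longleftrightarrow> frob a b"
  using frob_rev[of "a @ [0]" b] frob_rev[of a "b @ [0]"] frob_rev[of a b] by simp_all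

lemma frob_right_half': "0 < y \<Longrightarrow> x = 2 * y \<Longrightarrow> frob (a @ [x]) (b @ [y]) \<longleftrightarrow> frob (a @ [y]) b"
  using frob_right_wide'[of y x a b] frob_right_zero(1)[of "a @ [y]" b] by simp

text \<open>
  In each of the next lemmas a few moves, chosen at the left or at the right end, turn a family of
  types into a smaller member of the same family, up to reversal, or into another family of the list.
  The large part \<open>N\<close> of the bottom composition stays long enough for the moves to be the same for all
  members.
\<close>

lemma frob_2s_1_reduce:
  assumes N: "N = 2 * q + 3"
  shows "frob (replicate (Suc q) 2 @ [1]) ([N]) \<longleftrightarrow> frob ([1] @ replicate q 2) ([N - 2])"
proof -
  have "frob (replicate (Suc q) 2 @ [1]) ([N]) \<longleftrightarrow> frob (replicate (Suc q) 2) ([1, N - 2])"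
    using frob_right_wide[where x = 1 and y = "N" and a = "replicate (Suc q) 2" and b = "[]"] N
    by (simp add: replicate_append_same)
  also have "\<dots> \<longleftrightarrow> frob ([1] @ replicate q 2) ([N - 2])"
    using frob_wide'[where x = 2 and y = 1 and a = "replicate q 2" and b = "[N - 2]"] N
    by (simp add: replicate_append_same)
  finally show ?thesis .
qed

lemma frob_3_2s_reduce:
  assumes N: "N = 2 * q + 5"
  shows "frob ([3] @ replicate (Suc q) 2) ([N]) \<longleftrightarrow> frob ([1] @ replicate q 2) ([N - 4])"
proof -
  have "frob ([3] @ replicate (Suc q) 2) ([N]) \<longleftrightarrow> frob ([3] @ replicate q 2) ([2, N - 4])"
    using frob_right_wide[where x = 2 and y = "N" and a = "[3] @ replicate q 2" and b = "[]"] N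
    by (simp add: replicate_append_same)
  also have "\<dots> \<longleftrightarrow> frob ([2] @ replicate q 2) ([1, N - 4])"
    using frob_narrow'[where x = 3 and y = 2 and a = "replicate q 2" and b = "[N - 4]"] N
    by (simp add: replicate_append_same)
  also have "\<dots> \<longleftrightarrow> frob ([1] @ replicate q 2) ([N - 4])"
    using frob_wide'[where x = 2 and y = 1 and a = "replicate q 2" and b = "[N - 4]"] N
    by (simp add: replicate_append_same)
  finally show ?thesis .
qed

lemma frob_4s_1_reduce:
  assumes N: "N = 4 * p + 5"
  shows "frob (replicate (Suc p) 4 @ [1]) ([N]) \<longleftrightarrow> frob (replicate (Suc p) 4) ([1, N - 2])"
proof -
  have "frob (replicate (Suc p) 4 @ [1]) ([N]) \<longleftrightarrow> frob (replicate (Suc p) 4) ([1, N - 2])"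
    using frob_right_wide[where x = 1 and y = "N" and a = "replicate (Suc p) 4" and b = "[]"] N
    by (simp add: replicate_append_same)
  then show ?thesis .
qed

lemma frob_4s_over_1_reduce:
  assumes N: "N = 4 * p + 11"
  shows "frob (replicate (Suc (Suc (Suc p))) 4) ([1, N]) \<longleftrightarrow> frob (replicate (Suc p) 4) ([1, N - 8])"
proof -
  have "frob (replicate (Suc (Suc (Suc p))) 4) ([1, N]) \<longleftrightarrow> frob ([2, 1] @ replicate (Suc (Suc p)) 4) ([N])"
    using frob_wide'[where x = 4 and y = 1 and a = "replicate (Suc (Suc p)) 4" and b = "[N]"] N
    by (simp add: replicate_append_same)
  also have "\<dots> \<longleftrightarrow> frob ([1] @ replicate (Suc (Suc p)) 4) ([N - 4, 2])"
    using frob_wide[where x = 2 and y = "N" and a = "[1] @ replicate (Suc (Suc p)) 4" and b = "[]"] N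
    by (simp add: replicate_append_same)
  also have "\<dots> \<longleftrightarrow> frob ([1] @ replicate (Suc p) 4 @ [2]) ([N - 4])"
    using frob_right_half'[where x = 4 and y = 2 and a = "[1] @ replicate (Suc p) 4" and b = "[N - 4]"] N
    by (simp add: replicate_append_same)
  also have "\<dots> \<longleftrightarrow> frob ([1] @ replicate (Suc p) 4) ([2, N - 8])"
    using frob_right_wide[where x = 2 and y = "N - 4" and a = "[1] @ replicate (Suc p) 4" and b = "[]"] N
    by (simp add: replicate_append_same)
  also have "\<dots> \<longleftrightarrow> frob (replicate (Suc p) 4) ([1, N - 8])"
    using frob_wide[where x = 1 and y = 2 and a = "replicate (Suc p) 4" and b = "[N - 8]"] N
    by (simp add: replicate_append_same)
  finally show ?thesis .
qed

lemma frob_4s_3_reduce: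
  assumes N: "N = 4 * p + 7"
  shows "frob (replicate (Suc p) 4 @ [3]) ([N]) \<longleftrightarrow> frob ([1] @ replicate p 4) ([N - 6])"
proof -
  have "frob (replicate (Suc p) 4 @ [3]) ([N]) \<longleftrightarrow> frob (replicate (Suc p) 4) ([3, N - 6])"
    using frob_right_wide[where x = 3 and y = "N" and a = "replicate (Suc p) 4" and b = "[]"] N
    by (simp add: replicate_append_same)
  also have "\<dots> \<longleftrightarrow> frob ([3] @ replicate p 4) ([2, N - 6])"
    using frob_narrow'[where x = 4 and y = 3 and a = "replicate p 4" and b = "[N - 6]"] N
    by (simp add: replicate_append_same)
  also have "\<dots> \<longleftrightarrow> frob ([2] @ replicate p 4) ([1, N - 6])"
    using frob_narrow'[where x = 3 and y = 2 and a = "replicate p 4" and b = "[N - 6]"] N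
    by (simp add: replicate_append_same)
  also have "\<dots> \<longleftrightarrow> frob ([1] @ replicate p 4) ([N - 6])"
    using frob_wide'[where x = 2 and y = 1 and a = "replicate p 4" and b = "[N - 6]"] N
    by (simp add: replicate_append_same)
  finally show ?thesis .
qed

lemma frob_4s_3_2_reduce:
  assumes N: "N = 4 * p + 13"
  shows "frob (replicate (Suc (Suc p)) 4 @ [3, 2]) ([N]) \<longleftrightarrow> frob (replicate (Suc p) 4) ([1, N - 10])"
proof -
  have "frob (replicate (Suc (Suc p)) 4 @ [3, 2]) ([N]) \<longleftrightarrow> frob (replicate (Suc (Suc p)) 4 @ [3]) ([2, N - 4])"
    using frob_right_wide[where x = 2 and y = "N" and a = "replicate (Suc (Suc p)) 4 @ [3]" and b = "[]"] N
    by (simp add: replicate_append_same)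
  also have "\<dots> \<longleftrightarrow> frob ([2] @ replicate (Suc p) 4 @ [3]) ([N - 4])"
    using frob_wide'[where x = 4 and y = 2 and a = "replicate (Suc p) 4 @ [3]" and b = "[N - 4]"] N
    by (simp add: replicate_append_same)
  also have "\<dots> \<longleftrightarrow> frob ([2] @ replicate (Suc p) 4) ([3, N - 10])"
    using frob_right_wide[where x = 3 and y = "N - 4" and a = "[2] @ replicate (Suc p) 4" and b = "[]"] N
    by (simp add: replicate_append_same)
  also have "\<dots> \<longleftrightarrow> frob ([1] @ replicate (Suc p) 4) ([2, N - 10])"
    using frob_narrow[where x = 2 and y = 3 and a = "replicate (Suc p) 4" and b = "[N - 10]"] N
    by (simp add: replicate_append_same)
  also have "\<dots> \<longleftrightarrow> frob (replicate (Suc p) 4) ([1, N - 10])"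
    using frob_wide[where x = 1 and y = 2 and a = "replicate (Suc p) 4" and b = "[N - 10]"] N
    by (simp add: replicate_append_same)
  finally show ?thesis .
qed

lemma frob_4s_1_1_reduce:
  assumes N: "N = 4 * p + 6"
  shows "frob (replicate (Suc p) 4 @ [1, 1]) ([N]) \<longleftrightarrow> frob (replicate (Suc p) 4) ([1, 1, N - 4])"
proof -
  have "frob (replicate (Suc p) 4 @ [1, 1]) ([N]) \<longleftrightarrow> frob (replicate (Suc p) 4 @ [1]) ([1, N - 2])"
    using frob_right_wide[where x = 1 and y = "N" and a = "replicate (Suc p) 4 @ [1]" and b = "[]"] N
    by (simp add: replicate_append_same)
  also have "\<dots> \<longleftrightarrow> frob (replicate (Suc p) 4) ([1, 1, N - 4])"
    using frob_right_wide[where x = 1 and y = "N - 2" and a = "replicate (Suc p) 4" and b = "[1]"] N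
    by (simp add: replicate_append_same)
  finally show ?thesis .
qed

lemma frob_4s_over_1_1_reduce:
  assumes N: "N = 4 * p + 2"
  shows "frob (replicate (Suc p) 4) ([1, 1, N]) \<longleftrightarrow> frob ([1, 1] @ replicate p 4) ([N])"
proof -
  have "frob (replicate (Suc p) 4) ([1, 1, N]) \<longleftrightarrow> frob ([2, 1] @ replicate p 4) ([1, N])"
    using frob_wide'[where x = 4 and y = 1 and a = "replicate p 4" and b = "[1, N]"] N
    by (simp add: replicate_append_same)
  also have "\<dots> \<longleftrightarrow> frob ([1, 1] @ replicate p 4) ([N])"
    using frob_wide'[where x = 2 and y = 1 and a = "[1] @ replicate p 4" and b = "[N]"] N
    by (simp add: replicate_append_same)
  finally show ?thesis .
qed

lemma frob_4s_3_3_reduce: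
  assumes N: "N = 4 * p + 14"
  shows "frob (replicate (Suc (Suc p)) 4 @ [3, 3]) ([N]) \<longleftrightarrow> frob (replicate (Suc p) 4) ([1, 1, N - 12])"
proof -
  have "frob (replicate (Suc (Suc p)) 4 @ [3, 3]) ([N]) \<longleftrightarrow> frob (replicate (Suc (Suc p)) 4 @ [3]) ([3, N - 6])"
    using frob_right_wide[where x = 3 and y = "N" and a = "replicate (Suc (Suc p)) 4 @ [3]" and b = "[]"] N
    by (simp add: replicate_append_same)
  also have "\<dots> \<longleftrightarrow> frob (replicate (Suc (Suc p)) 4) ([3, 3, N - 12])"
    using frob_right_wide[where x = 3 and y = "N - 6" and a = "replicate (Suc (Suc p)) 4" and b = "[3]"] N
    by (simp add: replicate_append_same)
  also have "\<dots> \<longleftrightarrow> frob ([3] @ replicate (Suc p) 4) ([2, 3, N - 12])"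
    using frob_narrow'[where x = 4 and y = 3 and a = "replicate (Suc p) 4" and b = "[3, N - 12]"] N
    by (simp add: replicate_append_same)
  also have "\<dots> \<longleftrightarrow> frob ([2] @ replicate (Suc p) 4) ([1, 3, N - 12])"
    using frob_narrow'[where x = 3 and y = 2 and a = "replicate (Suc p) 4" and b = "[3, N - 12]"] N
    by (simp add: replicate_append_same)
  also have "\<dots> \<longleftrightarrow> frob ([1] @ replicate (Suc p) 4) ([3, N - 12])"
    using frob_wide'[where x = 2 and y = 1 and a = "replicate (Suc p) 4" and b = "[3, N - 12]"] N
    by (simp add: replicate_append_same)
  also have "\<dots> \<longleftrightarrow> frob (replicate (Suc p) 4) ([1, 1, N - 12])"
    using frob_wide[where x = 1 and y = 3 and a = "replicate (Suc p) 4" and b = "[N - 12]"] N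
    by (simp add: replicate_append_same)
  finally show ?thesis .
qed


lemmas frob_moves = frob_wide frob_narrow frob_wide' frob_narrow' frob_equal

lemma frob_2s_1: "frob (replicate q 2 @ [1]) [2 * q + 1]"
proof (induction q)
  case 0
  show ?case by (simp add: frob_equal)
next
  case (Suc q)
  have "frob ([1] @ replicate q 2) [2 * q + 1]"
    using Suc frob_rev[of "replicate q 2 @ [1]" "[2 * q + 1]"] by simp
  then show ?case using frob_2s_1_reduce[of "2 * Suc q + 1" q] by simp
qed

lemma frob_3_2s: "0 < q \<Longrightarrow> frob ([3] @ replicate q 2) [2 * q + 3]"
  using frob_3_2s_reduce[of "2 * q + 3" "q - 1"] frob_2s_1[of "q - 1"]
    frob_rev[of "replicate (q - 1) 2 @ [1]" "[2 * (q - 1) + 1]"]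
  by (cases q) auto

lemma frob_4s_over_1: "frob (replicate (Suc p) 4) [1, 4 * p + 3]"
proof (induction p rule: induct_nat_012)
  case (ge2 p)
  then show ?case using frob_4s_over_1_reduce[of "4 * Suc (Suc p) + 3" p] by (simp add: add.commute)
qed (simp_all add: frob_moves)

lemma frob_4s_1: "frob (replicate p 4 @ [1]) [4 * p + 1]"
proof (cases p)
  case 0
  then show ?thesis by (simp add: frob_equal)
next
  case (Suc k)
  then show ?thesis using frob_4s_1_reduce[of "4 * p + 1" k] frob_4s_over_1[of k] by (simp add: add.commute)
qed

lemma frob_4s_3: "frob (replicate (Suc p) 4 @ [3]) [4 * p + 7]"
  using frob_4s_3_reduce[of "4 * p + 7" p] frob_4s_1[of p]
    frob_rev[of "replicate p 4 @ [1]" "[4 * p + 1]"] by simp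

lemma frob_4s_3_2: "frob (replicate (Suc (Suc p)) 4 @ [3, 2]) [4 * p + 13]"
  using frob_4s_3_2_reduce[of "4 * p + 13" p] frob_4s_over_1[of p]
  by (simp add: add.commute)

lemma frob_4s_1_1: "frob (replicate p 4 @ [1, 1]) [4 * p + 2]"
proof (induction p)
  case 0
  show ?case by (simp add: frob_moves)
next
  case (Suc p)
  have "frob ([1, 1] @ replicate p 4) [4 * p + 2]"
    using Suc frob_rev[of "replicate p 4 @ [1, 1]" "[4 * p + 2]"] by simp
  then show ?case
    using frob_4s_1_1_reduce[of "4 * Suc p + 2" p] frob_4s_over_1_1_reduce[of "4 * p + 2" p] by simp
qed

lemma frob_4s_3_3: "frob (replicate (Suc (Suc p)) 4 @ [3, 3]) [4 * p + 14]"
  using frob_4s_3_3_reduce[of "4 * p + 14" p] frob_4s_1_1[of "Suc p"]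
    frob_4s_1_1_reduce[of "4 * Suc p + 2" p] by simp

text \<open>
  The remaining types with the right number of odd parts: after boundedly many moves equal blocks
  stand at the left ends, and the type is not \<open>1\<close> over \<open>1\<close>. The numerical conditions exclude small
  partitions that do have index 0.
\<close>

lemma not_frob_4s_2s_1:
  assumes N: "N = 4 * p + 2 * q + 7"
  shows "\<not> frob (replicate (Suc p) 4 @ replicate (Suc q) 2 @ [1]) ([N])"
proof -
  have "frob (replicate (Suc p) 4 @ replicate (Suc q) 2 @ [1]) ([N]) \<longleftrightarrow> frob (replicate (Suc p) 4 @ replicate (Suc q) 2) ([1, N - 2])"
    using frob_right_wide[where x = 1 and y = "N" and a = "replicate (Suc p) 4 @ replicate (Suc q) 2" and b = "[]"] N
    by (simp add: replicate_append_same)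
  also have "\<dots> \<longleftrightarrow> frob (replicate (Suc p) 4 @ replicate q 2) ([1, 2, N - 6])"
    using frob_right_wide[where x = 2 and y = "N - 2" and a = "replicate (Suc p) 4 @ replicate q 2" and b = "[1]"] N
    by (simp add: replicate_append_same)
  also have "\<dots> \<longleftrightarrow> frob ([2, 1] @ replicate p 4 @ replicate q 2) ([2, N - 6])"
    using frob_wide'[where x = 4 and y = 1 and a = "replicate p 4 @ replicate q 2" and b = "[2, N - 6]"] N
    by (simp add: replicate_append_same)
  also have "\<dots> \<longleftrightarrow> False"
    using frob_equal[of 2 "[1] @ replicate p 4 @ replicate q 2" "[N - 6]"] by simp
  finally show ?thesis by simp
qed

lemma not_frob_4s_3_2s:
  assumes N: "N = 4 * p + 2 * q + 11"
  shows "\<not> frob (replicate (Suc p) 4 @ [3] @ replicate (Suc (Suc q)) 2) ([N])"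
proof -
  have "frob (replicate (Suc p) 4 @ [3] @ replicate (Suc (Suc q)) 2) ([N]) \<longleftrightarrow> frob (replicate (Suc p) 4 @ [3] @ replicate (Suc q) 2) ([2, N - 4])"
    using frob_right_wide[where x = 2 and y = "N" and a = "replicate (Suc p) 4 @ [3] @ replicate (Suc q) 2" and b = "[]"] N
    by (simp add: replicate_append_same)
  also have "\<dots> \<longleftrightarrow> frob (replicate (Suc p) 4 @ [3] @ replicate q 2) ([2, 2, N - 8])"
    using frob_right_wide[where x = 2 and y = "N - 4" and a = "replicate (Suc p) 4 @ [3] @ replicate q 2" and b = "[2]"] N
    by (simp add: replicate_append_same)
  also have "\<dots> \<longleftrightarrow> frob ([2] @ replicate p 4 @ [3] @ replicate q 2) ([2, N - 8])"
    using frob_wide'[where x = 4 and y = 2 and a = "replicate p 4 @ [3] @ replicate q 2" and b = "[2, N - 8]"] N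
    by (simp add: replicate_append_same)
  also have "\<dots> \<longleftrightarrow> False"
    using frob_equal[of 2 "replicate p 4 @ [3] @ replicate q 2" "[N - 8]"] by simp
  finally show ?thesis by simp
qed

lemma not_frob_4s_3_2s_1:
  assumes N: "N = 4 * p + 2 * q + 10"
  shows "\<not> frob (replicate (Suc p) 4 @ [3] @ replicate (Suc q) 2 @ [1]) ([N])"
proof -
  have "frob (replicate (Suc p) 4 @ [3] @ replicate (Suc q) 2 @ [1]) ([N]) \<longleftrightarrow> frob (replicate (Suc p) 4 @ [3] @ replicate (Suc q) 2) ([1, N - 2])"
    using frob_right_wide[where x = 1 and y = "N" and a = "replicate (Suc p) 4 @ [3] @ replicate (Suc q) 2" and b = "[]"] N
    by (simp add: replicate_append_same)
  also have "\<dots> \<longleftrightarrow> frob (replicate (Suc p) 4 @ [3] @ replicate q 2) ([1, 2, N - 6])"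
    using frob_right_wide[where x = 2 and y = "N - 2" and a = "replicate (Suc p) 4 @ [3] @ replicate q 2" and b = "[1]"] N
    by (simp add: replicate_append_same)
  also have "\<dots> \<longleftrightarrow> frob ([2, 1] @ replicate p 4 @ [3] @ replicate q 2) ([2, N - 6])"
    using frob_wide'[where x = 4 and y = 1 and a = "replicate p 4 @ [3] @ replicate q 2" and b = "[2, N - 6]"] N
    by (simp add: replicate_append_same)
  also have "\<dots> \<longleftrightarrow> False"
    using frob_equal[of 2 "[1] @ replicate p 4 @ [3] @ replicate q 2" "[N - 6]"] by simp
  finally show ?thesis by simp
qed

lemma not_frob_4s_3_1:
  assumes N: "N = 4 * p + 12"
  shows "\<not> frob (replicate (Suc (Suc p)) 4 @ [3, 1]) ([N])"
proof -
  have "frob (replicate (Suc (Suc p)) 4 @ [3, 1]) ([N]) \<longleftrightarrow> frob (replicate (Suc (Suc p)) 4 @ [3]) ([1, N - 2])"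
    using frob_right_wide[where x = 1 and y = "N" and a = "replicate (Suc (Suc p)) 4 @ [3]" and b = "[]"] N
    by (simp add: replicate_append_same)
  also have "\<dots> \<longleftrightarrow> frob (replicate (Suc (Suc p)) 4) ([1, 3, N - 8])"
    using frob_right_wide[where x = 3 and y = "N - 2" and a = "replicate (Suc (Suc p)) 4" and b = "[1]"] N
    by (simp add: replicate_append_same)
  also have "\<dots> \<longleftrightarrow> frob ([2, 1] @ replicate (Suc p) 4) ([3, N - 8])"
    using frob_wide'[where x = 4 and y = 1 and a = "replicate (Suc p) 4" and b = "[3, N - 8]"] N
    by (simp add: replicate_append_same)
  also have "\<dots> \<longleftrightarrow> frob ([1, 1] @ replicate (Suc p) 4) ([2, N - 8])"
    using frob_narrow[where x = 2 and y = 3 and a = "[1] @ replicate (Suc p) 4" and b = "[N - 8]"] N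
    by (simp add: replicate_append_same)
  also have "\<dots> \<longleftrightarrow> frob ([1] @ replicate (Suc p) 4) ([1, N - 8])"
    using frob_wide[where x = 1 and y = 2 and a = "[1] @ replicate (Suc p) 4" and b = "[N - 8]"] N
    by (simp add: replicate_append_same)
  also have "\<dots> \<longleftrightarrow> False"
    using frob_equal[of 1 "replicate (Suc p) 4" "[N - 8]"] N by simp
  finally show ?thesis by simp
qed

lemma not_frob_3_2s_1:
  assumes N: "N = 2 * q + 8"
  shows "\<not> frob ([3] @ replicate (Suc (Suc q)) 2 @ [1]) ([N])"
proof -
  have "frob ([3] @ replicate (Suc (Suc q)) 2 @ [1]) ([N]) \<longleftrightarrow> frob ([3] @ replicate (Suc (Suc q)) 2) ([1, N - 2])"
    using frob_right_wide[where x = 1 and y = "N" and a = "[3] @ replicate (Suc (Suc q)) 2" and b = "[]"] N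
    by (simp add: replicate_append_same)
  also have "\<dots> \<longleftrightarrow> frob ([3] @ replicate (Suc q) 2) ([1, 2, N - 6])"
    using frob_right_wide[where x = 2 and y = "N - 2" and a = "[3] @ replicate (Suc q) 2" and b = "[1]"] N
    by (simp add: replicate_append_same)
  also have "\<dots> \<longleftrightarrow> frob ([1, 1] @ replicate (Suc q) 2) ([2, N - 6])"
    using frob_wide'[where x = 3 and y = 1 and a = "replicate (Suc q) 2" and b = "[2, N - 6]"] N
    by (simp add: replicate_append_same)
  also have "\<dots> \<longleftrightarrow> frob ([1] @ replicate (Suc q) 2) ([1, N - 6])"
    using frob_wide[where x = 1 and y = 2 and a = "[1] @ replicate (Suc q) 2" and b = "[N - 6]"] N
    by (simp add: replicate_append_same)
  also have "\<dots> \<longleftrightarrow> False"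
    using frob_equal[of 1 "replicate (Suc q) 2" "[N - 6]"] N by simp
  finally show ?thesis by simp
qed

lemma not_frob_4s_2s_1_1:
  assumes N: "N = 4 * p + 2 * q + 8" and pos: "8 < N"
  shows "\<not> frob (replicate (Suc p) 4 @ replicate (Suc q) 2 @ [1, 1]) ([N])"
proof -
  have "frob (replicate (Suc p) 4 @ replicate (Suc q) 2 @ [1, 1]) ([N]) \<longleftrightarrow> frob (replicate (Suc p) 4 @ replicate (Suc q) 2 @ [1]) ([1, N - 2])"
    using frob_right_wide[where x = 1 and y = "N" and a = "replicate (Suc p) 4 @ replicate (Suc q) 2 @ [1]" and b = "[]"] N
    by (simp add: replicate_append_same)
  also have "\<dots> \<longleftrightarrow> frob (replicate (Suc p) 4 @ replicate (Suc q) 2) ([1, 1, N - 4])"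
    using frob_right_wide[where x = 1 and y = "N - 2" and a = "replicate (Suc p) 4 @ replicate (Suc q) 2" and b = "[1]"] N
    by (simp add: replicate_append_same)
  also have "\<dots> \<longleftrightarrow> frob (replicate (Suc p) 4 @ replicate q 2) ([1, 1, 2, N - 8])"
    using frob_right_wide[where x = 2 and y = "N - 4" and a = "replicate (Suc p) 4 @ replicate q 2" and b = "[1, 1]"] N
    by (simp add: replicate_append_same)
  also have "\<dots> \<longleftrightarrow> frob ([2, 1] @ replicate p 4 @ replicate q 2) ([1, 2, N - 8])"
    using frob_wide'[where x = 4 and y = 1 and a = "replicate p 4 @ replicate q 2" and b = "[1, 2, N - 8]"] N
    by (simp add: replicate_append_same)
  also have "\<dots> \<longleftrightarrow> frob ([1, 1] @ replicate p 4 @ replicate q 2) ([2, N - 8])"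
    using frob_wide'[where x = 2 and y = 1 and a = "[1] @ replicate p 4 @ replicate q 2" and b = "[2, N - 8]"] N
    by (simp add: replicate_append_same)
  also have "\<dots> \<longleftrightarrow> frob ([1] @ replicate p 4 @ replicate q 2) ([1, N - 8])"
    using frob_wide[where x = 1 and y = 2 and a = "[1] @ replicate p 4 @ replicate q 2" and b = "[N - 8]"] N
    by (simp add: replicate_append_same)
  also have "\<dots> \<longleftrightarrow> False"
    using frob_equal[of 1 "replicate p 4 @ replicate q 2" "[N - 8]"] N pos by simp
  finally show ?thesis by simp
qed

lemma not_frob_2s_1_1:
  assumes N: "N = 2 * q + 4" and pos: "4 < N"
  shows "\<not> frob (replicate (Suc q) 2 @ [1, 1]) ([N])"
proof -
  have "frob (replicate (Suc q) 2 @ [1, 1]) ([N]) \<longleftrightarrow> frob (replicate (Suc q) 2 @ [1]) ([1, N - 2])"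
    using frob_right_wide[where x = 1 and y = "N" and a = "replicate (Suc q) 2 @ [1]" and b = "[]"] N
    by (simp add: replicate_append_same)
  also have "\<dots> \<longleftrightarrow> frob (replicate (Suc q) 2) ([1, 1, N - 4])"
    using frob_right_wide[where x = 1 and y = "N - 2" and a = "replicate (Suc q) 2" and b = "[1]"] N
    by (simp add: replicate_append_same)
  also have "\<dots> \<longleftrightarrow> frob ([1] @ replicate q 2) ([1, N - 4])"
    using frob_wide'[where x = 2 and y = 1 and a = "replicate q 2" and b = "[1, N - 4]"] N
    by (simp add: replicate_append_same)
  also have "\<dots> \<longleftrightarrow> False"
    using frob_equal[of 1 "replicate q 2" "[N - 4]"] N pos by simp
  finally show ?thesis by simp
qed

lemma not_frob_4s_3_3_2s:
  assumes N: "N = 4 * p + 2 * q + 14"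
  shows "\<not> frob (replicate (Suc p) 4 @ [3, 3] @ replicate (Suc (Suc q)) 2) ([N])"
proof -
  have "frob (replicate (Suc p) 4 @ [3, 3] @ replicate (Suc (Suc q)) 2) ([N]) \<longleftrightarrow> frob (replicate (Suc p) 4 @ [3, 3] @ replicate (Suc q) 2) ([2, N - 4])"
    using frob_right_wide[where x = 2 and y = "N" and a = "replicate (Suc p) 4 @ [3, 3] @ replicate (Suc q) 2" and b = "[]"] N
    by (simp add: replicate_append_same)
  also have "\<dots> \<longleftrightarrow> frob (replicate (Suc p) 4 @ [3, 3] @ replicate q 2) ([2, 2, N - 8])"
    using frob_right_wide[where x = 2 and y = "N - 4" and a = "replicate (Suc p) 4 @ [3, 3] @ replicate q 2" and b = "[2]"] N
    by (simp add: replicate_append_same)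
  also have "\<dots> \<longleftrightarrow> frob ([2] @ replicate p 4 @ [3, 3] @ replicate q 2) ([2, N - 8])"
    using frob_wide'[where x = 4 and y = 2 and a = "replicate p 4 @ [3, 3] @ replicate q 2" and b = "[2, N - 8]"] N
    by (simp add: replicate_append_same)
  also have "\<dots> \<longleftrightarrow> False"
    using frob_equal[of 2 "replicate p 4 @ [3, 3] @ replicate q 2" "[N - 8]"] by simp
  finally show ?thesis by simp
qed

lemma not_frob_4s_3_3_2:
  assumes N: "N = 4 * p + 20"
  shows "\<not> frob (replicate (Suc (Suc (Suc p))) 4 @ [3, 3, 2]) ([N])"
proof -
  have "frob (replicate (Suc (Suc (Suc p))) 4 @ [3, 3, 2]) ([N]) \<longleftrightarrow> frob (replicate (Suc (Suc (Suc p))) 4 @ [3, 3]) ([2, N - 4])"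
    using frob_right_wide[where x = 2 and y = "N" and a = "replicate (Suc (Suc (Suc p))) 4 @ [3, 3]" and b = "[]"] N
    by (simp add: replicate_append_same)
  also have "\<dots> \<longleftrightarrow> frob ([2] @ replicate (Suc (Suc p)) 4 @ [3, 3]) ([N - 4])"
    using frob_wide'[where x = 4 and y = 2 and a = "replicate (Suc (Suc p)) 4 @ [3, 3]" and b = "[N - 4]"] N
    by (simp add: replicate_append_same)
  also have "\<dots> \<longleftrightarrow> frob ([2] @ replicate (Suc (Suc p)) 4 @ [3]) ([3, N - 10])"
    using frob_right_wide[where x = 3 and y = "N - 4" and a = "[2] @ replicate (Suc (Suc p)) 4 @ [3]" and b = "[]"] N
    by (simp add: replicate_append_same)
  also have "\<dots> \<longleftrightarrow> frob ([2] @ replicate (Suc (Suc p)) 4) ([3, 3, N - 16])"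
    using frob_right_wide[where x = 3 and y = "N - 10" and a = "[2] @ replicate (Suc (Suc p)) 4" and b = "[3]"] N
    by (simp add: replicate_append_same)
  also have "\<dots> \<longleftrightarrow> frob ([1] @ replicate (Suc (Suc p)) 4) ([2, 3, N - 16])"
    using frob_narrow[where x = 2 and y = 3 and a = "replicate (Suc (Suc p)) 4" and b = "[3, N - 16]"] N
    by (simp add: replicate_append_same)
  also have "\<dots> \<longleftrightarrow> frob (replicate (Suc (Suc p)) 4) ([1, 3, N - 16])"
    using frob_wide[where x = 1 and y = 2 and a = "replicate (Suc (Suc p)) 4" and b = "[3, N - 16]"] N
    by (simp add: replicate_append_same)
  also have "\<dots> \<longleftrightarrow> frob ([2, 1] @ replicate (Suc p) 4) ([3, N - 16])"
    using frob_wide'[where x = 4 and y = 1 and a = "replicate (Suc p) 4" and b = "[3, N - 16]"] N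
    by (simp add: replicate_append_same)
  also have "\<dots> \<longleftrightarrow> frob ([1, 1] @ replicate (Suc p) 4) ([2, N - 16])"
    using frob_narrow[where x = 2 and y = 3 and a = "[1] @ replicate (Suc p) 4" and b = "[N - 16]"] N
    by (simp add: replicate_append_same)
  also have "\<dots> \<longleftrightarrow> frob ([1] @ replicate (Suc p) 4) ([1, N - 16])"
    using frob_wide[where x = 1 and y = 2 and a = "[1] @ replicate (Suc p) 4" and b = "[N - 16]"] N
    by (simp add: replicate_append_same)
  also have "\<dots> \<longleftrightarrow> False"
    using frob_equal[of 1 "replicate (Suc p) 4" "[N - 16]"] N by simp
  finally show ?thesis by simp
qed

lemma not_frob_3_3_2s:
  assumes N: "N = 2 * q + 14"
  shows "\<not> frob ([3, 3] @ replicate (Suc (Suc (Suc (Suc q)))) 2) ([N])"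
proof -
  have "frob ([3, 3] @ replicate (Suc (Suc (Suc (Suc q)))) 2) ([N]) \<longleftrightarrow> frob ([3, 3] @ replicate (Suc (Suc (Suc q))) 2) ([2, N - 4])"
    using frob_right_wide[where x = 2 and y = "N" and a = "[3, 3] @ replicate (Suc (Suc (Suc q))) 2" and b = "[]"] N
    by (simp add: replicate_append_same)
  also have "\<dots> \<longleftrightarrow> frob ([3, 3] @ replicate (Suc (Suc q)) 2) ([2, 2, N - 8])"
    using frob_right_wide[where x = 2 and y = "N - 4" and a = "[3, 3] @ replicate (Suc (Suc q)) 2" and b = "[2]"] N
    by (simp add: replicate_append_same)
  also have "\<dots> \<longleftrightarrow> frob ([2, 3] @ replicate (Suc (Suc q)) 2) ([1, 2, N - 8])"
    using frob_narrow'[where x = 3 and y = 2 and a = "[3] @ replicate (Suc (Suc q)) 2" and b = "[2, N - 8]"] N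
    by (simp add: replicate_append_same)
  also have "\<dots> \<longleftrightarrow> frob ([1, 3] @ replicate (Suc (Suc q)) 2) ([2, N - 8])"
    using frob_wide'[where x = 2 and y = 1 and a = "[3] @ replicate (Suc (Suc q)) 2" and b = "[2, N - 8]"] N
    by (simp add: replicate_append_same)
  also have "\<dots> \<longleftrightarrow> frob ([3] @ replicate (Suc (Suc q)) 2) ([1, N - 8])"
    using frob_wide[where x = 1 and y = 2 and a = "[3] @ replicate (Suc (Suc q)) 2" and b = "[N - 8]"] N
    by (simp add: replicate_append_same)
  also have "\<dots> \<longleftrightarrow> frob ([1, 1] @ replicate (Suc (Suc q)) 2) ([N - 8])"
    using frob_wide'[where x = 3 and y = 1 and a = "replicate (Suc (Suc q)) 2" and b = "[N - 8]"] N
    by (simp add: replicate_append_same)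
  also have "\<dots> \<longleftrightarrow> frob ([1, 1] @ replicate (Suc q) 2) ([2, N - 12])"
    using frob_right_wide[where x = 2 and y = "N - 8" and a = "[1, 1] @ replicate (Suc q) 2" and b = "[]"] N
    by (simp add: replicate_append_same)
  also have "\<dots> \<longleftrightarrow> frob ([1] @ replicate (Suc q) 2) ([1, N - 12])"
    using frob_wide[where x = 1 and y = 2 and a = "[1] @ replicate (Suc q) 2" and b = "[N - 12]"] N
    by (simp add: replicate_append_same)
  also have "\<dots> \<longleftrightarrow> False"
    using frob_equal[of 1 "replicate (Suc q) 2" "[N - 12]"] N by simp
  finally show ?thesis by simp
qed

section \<open>Seaweed algebras as matrices with prescribed support\<close>

lemma mem_coord_span:
  assumes I: "I \<subseteq> {..<n}"
  shows "coord_span n I = {v \<in> carrier_vec n. \<forall>i<n. i \<notin> I \<longrightarrow> v $ i = 0}" (is "_ = ?W")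
proof
  interpret vec_module "TYPE(complex)" n .
  have "submodule class_ring ?W V"
    unfolding submodule_def using I
    by (auto simp: module_vec_simps module_axioms)
  then show "coord_span n I \<subseteq> ?W"
    unfolding coord_span_def by (intro span_is_subset) (use I in \<open>auto simp: unit_vec_def\<close>)
  show "?W \<subseteq> coord_span n I"
  proof
    fix v assume v: "v \<in> ?W"
    have "finite I" using I finite_subset by blast
    have "vec n (\<lambda>i. if i \<in> J then v $ i else 0) \<in> coord_span n I" if "finite J" "J \<subseteq> I" for J
      using that
    proof (induction J rule: finite_induct)
      case empty
      have "vec n (\<lambda>i. if i \<in> {} then v $ i else 0) = 0\<^sub>v n" by auto
      then show ?case using coord_span_closed(2)[OF I] by simp
    next
      case (insert j J)
      have "unit_vec n ` I \<subseteq> carrier_vec n" by auto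
      then have "unit_vec n ` I \<subseteq> coord_span n I"
        unfolding coord_span_def using in_own_span by simp
      then have "unit_vec n j \<in> coord_span n I" using insert by auto
      then have "vec n (\<lambda>i. if i \<in> J then v $ i else 0) + v $ j \<cdot>\<^sub>v unit_vec n j \<in> coord_span n I"
        using insert coord_span_closed(3,4)[OF I] by auto
      moreover have "vec n (\<lambda>i. if i \<in> J then v $ i else 0) + v $ j \<cdot>\<^sub>v unit_vec n j
          = vec n (\<lambda>i. if i \<in> insert j J then v $ i else 0)"
        by (rule eq_vecI) (use insert in \<open>auto simp: unit_vec_def\<close>)
      ultimately show ?case by simp
    qed
    from this[OF \<open>finite I\<close> subset_refl] have "vec n (\<lambda>i. if i \<in> I then v $ i else 0) \<in> coord_span n I" by simp
    moreover have "vec n (\<lambda>i. if i \<in> I then v $ i else 0) = v"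
      by (rule eq_vecI) (use v in auto)
    ultimately show "v \<in> coord_span n I" by simp
  qed
qed

lemma preserves_coord_span:
  assumes I: "I \<subseteq> {..<n}" and A: "A \<in> carrier_mat n n"
  shows "preserves A (coord_span n I) \<longleftrightarrow> (\<forall>k<n. \<forall>l<n. l \<in> I \<longrightarrow> k \<notin> I \<longrightarrow> A $$ (k, l) = 0)"
proof
  assume p: "preserves A (coord_span n I)"
  show "\<forall>k<n. \<forall>l<n. l \<in> I \<longrightarrow> k \<notin> I \<longrightarrow> A $$ (k, l) = 0"
  proof (intro allI impI)
    fix k l assume kl: "k < n" "l < n" "l \<in> I" "k \<notin> I"
    have "unit_vec n l \<in> coord_span n I" using kl by (auto simp: mem_coord_span[OF I] unit_vec_def)
    then have "A *\<^sub>v unit_vec n l \<in> coord_span n I" using p unfolding preserves_def by blast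
    then have "(A *\<^sub>v unit_vec n l) $ k = 0" using kl by (simp add: mem_coord_span[OF I])
    then show "A $$ (k, l) = 0" using A kl by simp
  qed
next
  assume z: "\<forall>k<n. \<forall>l<n. l \<in> I \<longrightarrow> k \<notin> I \<longrightarrow> A $$ (k, l) = 0"
  show "preserves A (coord_span n I)"
    unfolding preserves_def
  proof
    fix v assume v: "v \<in> coord_span n I"
    have "(A *\<^sub>v v) $ k = 0" if k: "k < n" "k \<notin> I" for k
    proof -
      have "(A *\<^sub>v v) $ k = (\<Sum>l<n. A $$ (k, l) * v $ l)"
        using A v k by (auto simp: mem_coord_span[OF I] scalar_prod_def atLeast0LessThan)
      also have "\<dots> = 0"
        by (rule sum.neutral) (use z v k in \<open>auto simp: mem_coord_span[OF I]\<close>)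
      finally show ?thesis .
    qed
    then show "A *\<^sub>v v \<in> coord_span n I" using A v by (auto simp: mem_coord_span[OF I])
  qed
qed

lemma cuts_take: "cuts a = (\<lambda>i. sum_list (take i a)) ` {..length a}"
proof (induction a)
  case (Cons x a)
  have "{..length (x # a)} = insert 0 (Suc ` {..length a})"
    by (simp add: atMost_Suc_eq_insert_0)
  then show ?case by (simp add: Cons.IH image_image)
qed simp

lemma seaweed_supported:
  assumes a: "sum_list a = n" and b: "sum_list b = n"
  shows "seaweed n a b = {A \<in> sl n. supported {..<n} (allowed (cuts a) (cuts b)) (\<lambda>i j. A $$ (i, j))}"
proof -
  have "(\<forall>i\<le>length a. preserves A (upper_flag n a i)) \<and> (\<forall>j\<le>length b. preserves A (lower_flag n b j))
      \<longleftrightarrow> supported {..<n} (allowed (cuts a) (cuts b)) (\<lambda>i j. A $$ (i, j))" if A: "A \<in> carrier_mat n n" for A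
  proof -
    have u: "(\<forall>i\<le>length a. preserves A (upper_flag n a i))
        \<longleftrightarrow> (\<forall>c\<in>cuts a. \<forall>k<n. \<forall>l<n. l < c \<longrightarrow> \<not> k < c \<longrightarrow> A $$ (k, l) = 0)"
      using flags_coord_span(1)[OF a] A
      by (auto simp: upper_flag_def preserves_coord_span cuts_take)
    have l: "(\<forall>j\<le>length b. preserves A (lower_flag n b j))
        \<longleftrightarrow> (\<forall>c\<in>cuts b. \<forall>k<n. \<forall>l<n. \<not> l < c \<longrightarrow> k < c \<longrightarrow> A $$ (k, l) = 0)"
      using flags_coord_span(2)[OF b] A
      by (auto simp add: lower_flag_def preserves_coord_span cuts_take not_less)
    show ?thesis unfolding u l supported_def allowed_def by (simp only: lessThan_iff Ball_def) blast
  qed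
  then show ?thesis unfolding seaweed_def sl_def by blast
qed

text \<open>
  The dimension is a least size of finite generating sets, so that dimension 0 is informative only for
  a space known to have one. Generators are found by letting the permitted positions of nonzero
  entries grow one at a time; each step needs at most one new generator.
\<close>

lemma mat_subspace_fin_dim:
  assumes W: "subspace class_ring W (module_mat TYPE(complex) n n)"
  shows "vectorspace.fin_dim class_ring ((module_mat TYPE(complex) n n)\<lparr>carrier := W\<rparr>)"
proof -
  let ?V = "(module_mat TYPE(complex) n n)\<lparr>carrier := W\<rparr>"
  interpret V0: vectorspace "class_ring :: complex ring" "module_mat TYPE(complex) n n"
    by (rule matrix_vs)
  have "vectorspace class_ring ?V" by (rule V0.subspace_is_vs[OF W])
  then interpret V: vectorspace "class_ring :: complex ring" ?V .
  have Wc: "W \<subseteq> carrier_mat n n" and Wadd: "\<And>x y. x \<in> W \<Longrightarrow> y \<in> W \<Longrightarrow> x + y \<in> W"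
    and Wsm: "\<And>c x. x \<in> W \<Longrightarrow> c \<cdot>\<^sub>m x \<in> W"
    using W unfolding subspace_def submodule_def by (auto simp: module_mat_simps)
  have "\<exists>G. finite G \<and> G \<subseteq> W \<and> {x \<in> W. \<forall>k<n. \<forall>l<n. (k, l) \<notin> S \<longrightarrow> x $$ (k, l) = 0} \<subseteq> V.span G"
    if "finite S" for S
    using that
  proof (induction S rule: finite_induct)
    case empty
    have "x = 0\<^sub>m n n" if "x \<in> W" "\<forall>k<n. \<forall>l<n. x $$ (k, l) = 0" for x
      using that Wc by (intro eq_matI) auto
    then have "{x \<in> W. \<forall>k<n. \<forall>l<n. (k, l) \<notin> {} \<longrightarrow> x $$ (k, l) = 0} \<subseteq> V.span {}"
      by (auto simp: V.span_empty module_mat_simps)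
    then show ?case by blast
  next
    case (insert p S)
    obtain i j where p: "p = (i, j)" by (cases p)
    obtain G where G: "finite G" "G \<subseteq> W"
      and GS: "{x \<in> W. \<forall>k<n. \<forall>l<n. (k, l) \<notin> S \<longrightarrow> x $$ (k, l) = 0} \<subseteq> V.span G"
      using insert by blast
    let ?X = "{x \<in> W. \<forall>k<n. \<forall>l<n. (k, l) \<notin> insert p S \<longrightarrow> x $$ (k, l) = 0}"
    show ?case
    proof (cases "\<exists>w\<in>?X. i < n \<and> j < n \<and> w $$ (i, j) \<noteq> 0")
      case nw: False
      have "x $$ (k, l) = 0" if "x \<in> ?X" "k < n" "l < n" "(k, l) \<notin> S" for x k l
      proof (rule ccontr)
        assume nz: "x $$ (k, l) \<noteq> 0"
        have "(k, l) = p"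
        proof (rule ccontr)
          assume "(k, l) \<noteq> p"
          then have "(k, l) \<notin> insert p S" using that(4) by simp
          then show False using that(1-3) nz by blast
        qed
        then have kl: "k = i" "l = j" using p by auto
        have "i < n \<and> j < n \<and> x $$ (i, j) \<noteq> 0" using kl nz that(2,3) by simp
        then have "\<exists>w\<in>?X. i < n \<and> j < n \<and> w $$ (i, j) \<noteq> 0" using that(1) by (rule bexI)
        with nw show False by contradiction
      qed
      then have "?X \<subseteq> {x \<in> W. \<forall>k<n. \<forall>l<n. (k, l) \<notin> S \<longrightarrow> x $$ (k, l) = 0}"
        by (intro subsetI CollectI conjI allI impI) simp_all
      then show ?thesis using G subset_trans[OF _ GS] by (intro exI[of _ G] conjI) simp_all
    next
      case True
      then obtain w where w: "w \<in> ?X" "i < n" "j < n" "w $$ (i, j) \<noteq> 0" by blast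
      have wG: "insert w G \<subseteq> carrier ?V" using w(1) G(2) by simp
      then have sub: "submodule class_ring (V.span (insert w G)) ?V" by (rule V.span_is_submodule)
      have "?X \<subseteq> V.span (insert w G)"
      proof
        fix x assume x: "x \<in> ?X"
        define c where "c = x $$ (i, j) / w $$ (i, j)"
        have xw: "x \<in> carrier_mat n n" "w \<in> carrier_mat n n" using x w(1) by (simp_all add: subsetD[OF Wc])
        let ?y = "x + (- c) \<cdot>\<^sub>m w"
        have "?y \<in> W" by (intro Wadd Wsm) (use x w(1) in simp_all)
        moreover have "?y $$ (k, l) = 0" if "k < n" "l < n" "(k, l) \<notin> S" for k l
        proof -
          have y: "?y $$ (k, l) = x $$ (k, l) - c * w $$ (k, l)" using xw that(1,2) by simp
          show ?thesis
          proof (cases "(k, l) = p")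
            case True
            then show ?thesis using y w(4) p by (simp add: c_def)
          next
            case False
            then have "(k, l) \<notin> insert p S" using that(3) by simp
            then have "x $$ (k, l) = 0" "w $$ (k, l) = 0" using x w(1) that(1,2) by simp_all
            then show ?thesis using y by simp
          qed
        qed
        ultimately have "?y \<in> {x \<in> W. \<forall>k<n. \<forall>l<n. (k, l) \<notin> S \<longrightarrow> x $$ (k, l) = 0}"
          by (intro CollectI conjI allI impI)
        then have "?y \<in> V.span G" using GS by (rule rev_subsetD)
        moreover have "V.span G \<subseteq> V.span (insert w G)" by (rule V.span_is_monotone) auto
        moreover have "w \<in> V.span (insert w G)" using V.in_own_span[OF wG] by auto
        ultimately have "?y + c \<cdot>\<^sub>m w \<in> V.span (insert w G)"
          using sub unfolding submodule_def by (auto simp: module_mat_simps)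
        moreover have "?y + c \<cdot>\<^sub>m w = x" using xw by (intro eq_matI) auto
        ultimately show "x \<in> V.span (insert w G)" by simp
      qed
      moreover have "finite (insert w G)" "insert w G \<subseteq> W" using G w(1) by simp_all
      ultimately show ?thesis by (intro exI[of _ "insert w G"] conjI)
    qed
  qed
  from this[of "{..<n} \<times> {..<n}"] obtain G where G: "finite G" "G \<subseteq> W" "W \<subseteq> V.span G" by auto
  moreover have "V.span G \<subseteq> W" using V.span_is_subset2[of G] G by simp
  ultimately show ?thesis unfolding V.fin_dim_def by (intro exI[of _ G]) auto
qed

lemma mat_subspace_dim_0:
  assumes W: "subspace class_ring W (module_mat TYPE(complex) n n)"
  shows "vectorspace.dim class_ring ((module_mat TYPE(complex) n n)\<lparr>carrier := W\<rparr>) = 0 \<longleftrightarrow> W = {0\<^sub>m n n}"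
proof -
  let ?V = "(module_mat TYPE(complex) n n)\<lparr>carrier := W\<rparr>"
  interpret V0: vectorspace "class_ring :: complex ring" "module_mat TYPE(complex) n n"
    by (rule matrix_vs)
  have "vectorspace class_ring ?V" by (rule V0.subspace_is_vs[OF W])
  then interpret V: vectorspace "class_ring :: complex ring" ?V .
  have se: "V.span {} = {0\<^sub>m n n}" by (simp add: V.span_empty module_mat_simps)
  show ?thesis
  proof
    assume "V.dim = 0"
    obtain B where B: "finite B" "V.basis B" using V.finite_basis_exists mat_subspace_fin_dim[OF W] by blast
    then have "card B = 0" using V.dim_basis \<open>V.dim = 0\<close> by simp
    then have "V.span {} = W" using B unfolding V.basis_def by auto
    then show "W = {0\<^sub>m n n}" using se by simp
  next
    assume "W = {0\<^sub>m n n}"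
    then have "V.dim \<le> card ({} :: complex mat set)" by (intro V.gen_ge_dim) (use se in auto)
    then show "V.dim = 0" by simp
  qed
qed

section \<open>Index 0 and bricks\<close>

lemma seaweed_space_simps [simp]:
  "carrier (seaweed_space n a b) = seaweed n a b"
  "x \<oplus>\<^bsub>seaweed_space n a b\<^esub> y = x + y"
  "c \<odot>\<^bsub>seaweed_space n a b\<^esub> x = c \<cdot>\<^sub>m x"
  by (simp_all add: seaweed_space_def module_mat_simps)

lemma seaweed_closed:
  assumes "sum_list a = n" "sum_list b = n"
  shows "seaweed n a b \<subseteq> carrier_mat n n" "0\<^sub>m n n \<in> seaweed n a b"
    "x \<in> seaweed n a b \<Longrightarrow> y \<in> seaweed n a b \<Longrightarrow> x + y \<in> seaweed n a b"
    "x \<in> seaweed n a b \<Longrightarrow> c \<cdot>\<^sub>m x \<in> seaweed n a b"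
  using seaweed_subspace[OF assms] unfolding subspace_def submodule_def
  by (auto simp: module_mat_simps)

lemma commutator_linear:
  assumes "x \<in> carrier_mat n n" "y \<in> carrier_mat n n" "z \<in> carrier_mat n n"
  shows "commutator (x + y) z = commutator x z + commutator y z"
    and "commutator (c \<cdot>\<^sub>m x) z = c \<cdot>\<^sub>m commutator x z"
proof -
  have diff_add: "(P + P') - (Q + Q') = (P - Q) + (P' - Q')"
    and diff_smult: "c \<cdot>\<^sub>m P - c \<cdot>\<^sub>m Q = c \<cdot>\<^sub>m (P - Q)"
    if "P \<in> carrier_mat n n" "P' \<in> carrier_mat n n" "Q \<in> carrier_mat n n" "Q' \<in> carrier_mat n n"
    for P P' Q Q' :: "complex mat"
    using that by (auto intro!: eq_matI simp: right_diff_distrib)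
  have "commutator (x + y) z = (x * z + y * z) - (z * x + z * y)"
    using assms by (simp add: commutator_def add_mult_distrib_mat[of _ n n] mult_add_distrib_mat[of _ n n])
  also have "\<dots> = commutator x z + commutator y z"
    unfolding commutator_def using assms by (intro diff_add) simp_all
  finally show "commutator (x + y) z = commutator x z + commutator y z" .
  have "commutator (c \<cdot>\<^sub>m x) z = c \<cdot>\<^sub>m (x * z) - c \<cdot>\<^sub>m (z * x)"
    using assms by (simp add: commutator_def mult_smult_distrib[of _ n n] mult_smult_assoc_mat[of _ n n])
  also have "\<dots> = c \<cdot>\<^sub>m commutator x z"
    unfolding commutator_def using assms by (intro diff_smult[of _ "x * z" _ "x * z"]) simp_all
  finally show "commutator (c \<cdot>\<^sub>m x) z = c \<cdot>\<^sub>m commutator x z" .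
qed

lemma linear_functionals_iff:
  "f \<in> linear_functionals (seaweed_space n a b) \<longleftrightarrow>
    (\<forall>x\<in>seaweed n a b. \<forall>y\<in>seaweed n a b. f (x + y) = f x + f y) \<and>
    (\<forall>c. \<forall>x\<in>seaweed n a b. f (c \<cdot>\<^sub>m x) = c * f x)"
  by (simp add: linear_functionals_def)

lemma form_kernel_subspace:
  assumes s: "sum_list a = n" "sum_list b = n" and f: "f \<in> linear_functionals (seaweed_space n a b)"
  shows "subspace class_ring (form_kernel (seaweed_space n a b) commutator f) (module_mat TYPE(complex) n n)"
proof -
  let ?g = "seaweed n a b"
  note cl = seaweed_closed[OF s]
  have fl: "\<And>x y. x \<in> ?g \<Longrightarrow> y \<in> ?g \<Longrightarrow> f (x + y) = f x + f y" "\<And>c x. x \<in> ?g \<Longrightarrow> f (c \<cdot>\<^sub>m x) = c * f x"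
    using f unfolding linear_functionals_iff by auto
  have K: "form_kernel (seaweed_space n a b) commutator f = {x \<in> ?g. \<forall>y\<in>?g. f (commutator x y) = 0}" (is "_ = ?K")
    by (simp add: form_kernel_def)
  have cr: "x \<in> carrier_mat n n" if "x \<in> ?g" for x using cl(1) that by auto
  have cm: "commutator x y \<in> ?g" if "x \<in> ?g" "y \<in> ?g" for x y
    by (rule seaweed_commutator[OF s that])
  have add: "x + y \<in> ?K" if "x \<in> ?K" "y \<in> ?K" for x y
  proof -
    have "f (commutator (x + y) z) = 0" if z: "z \<in> ?g" for z
      using commutator_linear(1)[of x n y z] fl(1)[of "commutator x z" "commutator y z"] cm cr z
        \<open>x \<in> ?K\<close> \<open>y \<in> ?K\<close> by simp
    then show ?thesis using that cl(3) by simp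
  qed
  have sm: "c \<cdot>\<^sub>m x \<in> ?K" if "x \<in> ?K" for c x
  proof -
    have "f (commutator (c \<cdot>\<^sub>m x) z) = 0" if z: "z \<in> ?g" for z
      using commutator_linear(2)[of x n x z c] fl(2)[of "commutator x z" c] cm cr z \<open>x \<in> ?K\<close> by simp
    then show ?thesis using that cl(4) by simp
  qed
  have zero: "0\<^sub>m n n \<in> ?K"
  proof -
    have "f (commutator (0\<^sub>m n n) z) = 0" if z: "z \<in> ?g" for z
    proof -
      have "commutator (0\<^sub>m n n) z = 0\<^sub>m n n" using cr[OF z] by (simp add: commutator_def)
      also have "0\<^sub>m n n = 0 \<cdot>\<^sub>m (0\<^sub>m n n :: complex mat)" by (intro eq_matI) auto
      finally show ?thesis using fl(2)[OF cl(2), of 0] by simp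
    qed
    then show ?thesis using cl(2) by simp
  qed
  have V: "vectorspace (class_ring :: complex ring) (module_mat TYPE(complex) n n)" by (rule matrix_vs)
  show ?thesis
    unfolding K subspace_def submodule_def
    using V add sm zero cr by (auto simp: vectorspace_def module_mat_simps)
qed

text \<open>
  The index is a minimum over a nonempty set of functionals, so it is 0 iff some form has kernel 0.
\<close>

lemma seaweed_index_0:
  assumes s: "sum_list a = n" "sum_list b = n"
  shows "seaweed_index n a b = 0 \<longleftrightarrow>
    (\<exists>f\<in>linear_functionals (seaweed_space n a b). form_kernel (seaweed_space n a b) commutator f = {0\<^sub>m n n})"
proof -
  let ?L = "seaweed_space n a b"
  let ?d = "\<lambda>f. vectorspace.dim class_ring (?L\<lparr>carrier := form_kernel ?L commutator f\<rparr>)"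
  have d: "?d f = 0 \<longleftrightarrow> form_kernel ?L commutator f = {0\<^sub>m n n}" if "f \<in> linear_functionals ?L" for f
    using mat_subspace_dim_0[OF form_kernel_subspace[OF s that]] by (simp add: seaweed_space_def)
  have "(\<lambda>_. 0) \<in> linear_functionals ?L" by (simp add: linear_functionals_iff)
  then have ex: "\<exists>f\<in>linear_functionals ?L. ?d (\<lambda>_. 0) = ?d f" by blast
  have "seaweed_index n a b = 0 \<longleftrightarrow> (\<exists>f\<in>linear_functionals ?L. 0 = ?d f)"
    unfolding seaweed_index_def lie_index_def
  proof
    assume z: "(LEAST k. \<exists>f\<in>linear_functionals ?L. k = ?d f) = 0"
    show "\<exists>f\<in>linear_functionals ?L. 0 = ?d f"
      using LeastI[of "\<lambda>k. \<exists>f\<in>linear_functionals ?L. k = ?d f", OF ex] unfolding z .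
  next
    assume "\<exists>f\<in>linear_functionals ?L. 0 = ?d f"
    then show "(LEAST k. \<exists>f\<in>linear_functionals ?L. k = ?d f) = 0" by (rule Least_eq_0)
  qed
  then show ?thesis using d by (metis (no_types, lifting))
qed

text \<open>
  This is \<open>tr (F A)\<close>.
\<close>

definition pairing :: "nat \<Rightarrow> (nat \<Rightarrow> nat \<Rightarrow> complex) \<Rightarrow> complex mat \<Rightarrow> complex" where
  "pairing n F A = (\<Sum>i<n. \<Sum>j<n. F i j * A $$ (j, i))"

abbreviation entries :: "complex mat \<Rightarrow> nat \<Rightarrow> nat \<Rightarrow> complex" where
  "entries A \<equiv> \<lambda>i j. A $$ (i, j)"

lemma pairing_commutator:
  assumes x: "x \<in> carrier_mat n n" and y: "y \<in> carrier_mat n n"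
  shows "pairing n F (commutator x y) = (\<Sum>l<n. \<Sum>k<n. comm {..<n} F (entries x) l k * y $$ (k, l))"
proof -
  have e: "(u * v) $$ (i, j) = (\<Sum>k<n. u $$ (i, k) * v $$ (k, j))"
    if "u \<in> carrier_mat n n" "v \<in> carrier_mat n n" "i < n" "j < n" for u v :: "complex mat" and i j
    using that by (auto simp: scalar_prod_def atLeast0LessThan)
  have "pairing n F (commutator x y)
      = (\<Sum>i<n. \<Sum>j<n. F i j * ((\<Sum>k<n. x $$ (j, k) * y $$ (k, i)) - (\<Sum>k<n. y $$ (j, k) * x $$ (k, i))))"
    unfolding pairing_def
  proof (intro sum.cong refl)
    fix i j assume "i \<in> {..<n}" "j \<in> {..<n}"
    then have "commutator x y $$ (j, i) = (x * y) $$ (j, i) - (y * x) $$ (j, i)"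
      using x y by (simp add: commutator_def)
    then show "F i j * commutator x y $$ (j, i)
        = F i j * ((\<Sum>k<n. x $$ (j, k) * y $$ (k, i)) - (\<Sum>k<n. y $$ (j, k) * x $$ (k, i)))"
      using e[OF x y] e[OF y x] \<open>i \<in> {..<n}\<close> \<open>j \<in> {..<n}\<close> by simp
  qed
  also have "\<dots> = (\<Sum>i<n. \<Sum>j<n. \<Sum>k<n. F i j * x $$ (j, k) * y $$ (k, i))
      - (\<Sum>i<n. \<Sum>j<n. \<Sum>k<n. x $$ (k, i) * F i j * y $$ (j, k))"
    by (simp add: right_diff_distrib sum_subtractf sum_distrib_left mult_ac)
  also have "(\<Sum>i<n. \<Sum>j<n. \<Sum>k<n. F i j * x $$ (j, k) * y $$ (k, i))
      = (\<Sum>l<n. \<Sum>k<n. mprod {..<n} F (entries x) l k * y $$ (k, l))"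
    unfolding mprod_def sum_distrib_right by (intro sum.cong refl sum.swap)
  also have "(\<Sum>i<n. \<Sum>j<n. \<Sum>k<n. x $$ (k, i) * F i j * y $$ (j, k))
      = (\<Sum>l<n. \<Sum>k<n. mprod {..<n} (entries x) F l k * y $$ (k, l))"
  proof -
    have "(\<Sum>i<n. \<Sum>j<n. \<Sum>k<n. x $$ (k, i) * F i j * y $$ (j, k))
        = (\<Sum>i<n. \<Sum>k<n. \<Sum>j<n. x $$ (k, i) * F i j * y $$ (j, k))"
      by (intro sum.cong refl sum.swap)
    also have "\<dots> = (\<Sum>k<n. \<Sum>i<n. \<Sum>j<n. x $$ (k, i) * F i j * y $$ (j, k))" by (rule sum.swap)
    also have "\<dots> = (\<Sum>k<n. \<Sum>j<n. \<Sum>i<n. x $$ (k, i) * F i j * y $$ (j, k))"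
      by (intro sum.cong refl sum.swap)
    finally show ?thesis by (simp add: mprod_def sum_distrib_right)
  qed
  finally show ?thesis
    by (simp add: comm_def left_diff_distrib sum_subtractf)
qed

text \<open>
  The elementary matrix at \<open>(k, l)\<close>, projected to trace zero along the identity.
\<close>

definition traceless_unit :: "nat \<Rightarrow> nat \<Rightarrow> nat \<Rightarrow> complex mat" where
  "traceless_unit n k l = mat n n (\<lambda>(i, j).
     (if i = k \<and> j = l then 1 else 0) - (if k = l \<and> i = j then 1 / of_nat n else 0))"

lemma sum_traceless_unit:
  assumes "k < n" "l < n"
  shows "(\<Sum>i<n. \<Sum>j<n. c i j * traceless_unit n k l $$ (j, i))
    = c l k - (if k = l then (\<Sum>i<n. c i i) / of_nat n else 0)"
proof -
  have "(\<Sum>i<n. \<Sum>j<n. c i j * traceless_unit n k l $$ (j, i))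
    = (\<Sum>i<n. \<Sum>j<n. (if j = k then (if i = l then c i k else 0) else 0)
        - (if j = i then (if k = l then c i i / of_nat n else 0) else 0))"
    by (intro sum.cong refl) (auto simp: traceless_unit_def right_diff_distrib)
  also have "\<dots> = (\<Sum>i<n. (if i = l then c i k else 0) - (if k = l then c i i / of_nat n else 0))"
    using assms by (intro sum.cong refl) (simp add: sum_subtractf)
  also have "\<dots> = c l k - (if k = l then (\<Sum>i<n. c i i) / of_nat n else 0)"
    using assms by (simp add: sum_subtractf sum_divide_distrib)
  finally show ?thesis .
qed

lemma traceless_unit_seaweed:
  assumes s: "sum_list a = n" "sum_list b = n" and kl: "k < n" "l < n" "allowed (cuts a) (cuts b) k l"
  shows "traceless_unit n k l \<in> seaweed n a b"
proof -
  have "(\<Sum>i<n. traceless_unit n k l $$ (i, i))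
      = (\<Sum>i<n. (if i = k then (if k = l then 1 else 0) else 0) - (if k = l then 1 / of_nat n else 0))"
    by (intro sum.cong refl) (auto simp: traceless_unit_def)
  also have "\<dots> = 0" using kl by (simp add: sum_subtractf)
  finally have "traceless_unit n k l \<in> sl n" by (simp add: sl_def traceless_unit_def)
  moreover have "supported {..<n} (allowed (cuts a) (cuts b)) (entries (traceless_unit n k l))"
    using kl allowed_refl by (auto simp: supported_def traceless_unit_def split: if_splits)
  ultimately show ?thesis by (simp add: seaweed_supported[OF s])
qed

lemma trace_comm_zero: "(\<Sum>i<n. comm {..<n} F x i i) = 0"
  unfolding comm_def mprod_def sum_subtractf
  by (subst sum.swap) (simp add: mult.commute)

text \<open>
  Testing against the projected elementary matrices shows that a kernel element of the functional
  \<open>tr (F _)\<close> on the seaweed algebra satisfies the equations for the full algebra; the correction by the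
  trace is harmless because commutators have trace zero. A scalar of trace zero is 0.
\<close>

lemma index_zero_if_brick:
  assumes s: "sum_list a = n" "sum_list b = n" and n: "0 < n"
    and F: "brick {..<n} (allowed (cuts a) (cuts b)) F"
  shows "seaweed_index n a b = 0"
proof -
  let ?g = "seaweed n a b" and ?R = "allowed (cuts a) (cuts b)"
  note cl = seaweed_closed[OF s]
  have lin: "pairing n F \<in> linear_functionals (seaweed_space n a b)"
    unfolding linear_functionals_iff
  proof (intro conjI ballI allI)
    fix x y assume "x \<in> ?g" "y \<in> ?g"
    then have "x \<in> carrier_mat n n" "y \<in> carrier_mat n n" using cl(1) by auto
    then show "pairing n F (x + y) = pairing n F x + pairing n F y"
      by (simp add: pairing_def distrib_left sum.distrib)
  next
    fix c x assume "x \<in> ?g"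
    then have "x \<in> carrier_mat n n" using cl(1) by auto
    then show "pairing n F (c \<cdot>\<^sub>m x) = c * pairing n F x"
      by (simp add: pairing_def sum_distrib_left mult.left_commute)
  qed
  have "x = 0\<^sub>m n n" if x: "x \<in> ?g" and k: "\<And>y. y \<in> ?g \<Longrightarrow> pairing n F (commutator x y) = 0" for x
  proof -
    have xc: "x \<in> carrier_mat n n" using x cl(1) by auto
    have "comm {..<n} F (entries x) l k = 0" if kl: "k < n" "l < n" "?R k l" for k l
    proof -
      have t: "traceless_unit n k l \<in> ?g" by (rule traceless_unit_seaweed[OF s kl])
      then have "traceless_unit n k l \<in> carrier_mat n n" using cl(1) by auto
      then have "pairing n F (commutator x (traceless_unit n k l)) = comm {..<n} F (entries x) l k"
        using pairing_commutator[OF xc, of "traceless_unit n k l" F]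
          sum_traceless_unit[OF kl(1,2), of "comm {..<n} F (entries x)"] trace_comm_zero[where F = F and x = "entries x" and n = n]
        by simp
      then show ?thesis using k[OF t] by simp
    qed
    then have "centralizes {..<n} ?R F (entries x)" unfolding centralizes_comm by simp
    moreover have "supported {..<n} ?R (entries x)" using x by (simp add: seaweed_supported[OF s])
    ultimately obtain c where c: "\<And>i j. i < n \<Longrightarrow> j < n \<Longrightarrow> x $$ (i, j) = (if i = j then c else 0)"
      using F unfolding brick_def scalar_on_def by fastforce
    have "(\<Sum>i<n. x $$ (i, i)) = 0" using x by (simp add: seaweed_def sl_def)
    then have "of_nat n * c = 0" using c by simp
    then have "c = 0" using n by simp
    then show ?thesis using c xc by (intro eq_matI) auto
  qed
  moreover have "0\<^sub>m n n \<in> form_kernel (seaweed_space n a b) commutator (pairing n F)"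
    using form_kernel_subspace[OF s lin] unfolding subspace_def submodule_def
    by (auto simp: module_mat_simps)
  ultimately have "form_kernel (seaweed_space n a b) commutator (pairing n F) = {0\<^sub>m n n}"
    by (auto simp: form_kernel_def)
  then show ?thesis using seaweed_index_0[OF s] lin by blast
qed

text \<open>
  A functional on the trace zero matrices is extended by 0 on the identity; then it is determined by
  its values on elementary matrices.
\<close>

lemma functional_is_pairing:
  assumes s: "sum_list a = n" "sum_list b = n" and f: "f \<in> linear_functionals (seaweed_space n a b)"
    and y: "y \<in> seaweed n a b"
  defines "F \<equiv> \<lambda>l k. if allowed (cuts a) (cuts b) k l then f (traceless_unit n k l) else 0"
  shows "f y = pairing n F y"
proof -
  let ?g = "seaweed n a b" and ?R = "allowed (cuts a) (cuts b)"
  note cl = seaweed_closed[OF s]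
  have fl: "\<And>x y. x \<in> ?g \<Longrightarrow> y \<in> ?g \<Longrightarrow> f (x + y) = f x + f y" "\<And>c x. x \<in> ?g \<Longrightarrow> f (c \<cdot>\<^sub>m x) = c * f x"
    using f unfolding linear_functionals_iff by auto
  have yc: "y \<in> carrier_mat n n" and ys: "supported {..<n} ?R (entries y)"
    and ytr: "(\<Sum>i<n. y $$ (i, i)) = 0"
    using y by (auto simp: seaweed_supported[OF s] sl_def)
  define part where "part = (\<lambda>S. mat n n (\<lambda>(i, j). \<Sum>(k, l)\<in>S. y $$ (k, l) * traceless_unit n k l $$ (i, j)))"
  have "part S \<in> ?g \<and> f (part S) = (\<Sum>(k, l)\<in>S. y $$ (k, l) * f (traceless_unit n k l))"
    if "finite S" "S \<subseteq> {(k, l). k < n \<and> l < n \<and> ?R k l}" for S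
    using that
  proof (induction S rule: finite_induct)
    case empty
    have "part {} = 0 \<cdot>\<^sub>m 0\<^sub>m n n" by (intro eq_matI) (auto simp: part_def)
    then show ?case using cl(2) cl(4) fl(2)[OF cl(2), of 0] by auto
  next
    case (insert p S)
    obtain k l where p: "p = (k, l)" "k < n" "l < n" "?R k l" using insert by auto
    have t: "traceless_unit n k l \<in> ?g" by (rule traceless_unit_seaweed[OF s p(2-4)])
    have "part (insert p S) = part S + y $$ (k, l) \<cdot>\<^sub>m traceless_unit n k l"
      using insert(1,2) p(1)
      by (intro eq_matI) (auto simp: part_def traceless_unit_def)
    moreover have "part S \<in> ?g" "f (part S) = (\<Sum>(k, l)\<in>S. y $$ (k, l) * f (traceless_unit n k l))"
      using insert by auto
    ultimately show ?case
      using cl(3)[OF _ cl(4)[OF t]] fl(1)[OF _ cl(4)[OF t]] fl(2)[OF t] insert(1,2) p(1) by simp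
  qed
  note part = this[of "{(k, l). k < n \<and> l < n \<and> ?R k l}"]
  let ?S = "{(k, l). k < n \<and> l < n \<and> ?R k l}"
  have fin: "finite ?S" by (rule finite_subset[of _ "{..<n} \<times> {..<n}"]) auto
  have sum_S: "(\<Sum>(k, l)\<in>?S. y $$ (k, l) * g k l) = (\<Sum>k<n. \<Sum>l<n. y $$ (k, l) * g k l)" for g
  proof -
    have "(\<Sum>(k, l)\<in>?S. y $$ (k, l) * g k l) = (\<Sum>(k, l)\<in>{..<n} \<times> {..<n}. y $$ (k, l) * g k l)"
      by (rule sum.mono_neutral_left) (use ys in \<open>auto simp: supported_def\<close>)
    then show ?thesis by (simp add: sum.cartesian_product)
  qed
  have "part ?S = y"
  proof (rule eq_matI)
    fix i j assume "i < dim_row y" "j < dim_col y"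
    then have ij: "i < n" "j < n" using yc by auto
    have "part ?S $$ (i, j) = (\<Sum>k<n. \<Sum>l<n. y $$ (k, l) * traceless_unit n k l $$ (i, j))"
      using ij sum_S[of "\<lambda>k l. traceless_unit n k l $$ (i, j)"] by (simp add: part_def)
    also have "\<dots> = (\<Sum>k<n. \<Sum>l<n. (if l = j then (if k = i then y $$ (i, j) else 0) else 0)
        - (if l = k then (if i = j then y $$ (k, k) / of_nat n else 0) else 0))"
      using ij by (intro sum.cong refl) (auto simp: traceless_unit_def right_diff_distrib)
    also have "\<dots> = (\<Sum>k<n. (if k = i then y $$ (i, j) else 0) - (if i = j then y $$ (k, k) / of_nat n else 0))"
      using ij by (intro sum.cong refl) (simp add: sum_subtractf)
    also have "\<dots> = y $$ (i, j)"
      using ij ytr by (cases "i = j") (simp_all add: sum_subtractf sum_divide_distrib[symmetric])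
    finally show "part ?S $$ (i, j) = y $$ (i, j)" .
  qed (use yc in \<open>auto simp: part_def\<close>)
  then have "f y = (\<Sum>k<n. \<Sum>l<n. y $$ (k, l) * f (traceless_unit n k l))"
    using part[OF fin] sum_S by simp
  also have "\<dots> = (\<Sum>k<n. \<Sum>l<n. F l k * y $$ (k, l))"
    by (intro sum.cong refl) (use ys in \<open>auto simp: F_def supported_def\<close>)
  also have "\<dots> = pairing n F y" unfolding pairing_def by (rule sum.swap)
  finally show ?thesis .
qed

text \<open>
  Subtracting from a kernel element in the full algebra the scalar with the same trace gives a kernel
  element in the seaweed algebra, which is 0.
\<close>

lemma brick_if_index_zero:
  assumes s: "sum_list a = n" "sum_list b = n" and n: "0 < n" and ind: "seaweed_index n a b = 0"
  shows "has_brick {..<n} (allowed (cuts a) (cuts b))"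
proof -
  let ?g = "seaweed n a b" and ?R = "allowed (cuts a) (cuts b)"
  obtain f where f: "f \<in> linear_functionals (seaweed_space n a b)"
    and ker: "form_kernel (seaweed_space n a b) commutator f = {0\<^sub>m n n}"
    using ind seaweed_index_0[OF s] by blast
  define F where "F = (\<lambda>l k. if ?R k l then f (traceless_unit n k l) else 0)"
  have fp: "f y = pairing n F y" if "y \<in> ?g" for y
    unfolding F_def by (rule functional_is_pairing[OF s f that])
  have "brick {..<n} ?R F"
    unfolding brick_def
  proof (intro allI impI)
    fix x assume xs: "supported {..<n} ?R x" and "centralizes {..<n} ?R F x"
    then have c: "\<And>k l. k < n \<Longrightarrow> l < n \<Longrightarrow> ?R k l \<Longrightarrow> comm {..<n} F x l k = 0"
      unfolding centralizes_comm by simp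
    define t where "t = (\<Sum>i<n. x i i) / of_nat n"
    define x0 where "x0 = mat n n (\<lambda>(i, j). x i j - (if i = j then t else 0))"
    have x0c: "x0 \<in> carrier_mat n n" by (simp add: x0_def)
    have "(\<Sum>i<n. x0 $$ (i, i)) = 0" using n by (simp add: x0_def sum_subtractf t_def)
    then have "x0 \<in> sl n" using x0c by (simp add: sl_def)
    moreover have "supported {..<n} ?R (entries x0)"
      using xs allowed_refl by (auto simp: supported_def x0_def split: if_splits)
    ultimately have x0: "x0 \<in> ?g" by (simp add: seaweed_supported[OF s])
    have com: "comm {..<n} F (entries x0) l k = comm {..<n} F x l k" if "k < n" "l < n" for k l
    proof -
      have "comm {..<n} F (entries x0) l k = comm {..<n} F (\<lambda>i j. x i j - (if i = j then t else 0)) l k"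
        by (rule comm_cong) (use that in \<open>auto simp: x0_def\<close>)
      also have "\<dots> = comm {..<n} F x l k - comm {..<n} F (\<lambda>i j. if i = j then t else 0) l k"
        by (simp add: comm_def mprod_def left_diff_distrib right_diff_distrib sum_subtractf)
      also have "comm {..<n} F (\<lambda>i j. if i = j then t else 0) l k = 0"
        by (rule comm_scalar) (use that in auto)
      finally show ?thesis by simp
    qed
    have "f (commutator x0 y) = 0" if y: "y \<in> ?g" for y
    proof -
      have yc: "y \<in> carrier_mat n n" and ys: "supported {..<n} ?R (entries y)"
        using y by (auto simp: seaweed_supported[OF s] sl_def)
      have "f (commutator x0 y) = pairing n F (commutator x0 y)"
        by (rule fp) (rule seaweed_commutator[OF s x0 y])
      also have "\<dots> = (\<Sum>l<n. \<Sum>k<n. comm {..<n} F (entries x0) l k * y $$ (k, l))"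
        by (rule pairing_commutator[OF x0c yc])
      also have "\<dots> = 0"
      proof (intro sum.neutral ballI)
        fix l k assume "l \<in> {..<n}" "k \<in> {..<n}"
        then show "comm {..<n} F (entries x0) l k * y $$ (k, l) = 0"
          using com[of k l] c[of k l] ys unfolding supported_def by fastforce
      qed
      finally show ?thesis .
    qed
    then have "x0 \<in> form_kernel (seaweed_space n a b) commutator f"
      using x0 by (simp add: form_kernel_def)
    then have z: "x0 = 0\<^sub>m n n" using ker by simp
    have "x i j = (if i = j then t else 0)" if "i < n" "j < n" for i j
    proof -
      have "x0 $$ (i, j) = 0" using z that by simp
      then show ?thesis using that by (simp add: x0_def split: if_splits)
    qed
    then show "scalar_on {..<n} x" unfolding scalar_on_def by auto
  qed
  then show ?thesis unfolding has_brick_def by blast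
qed

lemma frobenius_partition_iff:
  assumes "0 < n"
  shows "frobenius_partition n l \<longleftrightarrow> is_partition n l \<and> frob l [n]"
proof -
  have "seaweed_index n l [n] = 0 \<longleftrightarrow> frob l [n]" if l: "sum_list l = n"
  proof -
    have n: "sum_list [n] = n" by simp
    have "frob l [n] \<longleftrightarrow> has_brick {..<n} (allowed (cuts l) (cuts [n]))"
      unfolding frob_def l n by simp
    then show ?thesis
      using index_zero_if_brick[OF l n assms] brick_if_index_zero[OF l n assms]
      unfolding has_brick_def by metis
  qed
  then show ?thesis
    by (auto simp: frobenius_partition_def is_partition_def is_composition_def)
qed

section \<open>Classification and count\<close>

lemma mem_frobenius_partitions_le:
  assumes "0 < n"
  shows "l \<in> frobenius_partitions_le n d \<longleftrightarrow>
    (\<forall>x\<in>set l. 0 < x \<and> x \<le> d) \<and> sorted_wrt (\<ge>) l \<and> frob l [n]"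
  using frobenius_partition_iff[OF assms, of l]
  by (auto simp: frobenius_partitions_le_def is_partition_def is_composition_def frob_def)

lemma decreasing_le_4:
  assumes "\<forall>x\<in>set l. 0 < x \<and> x \<le> (4 :: nat)" "sorted_wrt (\<ge>) l"
  shows "\<exists>p r q s. l = replicate p 4 @ replicate r 3 @ replicate q 2 @ replicate s 1"
  using assms
proof (induction l)
  case Nil
  show ?case by (metis append_Nil replicate_0)
next
  case (Cons x l)
  then obtain p r q s where l: "l = replicate p 4 @ replicate r 3 @ replicate q 2 @ replicate s 1"
    by auto
  have le: "\<forall>y\<in>set l. y \<le> x" using Cons.prems by simp
  consider "x = 4" | "x = 3" "p = 0" | "x = 2" "p = 0" "r = 0" | "x = 1" "p = 0" "r = 0" "q = 0"
  proof -
    have "x < 4 \<Longrightarrow> p = 0" "x < 3 \<Longrightarrow> r = 0" "x < 2 \<Longrightarrow> q = 0"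
      using le unfolding l by (auto simp: ball_Un)
    moreover have "x = 1 \<or> x = 2 \<or> x = 3 \<or> x = 4" using Cons.prems(1) by auto
    ultimately show ?thesis using that by auto
  qed
  then show ?case
  proof cases
    case 1
    then have "x # l = replicate (Suc p) 4 @ replicate r 3 @ replicate q 2 @ replicate s 1" using l by simp
    then show ?thesis by blast
  next
    case 2
    then have "x # l = replicate 0 4 @ replicate (Suc r) 3 @ replicate q 2 @ replicate s 1" using l by simp
    then show ?thesis by blast
  next
    case 3
    then have "x # l = replicate 0 4 @ replicate 0 3 @ replicate (Suc q) 2 @ replicate s 1" using l by simp
    then show ?thesis by blast
  next
    case 4
    then have "x # l = replicate 0 4 @ replicate 0 3 @ replicate 0 2 @ replicate (Suc s) 1" using l by simp
    then show ?thesis by blast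
  qed
qed

lemma replicate_two: "replicate 2 x = [x, x]"
  by (simp add: numeral_2_eq_2)

text \<open>
  Counting odd parts leaves one part 1 or 3 for odd \<open>n\<close> and two such parts for even \<open>n\<close>; the types ruled
  out one by one above bound the other parts.
\<close>

lemma frob_odd:
  assumes f: "frob (replicate p 4 @ replicate r 3 @ replicate q 2 @ replicate s 1) [n]" and n: "17 \<le> n \<or> p = 0"
    and odd: "odd n"
  shows "r = 0 \<and> s = 1 \<and> (p = 0 \<or> q = 0) \<or> r = 1 \<and> s = 0 \<and> (p = 0 \<or> q \<le> 1)"
proof -
  let ?l = "replicate p (4 :: nat) @ replicate r 3 @ replicate q 2 @ replicate s 1"
  have sum: "n = 4 * p + 3 * r + 2 * q + s" using f by (simp add: frob_def sum_list_replicate)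
  have "0 < sum_list ?l" using f odd by (simp add: frob_def odd_pos)
  then have "r + s + n mod 2 = 2" using frob_odds[OF f] by simp
  then consider "r = 0" "s = 1" | "r = 1" "s = 0" using odd by (auto simp: odd_iff_mod_2_eq_one add_is_1)
  then show ?thesis
  proof cases
    case 1
    have "p = 0 \<or> q = 0"
    proof (rule ccontr)
      assume "\<not> (p = 0 \<or> q = 0)"
      then show False using not_frob_4s_2s_1[of n "p - 1" "q - 1"] f 1 sum by (cases p; cases q) auto
    qed
    then show ?thesis using 1 by blast
  next
    case 2
    have "p = 0 \<or> q \<le> 1"
    proof (rule ccontr)
      assume "\<not> (p = 0 \<or> q \<le> 1)"
      then obtain p' q' where "p = Suc p'" "q = Suc (Suc q')"
        by (metis not0_implies_Suc not_less_eq_eq One_nat_def le0)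
      then show False using not_frob_4s_3_2s[of n p' q'] f 2 sum by simp
    qed
    then show ?thesis using 2 by blast
  qed
qed

lemma frob_even:
  assumes f: "frob (replicate p 4 @ replicate r 3 @ replicate q 2 @ replicate s 1) [n]" and ev: "even n"
    and n: "17 \<le> n \<or> p = 0 \<and> 13 \<le> n \<or> p = 0 \<and> r = 0 \<and> 5 \<le> n"
  shows "q = 0 \<and> (r = 0 \<and> s = 2 \<or> r = 2 \<and> s = 0)"
proof -
  let ?l = "replicate p (4 :: nat) @ replicate r 3 @ replicate q 2 @ replicate s 1"
  have sum: "n = 4 * p + 3 * r + 2 * q + s" using f by (simp add: frob_def sum_list_replicate)
  have "0 < n" using n by auto
  then have "0 < sum_list ?l" using f by (simp add: frob_def)
  then have "r + s + n mod 2 = 2" using frob_odds[OF f] by simp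
  then consider "r = 0" "s = 2" | "r = 1" "s = 1" | "r = 2" "s = 0" using ev by fastforce
  then show ?thesis
  proof cases
    case 1
    have "q = 0"
    proof (rule ccontr)
      assume "q \<noteq> 0"
      then obtain q' where q': "q = Suc q'" by (cases q) auto
      show False
      proof (cases p)
        case 0
        then show False using not_frob_2s_1_1[of n q'] f 1 sum n q' by (auto simp: replicate_two)
      next
        case (Suc p')
        then show False using not_frob_4s_2s_1_1[of n p' q'] f 1 sum n q'
          by (cases "p' = 0") (auto simp: replicate_two)
      qed
    qed
    then show ?thesis using 1 by blast
  next
    case 2
    show ?thesis
    proof (cases "p = 0")
      case True
      then have "2 \<le> q" using sum 2 n by auto
      then obtain q' where "q = 2 + q'" using le_Suc_ex by blast
      then have q': "q = Suc (Suc q')" by simp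
      then show ?thesis using not_frob_3_2s_1[of n q'] f 2 sum True by simp
    next
      case False
      then obtain p' where p': "p = Suc p'" by (cases p) auto
      show ?thesis
      proof (cases q)
        case 0
        then obtain p'' where p'': "p' = Suc p''" using sum 2 n p' by (cases p') auto
        then show ?thesis using not_frob_4s_3_1[of n p''] f 2 sum p' 0 by simp
      next
        case (Suc q')
        then show ?thesis using not_frob_4s_3_2s_1[of n p' q'] f 2 sum p' by simp
      qed
    qed
  next
    case 3
    have "q = 0"
    proof (rule ccontr)
      assume q0: "q \<noteq> 0"
      show False
      proof (cases "p = 0")
        case True
        then have "4 \<le> q" using sum 3 n by auto
        then obtain q' where "q = 4 + q'" using le_Suc_ex by blast
        then have q': "q = Suc (Suc (Suc (Suc q')))" by simp
        then show False using not_frob_3_3_2s[of n q'] f 3 sum True q' by (simp add: replicate_two)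
      next
        case False
        then obtain p' where p': "p = Suc p'" by (cases p) auto
        show False
        proof (cases "q = 1")
          case True
          then have "3 \<le> p" using sum 3 n p' by auto
          then obtain p'' where "p = 3 + p''" using le_Suc_ex by blast
          then have "p = Suc (Suc (Suc p''))" by simp
          then show False using not_frob_4s_3_3_2[of n p''] f 3 sum True by (simp add: replicate_two)
        next
          case False
          then obtain q' where q': "q = Suc (Suc q')" using q0 by (metis One_nat_def not0_implies_Suc)
          then show False using not_frob_4s_3_3_2s[of n p' q'] f 3 sum p' by (simp add: replicate_two)
        qed
      qed
    qed
    then show ?thesis using 3 by blast
  qed
qed

lemma frobenius_partition_shape:
  assumes l: "l \<in> frobenius_partitions_le n d" and n: "0 < n" and d: "d \<le> 4"
  obtains p r q s where "l = replicate p 4 @ replicate r 3 @ replicate q 2 @ replicate s 1"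
    and "frob (replicate p 4 @ replicate r 3 @ replicate q 2 @ replicate s 1) [n]"
    and "n = 4 * p + 3 * r + 2 * q + s"
    and "d < 4 \<longrightarrow> p = 0" "d < 3 \<longrightarrow> r = 0" "d < 2 \<longrightarrow> q = 0"
proof -
  have m: "\<forall>x\<in>set l. 0 < x \<and> x \<le> d" "sorted_wrt (\<ge>) l" "frob l [n]"
    using l mem_frobenius_partitions_le[OF n] by auto
  then obtain p r q s where l': "l = replicate p 4 @ replicate r 3 @ replicate q 2 @ replicate s 1"
    using decreasing_le_4[of l] d by fastforce
  have "d < 4 \<longrightarrow> p = 0" "d < 3 \<longrightarrow> r = 0" "d < 2 \<longrightarrow> q = 0"
    using m(1) unfolding l' by (force simp: ball_Un)+
  moreover have "n = 4 * p + 3 * r + 2 * q + s"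
    using m(3) unfolding l' by (simp add: frob_def sum_list_replicate)
  ultimately show ?thesis using that l' m(3) by blast
qed

lemma card_frobenius_partitions_le_1:
  assumes n: "3 \<le> n"
  shows "card (frobenius_partitions_le n 1) = 0"
proof -
  have False if l: "l \<in> frobenius_partitions_le n 1" for l
  proof -
    have "0 < n" "(1 :: nat) \<le> 4" using n by auto
    from frobenius_partition_shape[OF l this] obtain p r q s where
      f: "frob (replicate p 4 @ replicate r 3 @ replicate q 2 @ replicate s 1) [n]"
      and s: "n = 4 * p + 3 * r + 2 * q + s"
      and z: "(1 :: nat) < 4 \<longrightarrow> p = 0" "(1 :: nat) < 3 \<longrightarrow> r = 0" "(1 :: nat) < 2 \<longrightarrow> q = 0" by metis
    have "p = 0" "r = 0" "q = 0" using z by simp_all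
    then show False using frob_odds[OF f] s n by (simp add: sum_list_replicate)
  qed
  then have "frobenius_partitions_le n 1 = {}" by blast
  then show ?thesis by simp
qed

lemma sorted_wrt_replicate: "sorted_wrt (\<ge>) (replicate k (x :: nat))"
  by (induction k) auto

lemma frobenius_partitions_le_3_odd:
  assumes n: "5 \<le> n" "odd n"
  shows "frobenius_partitions_le n 2 = {replicate (n div 2) 2 @ [1]}"
    and "frobenius_partitions_le n 3 = {replicate (n div 2) 2 @ [1], [3] @ replicate (n div 2 - 1) 2}"
proof -
  have n0: "0 < n" using n by simp
  have nd: "2 * (n div 2) + 1 = n" using n by presburger
  have f1: "frob (replicate (n div 2) 2 @ [1]) [n]" using frob_2s_1[of "n div 2"] nd by simp
  have "0 < n div 2 - 1" "2 * (n div 2 - 1) + 3 = n" using n nd by linarith+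
  then have f2: "frob ([3] @ replicate (n div 2 - 1) 2) [n]" using frob_3_2s[of "n div 2 - 1"] by simp
  have shape: "l = replicate (n div 2) 2 @ [1] \<or> d = 3 \<and> l = [3] @ replicate (n div 2 - 1) 2"
    if l: "l \<in> frobenius_partitions_le n d" and d: "d = 2 \<or> d = 3" for l d
  proof -
    have "d \<le> 4" using d by auto
    from frobenius_partition_shape[OF l n0 this] obtain p r q s where
      *: "l = replicate p 4 @ replicate r 3 @ replicate q 2 @ replicate s 1"
      and f: "frob (replicate p 4 @ replicate r 3 @ replicate q 2 @ replicate s 1) [n]"
      and s: "n = 4 * p + 3 * r + 2 * q + s" "d < 4 \<longrightarrow> p = 0" "d < 3 \<longrightarrow> r = 0" by metis
    have p: "p = 0" using s d by auto
    from frob_odd[OF f _ n(2)] p consider "r = 0" "s = 1" | "r = 1" "s = 0" by auto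
    then show ?thesis
    proof cases
      case 1
      then have "n div 2 = q" using s p by simp
      then show ?thesis using * p 1 by simp
    next
      case 2
      then have "n div 2 - 1 = q" using s p by simp
      moreover have "d = 3" using 2 s d by auto
      ultimately show ?thesis using * p 2 by simp
    qed
  qed
  note mem = mem_frobenius_partitions_le[OF n0]
  show "frobenius_partitions_le n 2 = {replicate (n div 2) 2 @ [1]}"
  proof
    show "frobenius_partitions_le n 2 \<subseteq> {replicate (n div 2) 2 @ [1]}" using shape[of _ 2] by auto
  qed (use f1 in \<open>auto simp: mem sorted_wrt_append sorted_wrt_replicate\<close>)
  show "frobenius_partitions_le n 3 = {replicate (n div 2) 2 @ [1], [3] @ replicate (n div 2 - 1) 2}"
  proof
    show "frobenius_partitions_le n 3 \<subseteq> {replicate (n div 2) 2 @ [1], [3] @ replicate (n div 2 - 1) 2}"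
      using shape[of _ 3] by auto
  qed (use f1 f2 in \<open>auto simp: mem sorted_wrt_append sorted_wrt_replicate\<close>)
qed

lemma frobenius_partitions_le_3_even:
  assumes n: "even n" "d = 2 \<and> 5 \<le> n \<or> d = 3 \<and> 13 \<le> n"
  shows "frobenius_partitions_le n d = {}"
proof -
  have False if l: "l \<in> frobenius_partitions_le n d" for l
  proof -
    have "0 < n" "d \<le> 4" using n by auto
    from frobenius_partition_shape[OF l this] obtain p r q s where
      f: "frob (replicate p 4 @ replicate r 3 @ replicate q 2 @ replicate s 1) [n]"
      and s: "n = 4 * p + 3 * r + 2 * q + s" "d < 4 \<longrightarrow> p = 0" "d < 3 \<longrightarrow> r = 0" by metis
    have "p = 0" "d = 2 \<longrightarrow> r = 0" using n s by auto
    then have "q = 0 \<and> (r = 0 \<and> s = 2 \<or> r = 2 \<and> s = 0)" using frob_even[OF f n(1)] n by auto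
    then show False using s n \<open>p = 0\<close> by auto
  qed
  then show ?thesis by blast
qed

lemma frobenius_partitions_le_4:
  assumes n: "17 \<le> n"
  shows "frobenius_partitions_le n 4 =
    (if odd n then {replicate (n div 2) 2 @ [1], [3] @ replicate (n div 2 - 1) 2} else {}) \<union>
    (if n mod 4 = 1 then {replicate (n div 4) 4 @ [1], replicate (n div 4 - 1) 4 @ [3, 2]} else {}) \<union>
    (if n mod 4 = 2 then {replicate (n div 4) 4 @ [1, 1], replicate (n div 4 - 1) 4 @ [3, 3]} else {}) \<union>
    (if n mod 4 = 3 then {replicate (n div 4) 4 @ [3]} else {})" (is "_ = ?S")
proof
  have n0: "0 < n" using n by simp
  note mem = mem_frobenius_partitions_le[OF n0]
  show "frobenius_partitions_le n 4 \<subseteq> ?S"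
  proof
    fix l assume l: "l \<in> frobenius_partitions_le n 4"
    from frobenius_partition_shape[OF l n0] obtain p r q s where
      *: "l = replicate p 4 @ replicate r 3 @ replicate q 2 @ replicate s 1"
      and f: "frob (replicate p 4 @ replicate r 3 @ replicate q 2 @ replicate s 1) [n]"
      and s: "n = 4 * p + 3 * r + 2 * q + s" by (metis order_refl)
    consider "r = 0" "s = 1" "p = 0" "odd n" | "r = 0" "s = 1" "q = 0" "odd n" | "r = 1" "s = 0" "p = 0" "odd n"
      | "r = 1" "s = 0" "q = 0" "odd n" | "r = 1" "s = 0" "q = 1" "odd n"
      | "q = 0" "r = 0" "s = 2" | "q = 0" "r = 2" "s = 0"
      using frob_odd[OF f] frob_even[OF f] n by (cases "odd n") fastforce+
    then show "l \<in> ?S"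
    proof cases
      case 1
      then have "n div 2 = q" using s by simp
      then show ?thesis using * 1 by simp
    next
      case 2
      then have "n div 4 = p" "n mod 4 = 1" using s by simp_all
      then show ?thesis using * 2 by simp
    next
      case 3
      then have "n div 2 - 1 = q" using s by simp
      then show ?thesis using * 3 by simp
    next
      case 4
      then have "n div 4 = p" "n mod 4 = 3" using s by simp_all
      then show ?thesis using * 4 by simp
    next
      case 5
      then have "n = 4 * Suc p + 1" using s by simp
      then have "n div 4 - 1 = p" "n mod 4 = 1" by (simp_all only: div_mult_self4 mod_mult_self4) simp_all
      then show ?thesis using * 5 by simp
    next
      case 6
      then have "n = 4 * p + 2" using s by simp
      then have "n div 4 = p" "n mod 4 = 2" by (simp_all only: div_mult_self4 mod_mult_self4) simp_all
      then show ?thesis using * 6 by (simp add: replicate_two)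
    next
      case 7
      then have "n = 4 * Suc p + 2" using s by simp
      then have "n div 4 - 1 = p" "n mod 4 = 2" by (simp_all only: div_mult_self4 mod_mult_self4) simp_all
      then show ?thesis using * 7 by (simp add: replicate_two)
    qed
  qed
  have n4: "4 * (n div 4) + n mod 4 = n" by simp
  have "3 \<le> n div 4" using n by simp
  then obtain k where "n div 4 = 3 + k" using le_Suc_ex by blast
  then have k: "n div 4 = Suc (Suc (Suc k))" by simp
  have "replicate (n div 4) 4 @ [1] \<in> frobenius_partitions_le n 4" "replicate (n div 4 - 1) 4 @ [3, 2] \<in> frobenius_partitions_le n 4"
    if m: "n mod 4 = 1"
    using frob_4s_1[of "n div 4"] frob_4s_3_2[of k] n4 k m
    by (auto simp: mem sorted_wrt_append sorted_wrt_replicate add.commute)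
  moreover have "replicate (n div 4) 4 @ [1, 1] \<in> frobenius_partitions_le n 4" "replicate (n div 4 - 1) 4 @ [3, 3] \<in> frobenius_partitions_le n 4"
    if m: "n mod 4 = 2"
    using frob_4s_1_1[of "n div 4"] frob_4s_3_3[of k] n4 k m
    by (auto simp: mem sorted_wrt_append sorted_wrt_replicate add.commute)
  moreover have "replicate (n div 4) 4 @ [3] \<in> frobenius_partitions_le n 4" if m: "n mod 4 = 3"
    using frob_4s_3[of "Suc (Suc k)"] n4 k m
    by (auto simp: mem sorted_wrt_append sorted_wrt_replicate add.commute)
  moreover have "{replicate (n div 2) 2 @ [1], [3] @ replicate (n div 2 - 1) 2} \<subseteq> frobenius_partitions_le n 4"
    if m: "odd n"
  proof -
    have "frobenius_partitions_le n 3 \<subseteq> frobenius_partitions_le n 4"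
    proof
      fix l assume "l \<in> frobenius_partitions_le n 3"
      then have l: "\<forall>x\<in>set l. 0 < x \<and> x \<le> 3" "sorted_wrt (\<ge>) l" "frob l [n]" by (simp_all add: mem)
      then have "\<forall>x\<in>set l. 0 < x \<and> x \<le> 4" by force
      then show "l \<in> frobenius_partitions_le n 4" using l by (simp add: mem)
    qed
    then show ?thesis using frobenius_partitions_le_3_odd(2)[of n] that n by auto
  qed
  ultimately show "?S \<subseteq> frobenius_partitions_le n 4" by auto
qed


lemma card_frobenius_partitions_le_2:
  assumes "5 \<le> n"
  shows "card (frobenius_partitions_le n 2) = (if odd n then 1 else 0)"
  using frobenius_partitions_le_3_odd(1)[OF assms] frobenius_partitions_le_3_even[of n 2] assms by simp

lemma card_frobenius_partitions_le_3:
  assumes "13 \<le> n"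
  shows "card (frobenius_partitions_le n 3) = (if odd n then 2 else 0)"
proof (cases "odd n")
  case True
  obtain k where "n div 2 = Suc k" using assms by (cases "n div 2") auto
  then have "replicate (n div 2) (2 :: nat) @ [1] \<noteq> [3] @ replicate (n div 2 - 1) 2" by simp
  then show ?thesis using frobenius_partitions_le_3_odd(2)[of n] assms True by simp
next
  case False
  then show ?thesis using frobenius_partitions_le_3_even[of n 3] assms by simp
qed

lemma card_frobenius_partitions_le_4:
  assumes n: "17 \<le> n"
  shows "card (frobenius_partitions_le n 4)
    = (if n mod 4 = 1 then 4 else if n mod 4 = 2 then 2 else if n mod 4 = 3 then 3 else 0)"
proof -
  have "2 \<le> n div 2" "2 \<le> n div 4" using n by simp_all
  then obtain j k where "n div 2 = 2 + j" "n div 4 = 2 + k" using le_Suc_ex by metis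
  then have jk: "n div 2 = Suc (Suc j)" "n div 4 = Suc (Suc k)" by simp_all
  have last: "xs @ [x] \<noteq> ys @ [y, z]" if "x \<noteq> z" for xs ys and x y z :: nat
    using that by (metis append.assoc append_Cons append_Nil last_snoc)
  have "n mod 4 < 4" by simp
  then consider "n mod 4 = 0" | "n mod 4 = 1" | "n mod 4 = 2" | "n mod 4 = 3" by linarith
  then show ?thesis
  proof cases
    case 1
    then have "even n" by (metis dvd_eq_mod_eq_0 dvd_trans even_numeral)
    then show ?thesis using 1 frobenius_partitions_le_4[OF n] by simp
  next
    case 2
    then have "odd n" by (metis dvd_eq_mod_eq_0 even_numeral mod_mod_cancel odd_one one_mod_two_eq_one mod_by_1 odd_iff_mod_2_eq_one)
    then show ?thesis using 2 frobenius_partitions_le_4[OF n] last[of 1 2 "4 # 4 # replicate k 4" "4 # replicate k 4" 3] jk by simp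
  next
    case 3
    then have "even n" by (metis dvd_eq_mod_eq_0 even_numeral mod_mod_cancel mod_self)
    then show ?thesis using 3 frobenius_partitions_le_4[OF n] last[of 1 3 "4 # 4 # replicate k 4 @ [1]" "4 # replicate k 4" 3] jk by simp
  next
    case 4
    then have "odd n" by (metis dvd_eq_mod_eq_0 even_numeral mod_mod_cancel odd_numeral)
    then show ?thesis using 4 frobenius_partitions_le_4[OF n] jk by simp
  qed
qed

theorem theorem15:
  shows "(\<forall>d\<in>{1, 2, 3, 4}. \<exists>p>0. \<exists>N. \<forall>n\<ge>N.
            card (frobenius_partitions_le (n + p) d) = card (frobenius_partitions_le n d)) \<and>
         (\<forall>n\<ge>3. card (frobenius_partitions_le n 1) = 0) \<and>
         (\<forall>n\<ge>5. (odd n \<longrightarrow> card (frobenius_partitions_le n 2) = 1) \<and>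
                 (even n \<longrightarrow> card (frobenius_partitions_le n 2) = 0)) \<and>
         (\<forall>n\<ge>13. (odd n \<longrightarrow> card (frobenius_partitions_le n 3) = 2) \<and>
                  (even n \<longrightarrow> card (frobenius_partitions_le n 3) = 0)) \<and>
         (\<forall>n\<ge>17. (n mod 4 = 1 \<longrightarrow> card (frobenius_partitions_le n 4) = 4) \<and>
                  (n mod 4 = 2 \<longrightarrow> card (frobenius_partitions_le n 4) = 2) \<and>
                  (n mod 4 = 3 \<longrightarrow> card (frobenius_partitions_le n 4) = 3) \<and>
                  (n mod 4 = 0 \<longrightarrow> card (frobenius_partitions_le n 4) = 0))"
proof -
  have "\<exists>p>0. \<exists>N. \<forall>n\<ge>N. card (frobenius_partitions_le (n + p) d) = card (frobenius_partitions_le n d)"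
    if "d \<in> {1, 2, 3, 4}" for d
  proof -
    have "\<forall>n\<ge>17. card (frobenius_partitions_le (n + 4) d) = card (frobenius_partitions_le n d)"
      using that card_frobenius_partitions_le_1 card_frobenius_partitions_le_2 card_frobenius_partitions_le_3 card_frobenius_partitions_le_4 by auto
    then show ?thesis by (metis zero_less_numeral)
  qed
  then show ?thesis using card_frobenius_partitions_le_1 card_frobenius_partitions_le_2 card_frobenius_partitions_le_3 card_frobenius_partitions_le_4 by simp
qed

end
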